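(* Let $n\ge1$, $d\ge2$ be integers, $s=\lceil2^7e\log(d/\log d)\rceil$, $m=s-1$, and suppose $s\le\sqrt{(n/2)\log2}$. Let $x_1,\dots,x_n\in\mathbb R^d$ be independent observations with $\mathbb E[x_j]=\theta\in\mathbb R^d$, whose noise $\varepsilon_{j,a}=x_{j,a}-\theta_a$ satisfies, for some $\sigma_n>0$, $\mathbb E[\varepsilon_{j,a}\varepsilon_{j,b}]=0$ for $1\le j\le n$, $1\le a<b\le d$, and $\mathbb E[|n^{-1}\sum_{j=1}^n\varepsilon_j'\varepsilon_{j,a}|^{2k}]\le\sigma_n^{2k}2^{k-1}k!$ for $1\le a\le d$, $1\le k\le s$, where $(\varepsilon_j')$ is a Rademacher sequence independent of the noise. Let $f_0(x)=|x|$, $h=\sigma_n/\sqrt{\log(d/\log d)}$, $f_h(x)=\int h^{-1}K((x-t)/h)f_0(t)\,dt$, where the kernel $K$ satisfies, for a constant $C_1$, $$\int K(x)\,dx=1,\qquad\int|x^\ell K(x)|\,dx\le C_1\ (\ell\in\{0,1\}),\qquad2\|K^{(k-2)}\|_{L_\infty}\le C_1\ (2\le k\le s).\tag{A}$$ Let $f(\theta)=\|\theta\|_1/d$ and let $\widehat f$ be the estimator defined in the context. Then $$\mathbb E\big[|\widehat f-f(\theta)|^2\big]\le\big(1+\sqrt{2/\log d}+s^{-1/4}\big)^2\,\frac{C_1^2\sigma_n^2}{\log(d/\log d)}.$$ Moreover, (A) holds when $K$ is the Fourier inversion of a twice continuously differentiable function $Q$ satisfying $$Q(0)=\frac1{\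sqrt{2\pi}},\quad\mathrm{supp}(Q)=[-1,1],\quad\|Q\|_{L_1}\le\frac{C_1}{\sqrt{2/\pi}},\quad\max_{k=0,2}\|Q^{(k)}\|_{L_2}\le\frac{C_1}{\sqrt{2\pi}}.$$
   Context: Estimator: $$\widehat f=\frac1d\sum_{a=1}^d\Big\{f_h(\bar x_a)+\sum_{k=2}^m\frac{f_h^{(k)}(\bar x_a)\,\bar u_a^{(k)}}{k!}\Big\},$$ where $\bar x_a=n^{-1}\sum_{j=1}^nx_{j,a}$ and $\bar u_a^{(k)}=\frac{(n-k)!}{n!}\sum_{1\le j_1\neq\cdots\neq j_k\le n}\prod_{\ell=1}^k(x_{j_\ell,a}-\bar x_a)$ (indices pairwise distinct). Fourier inversion: $K(x)=(2\pi)^{-1/2}\int e^{i\zeta x}Q(\zeta)\,d\zeta$. A Rademacher sequence is an i.i.d. sequence of uniform $\pm1$ signs. $\|\theta\|_1=\sum_{a=1}^d|\theta_a|$. *)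

theory Defs
  imports "HOL-Probability.Probability"
begin

text \<open>Kernels and estimators are complex-valued: the Fourier inversion of a function \<open>Q\<close> that is
  not Hermitian is not real-valued. Real kernels are the special case of values in \<open>\<real>\<close>.\<close>

definition nth_deriv :: "nat \<Rightarrow> (real \<Rightarrow> complex) \<Rightarrow> real \<Rightarrow> complex" where
  "nth_deriv k f = ((\<lambda>g x. vector_derivative g (at x)) ^^ k) f"

definition times_differentiable :: "nat \<Rightarrow> (real \<Rightarrow> complex) \<Rightarrow> bool" where
  "times_differentiable k f \<longleftrightarrow> (\<forall>i<k. \<forall>x. nth_deriv i f differentiable (at x))"

definition smoothing :: "(real \<Rightarrow> complex) \<Rightarrow> real \<Rightarrow> (real \<Rightarrow> real) \<Rightarrow> real \<Rightarrow> complex" where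
  "smoothing K h f0 x =
     (LINT t|lborel. complex_of_real (1 / h) * K ((x - t) / h) * complex_of_real (f0 t))"

definition fourier_inversion :: "(real \<Rightarrow> complex) \<Rightarrow> real \<Rightarrow> complex" where
  "fourier_inversion Q x =
     complex_of_real (1 / sqrt (2 * pi)) *
     (LINT \<zeta>|lborel. exp (\<i> * complex_of_real (\<zeta> * x)) * Q \<zeta>)"

text \<open>The \<open>L\<^sub>\<infinity>\<close> norms involve classical derivatives, so \<open>K\<close> is required to be \<open>s - 2\<close> times
  differentiable everywhere. The integrability clauses say that the integrals are finite;
  the Bochner integral of a non-integrable function is \<open>0\<close>.\<close>

definition kernel_condition :: "real \<Rightarrow> nat \<Rightarrow> (real \<Rightarrow> complex) \<Rightarrow> bool" where
  "kernel_condition C\<^sub>1 s K \<longleftrightarrow>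
     (LINT x|lborel. K x) = 1 \<and>
     (\<forall>l\<in>{0, 1::nat}. integrable lborel (\<lambda>x. complex_of_real (x ^ l) * K x) \<and>
        (LINT x|lborel. norm (complex_of_real (x ^ l) * K x)) \<le> C\<^sub>1) \<and>
     times_differentiable (s - 2) K \<and>
     (\<forall>k\<in>{2..s}. 2 * esssup lborel (\<lambda>x. ereal (norm (nth_deriv (k - 2) K x))) \<le> ereal C\<^sub>1)"

definition fourier_window :: "real \<Rightarrow> (real \<Rightarrow> complex) \<Rightarrow> bool" where
  "fourier_window C\<^sub>1 Q \<longleftrightarrow>
     times_differentiable 2 Q \<and> continuous_on UNIV (nth_deriv 2 Q) \<and>
     Q 0 = complex_of_real (1 / sqrt (2 * pi)) \<and>
     closure {\<zeta>. Q \<zeta> \<noteq> 0} = {-1..1} \<and>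
     (LINT \<zeta>|lborel. norm (Q \<zeta>)) \<le> C\<^sub>1 / sqrt (2 / pi) \<and>
     (\<forall>k\<in>{0, 2}. sqrt (LINT \<zeta>|lborel. (norm (nth_deriv k Q \<zeta>))\<^sup>2) \<le> C\<^sub>1 / sqrt (2 * pi))"

text \<open>Below, \<open>y j\<close> is the \<open>j\<close>-th observed vector, for \<open>j\<close> in \<open>{1..n}\<close>; the coordinates are indexed
  by the finite type \<open>'d\<close>, so the dimension is \<open>CARD('d)\<close>.\<close>

definition sample_mean :: "nat \<Rightarrow> (nat \<Rightarrow> real ^ 'd) \<Rightarrow> 'd \<Rightarrow> real" where
  "sample_mean n y a = (\<Sum>j\<in>{1..n}. y j $ a) / real n"

text \<open>A tuple of pairwise distinct indices \<open>j\<^sub>1, \<dots>, j\<^sub>k\<close> is an injective function \<open>J\<close> on \<open>{1..k}\<close>.\<close>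

definition centered_ustat :: "nat \<Rightarrow> nat \<Rightarrow> (nat \<Rightarrow> real ^ 'd) \<Rightarrow> 'd \<Rightarrow> real" where
  "centered_ustat n k y a =
     fact (n - k) / fact n *
     (\<Sum>J\<in>{J \<in> {1..k} \<rightarrow>\<^sub>E {1..n}. inj_on J {1..k}}.
        \<Prod>l\<in>{1..k}. (y (J l) $ a - sample_mean n y a))"

definition estimator ::
    "nat \<Rightarrow> nat \<Rightarrow> (real \<Rightarrow> complex) \<Rightarrow> (nat \<Rightarrow> real ^ 'd::finite) \<Rightarrow> complex" where
  "estimator n m g y =
     complex_of_real (1 / real CARD('d)) *
     (\<Sum>a\<in>UNIV. g (sample_mean n y a) +
        (\<Sum>k\<in>{2..m}. nth_deriv k g (sample_mean n y a) *
           complex_of_real (centered_ustat n k y a) / fact k))"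

text \<open>In \<open>signs\<close>, the two conditions on probabilities say that each \<open>\<epsilon>' j\<close> is a uniform sign. The
  sequence \<open>\<epsilon>'\<close> lives on the same probability space as the observations, and the sigma-algebras
  generated by the whole sign vector and by the whole noise array are independent (the library's
  \<open>indep_var\<close> needs both variables to have the same type).\<close>

locale noisy_observations = prob_space M
  for M :: "'w measure" +
  fixes n s :: nat
    and \<theta> :: "real ^ 'd::finite"
    and \<sigma> :: real
    and x :: "nat \<Rightarrow> 'w \<Rightarrow> real ^ 'd"
    and \<epsilon>' :: "nat \<Rightarrow> 'w \<Rightarrow> real"
  assumes independent: "indep_vars (\<lambda>_. borel) x {1..n}"
    and mean: "\<And>j. j \<in> {1..n} \<Longrightarrow> integrable M (x j) \<and> expectation (x j) = \<theta>"
    and uncorrelated: "\<And>j a b. j \<in> {1..n} \<Longrightarrow> a \<noteq> b \<Longrightarrow>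
      integrable M (\<lambda>\<omega>. (x j \<omega> $ a - \<theta> $ a) * (x j \<omega> $ b - \<theta> $ b)) \<and>
      expectation (\<lambda>\<omega>. (x j \<omega> $ a - \<theta> $ a) * (x j \<omega> $ b - \<theta> $ b)) = 0"
    and signs_independent: "indep_vars (\<lambda>_. borel) \<epsilon>' {1..n}"
    and signs: "\<And>j. j \<in> {1..n} \<Longrightarrow>
      prob {\<omega> \<in> space M. \<epsilon>' j \<omega> = 1} = 1 / 2 \<and> prob {\<omega> \<in> space M. \<epsilon>' j \<omega> = -1} = 1 / 2"
    and signs_independent_noise:
      "indep_set
         (sets (vimage_algebra (space M) (\<lambda>\<omega>. \<lambda>j\<in>{1..n}. \<epsilon>' j \<omega>) (Pi\<^sub>M {1..n} (\<lambda>_. borel))))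
         (sets (vimage_algebra (space M) (\<lambda>\<omega>. \<lambda>j\<in>{1..n}. x j \<omega> - \<theta>) (Pi\<^sub>M {1..n} (\<lambda>_. borel))))"
    and noise_level: "\<sigma> > 0"
    and moments: "\<And>a k. k \<in> {1..s} \<Longrightarrow>
      integrable M (\<lambda>\<omega>. \<bar>(\<Sum>j\<in>{1..n}. \<epsilon>' j \<omega> * (x j \<omega> $ a - \<theta> $ a)) / real n\<bar> ^ (2 * k)) \<and>
      expectation (\<lambda>\<omega>. \<bar>(\<Sum>j\<in>{1..n}. \<epsilon>' j \<omega> * (x j \<omega> $ a - \<theta> $ a)) / real n\<bar> ^ (2 * k))
        \<le> \<sigma> ^ (2 * k) * 2 ^ (k - 1) * fact k"

end

theory Submission
  imports Defs
begin

text \<open>Write \<open>u\<^sub>k(t)\<close> for the U-statistic of order \<open>k\<close> of the data centred at \<open>t\<close>. Since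
  \<open>u\<^sub>k' = - k u\<^sub>k\<^sub>-\<^sub>1\<close>, the derivative of \<open>F(t) = (\<Sum>k\<le>m. f\<^sub>h\<^sup>(\<^sup>k\<^sup>)(t) u\<^sub>k(t) / k!)\<close> telescopes to
  \<open>f\<^sub>h\<^sup>(\<^sup>s\<^sup>)(t) u\<^sub>m(t) / m!\<close>, and each coordinate of the estimator is \<open>F\<close> at the sample mean. Its error splits
  into the bias of \<open>f\<^sub>h\<close>, at most \<open>C\<^sub>1 h\<close>; the fluctuation \<open>F(\<theta>) - f\<^sub>h(\<theta>)\<close>, an orthogonal sum with
  second moment at most \<open>2 C\<^sub>1\<^sup>2 h\<^sup>2 / log d\<close>; and the remainder \<open>F(xbar) - F(\<theta>)\<close>.

  For the remainder, polarization over random colourings of the sample bounds \<open>|u\<^sub>k(\<theta>)|\<close> by \<open>e\<^sup>k\<close> times an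
  average of \<open>k\<close>-th powers of signed sample means, whose even moments are controlled by the Rademacher
  moments through convexity, without an independent copy of the noise. This gives the second moment
  \<open>(1 + e)\<^sup>2\<^sup>m 8\<^sup>s s! \<sigma>\<^sup>2\<^sup>s\<close> up to a constant, and \<open>8 (1 + e)\<^sup>2 < 2\<^sup>7\<close> leaves an exponentially small factor.

  For the Fourier part, \<open>x\<^sup>2 K(x)\<close> is minus the inversion of \<open>Q''\<close>; Bessel's inequality, obtained by
  Gaussian damping, and the weight \<open>1 / (1 + x\<^sup>2)\<^sup>2\<close> bound the moments of \<open>|K|\<close>.\<close>

section \<open>Elementary symmetric polynomials\<close>

text \<open>The bandwidth makes \<open>exp L = d / ln d\<close> for
  \<open>L = (\<sigma> / h)^2\<close>. The fluctuation has second moment at most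
  \<open>2 (C h)^2 / d\<close> times the exponential series in \<open>L\<close>, so orthogonality
  leaves the factor \<open>1 / ln d\<close>. The remainder gets no such help: orthogonality between
  coordinates holds for products of noise variables, not for the absolute values in the remainder,
  which has to be small in every coordinate. This is what \<open>s \<ge> 128 e L\<close> is for:
  with \<open>s^s \<le> e^s s!\<close> it gives \<open>L^s \<le> s! / 128^s\<close>.

  The moment hypothesis speaks of random signs, whereas the sample mean has all signs 1 and
  polarization produces arbitrary fixed ones. Independence of signs and noise makes the given moment
  an average over all \<open>2^n\<close> sign patterns, so some pattern has a moment that small;
  convexity carries the bound to every pattern at the price \<open>2^(2k+1)\<close>, which together
  with \<open>2^(k-1)\<close> is the source of \<open>8^s\<close>.

  The bound on \<open>s\<close> in terms of \<open>n\<close> keeps U-statistics close to powers of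
  means: it gives \<open>n^k \<le> sqrt 2 * n! / (n - k)!\<close> for \<open>k < s\<close>.\<close>

definition esym :: "'i set \<Rightarrow> nat \<Rightarrow> ('i \<Rightarrow> real) \<Rightarrow> real" where
  "esym I k y = (\<Sum>A | A \<subseteq> I \<and> card A = k. \<Prod>j\<in>A. y j)"

lemma card_bijections_PiE:
  assumes "finite A" "card A = k"
  shows "card {J \<in> {1..k::nat} \<rightarrow>\<^sub>E A. inj_on J {1..k}} = fact k"
proof -
  have "card {f \<in> {1..k} \<rightarrow>\<^sub>E A. inj_on f {1..k}} =
      card A ^ (card {1..k} - card {1..k}) * prod ((-) (card A)) {0..<card {1..k}}"
    using card_inj_on_subset_funcset[of "{1..k}" A "{1..k}"] assms(1) by auto
  also have "\<dots> = prod ((-) k) {0..<k}" using assms by simp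
  also have "\<dots> = fact k" by (simp add: fact_prod_rev)
  finally show ?thesis .
qed

text \<open>Group the injections by their range: every \<open>k\<close>-set is the range of
  \<open>fact k\<close> of them, and the product depends on the range alone.\<close>

lemma sum_inj_eq_fact_esym:
  assumes "finite I"
  shows "(\<Sum>J\<in>{J \<in> {1..k} \<rightarrow>\<^sub>E I. inj_on J {1..k}}. \<Prod>l\<in>{1..k}. y (J l)) = fact k * esym I k y"
proof -
  let ?S = "{J \<in> {1..k} \<rightarrow>\<^sub>E I. inj_on J {1..k}}"
  let ?T = "{A. A \<subseteq> I \<and> card A = k}"
  have fS: "finite ?S" using assms by (simp add: finite_PiE)
  have fT: "finite ?T" using assms by simp
  have im: "(\<lambda>J. J ` {1..k}) ` ?S \<subseteq> ?T"
    by (auto simp: card_image PiE_iff)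
  have "(\<Sum>J\<in>?S. \<Prod>l\<in>{1..k}. y (J l))
      = (\<Sum>A\<in>?T. \<Sum>J\<in>{J \<in> ?S. J ` {1..k} = A}. \<Prod>l\<in>{1..k}. y (J l))"
    by (rule sum.group[OF fS fT im, symmetric])
  also have "\<dots> = (\<Sum>A\<in>?T. fact k * (\<Prod>j\<in>A. y j))"
  proof (rule sum.cong[OF refl])
    fix A assume A: "A \<in> ?T"
    then have fA: "finite A" using assms finite_subset by blast
    have eq: "{J \<in> ?S. J ` {1..k} = A} = {J \<in> {1..k} \<rightarrow>\<^sub>E A. inj_on J {1..k}}"
    proof (intro subset_antisym subsetI)
      fix J assume "J \<in> {J \<in> {1..k} \<rightarrow>\<^sub>E A. inj_on J {1..k}}"
      then have J: "J \<in> {1..k} \<rightarrow>\<^sub>E A" "inj_on J {1..k}" by auto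
      have "J ` {1..k} = A"
        by (rule card_subset_eq[OF fA]) (use J A in \<open>auto simp: card_image PiE_iff\<close>)
      then show "J \<in> {J \<in> ?S. J ` {1..k} = A}" using J A by (auto simp: PiE_iff)
    qed (auto simp: PiE_iff)
    have "(\<Sum>J\<in>{J \<in> ?S. J ` {1..k} = A}. \<Prod>l\<in>{1..k}. y (J l))
        = (\<Sum>J\<in>{J \<in> ?S. J ` {1..k} = A}. \<Prod>j\<in>A. y j)"
    proof (rule sum.cong[OF refl])
      fix J assume J: "J \<in> {J \<in> ?S. J ` {1..k} = A}"
      then have "(\<Prod>j\<in>J ` {1..k}. y j) = (\<Prod>l\<in>{1..k}. y (J l))"
        by (subst prod.reindex) auto
      with J show "(\<Prod>l\<in>{1..k}. y (J l)) = (\<Prod>j\<in>A. y j)" by auto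
    qed
    also have "\<dots> = fact k * (\<Prod>j\<in>A. y j)"
      unfolding eq using card_bijections_PiE[of A k] A fA by simp
    finally show "(\<Sum>J\<in>{J \<in> ?S. J ` {1..k} = A}. \<Prod>l\<in>{1..k}. y (J l)) = fact k * (\<Prod>j\<in>A. y j)" .
  qed
  finally show ?thesis by (simp add: esym_def sum_distrib_left)
qed

lemma card_supersets:
  assumes "finite I" "B \<subseteq> I" "card B \<le> k"
  shows "card {A. B \<subseteq> A \<and> A \<subseteq> I \<and> card A = k} = (card I - card B) choose (k - card B)"
proof -
  have fB: "finite B" using assms finite_subset by blast
  have "bij_betw (\<lambda>A. A - B) {A. B \<subseteq> A \<and> A \<subseteq> I \<and> card A = k} {C. C \<subseteq> I - B \<and> card C = k - card B}"
    by (rule bij_betwI[where g = "\<lambda>C. C \<union> B"])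
       (use assms fB in \<open>auto simp: card_Diff_subset card_Un_disjoint finite_subset
          intro!: trans[OF card_Un_disjoint]\<close>)
  then have "card {A. B \<subseteq> A \<and> A \<subseteq> I \<and> card A = k} = card {C. C \<subseteq> I - B \<and> card C = k - card B}"
    by (rule bij_betw_same_card)
  also have "\<dots> = card (I - B) choose (k - card B)" using assms by (simp add: n_subsets)
  finally show ?thesis using assms fB by (simp add: card_Diff_subset)
qed

text \<open>Expand each product into subsets \<open>B\<close> of its index set and exchange the
  sums; the coefficient counts the \<open>k\<close>-sets that contain a given
  \<open>B\<close>.\<close>

lemma esym_shift:
  assumes I: "finite I"
  shows "esym I k (\<lambda>j. y j + z) =
    (\<Sum>i\<le>k. real ((card I - i) choose (k - i)) * z ^ (k - i) * esym I i y)"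
proof -
  let ?T = "\<lambda>k. {A. A \<subseteq> I \<and> card A = k}"
  have fin: "finite (?T k)" for k using I by simp
  have "esym I k (\<lambda>j. y j + z) = (\<Sum>A\<in>?T k. \<Sum>B\<in>Pow A. (\<Prod>j\<in>B. y j) * z ^ (k - card B))"
    unfolding esym_def
  proof (rule sum.cong[OF refl])
    fix A assume A: "A \<in> ?T k"
    then have fA: "finite A" using I finite_subset by blast
    show "(\<Prod>j\<in>A. y j + z) = (\<Sum>B\<in>Pow A. (\<Prod>j\<in>B. y j) * z ^ (k - card B))"
      unfolding prod_add[OF fA]
      by (rule sum.cong[OF refl]) (use A fA in \<open>auto simp: card_Diff_subset finite_subset\<close>)
  qed
  also have "\<dots> = (\<Sum>A\<in>?T k. \<Sum>B | B \<in> {B. B \<subseteq> I \<and> card B \<le> k} \<and> B \<subseteq> A. (\<Prod>j\<in>B. y j) * z ^ (k - card B))"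
  proof (rule sum.cong[OF refl])
    fix A assume A: "A \<in> ?T k"
    then have "finite A" using I finite_subset by blast
    then have "Pow A = {B. B \<in> {B. B \<subseteq> I \<and> card B \<le> k} \<and> B \<subseteq> A}"
      using A by (auto intro: card_mono)
    then show "(\<Sum>B\<in>Pow A. (\<Prod>j\<in>B. y j) * z ^ (k - card B))
        = (\<Sum>B | B \<in> {B. B \<subseteq> I \<and> card B \<le> k} \<and> B \<subseteq> A. (\<Prod>j\<in>B. y j) * z ^ (k - card B))"
      by simp
  qed
  also have "\<dots> = (\<Sum>B\<in>{B. B \<subseteq> I \<and> card B \<le> k}. \<Sum>A | A \<in> ?T k \<and> B \<subseteq> A. (\<Prod>j\<in>B. y j) * z ^ (k - card B))"
    by (rule sum.swap_restrict) (use I in auto)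
  also have "\<dots> = (\<Sum>B\<in>{B. B \<subseteq> I \<and> card B \<le> k}. real ((card I - card B) choose (k - card B)) * z ^ (k - card B) * (\<Prod>j\<in>B. y j))"
  proof (rule sum.cong[OF refl])
    fix B assume B: "B \<in> {B. B \<subseteq> I \<and> card B \<le> k}"
    have "{A. A \<in> ?T k \<and> B \<subseteq> A} = {A. B \<subseteq> A \<and> A \<subseteq> I \<and> card A = k}" by auto
    then show "(\<Sum>A | A \<in> ?T k \<and> B \<subseteq> A. (\<Prod>j\<in>B. y j) * z ^ (k - card B)) =
      real ((card I - card B) choose (k - card B)) * z ^ (k - card B) * (\<Prod>j\<in>B. y j)"
      using card_supersets[OF I, of B k] B by simp
  qed
  also have "\<dots> = (\<Sum>i\<le>k. \<Sum>B | B \<in> {B. B \<subseteq> I \<and> card B \<le> k} \<and> card B = i.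
      real ((card I - card B) choose (k - card B)) * z ^ (k - card B) * (\<Prod>j\<in>B. y j))"
    by (rule sum.group[symmetric]) (use I in auto)
  also have "\<dots> = (\<Sum>i\<le>k. \<Sum>B\<in>?T i. real ((card I - i) choose (k - i)) * z ^ (k - i) * (\<Prod>j\<in>B. y j))"
    by (intro sum.cong) auto
  finally show ?thesis by (simp add: esym_def sum_distrib_left)
qed

lemma power_sum_PiE:
  fixes f :: "'i \<Rightarrow> 'a::comm_semiring_1"
  assumes "finite I"
  shows "(\<Sum>j\<in>I. f j) ^ k = (\<Sum>J\<in>{1..k} \<rightarrow>\<^sub>E I. \<Prod>l\<in>{1..k}. f (J l))"
  using prod_sum_PiE[of "{1..k}" "\<lambda>_. I" "\<lambda>_. f"] assms by simp

text \<open>The power expands over all \<open>k\<close>-tuples and the left side over the injective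
  ones, so nonnegative terms are dropped. This is what bounds the variance of a U-statistic.\<close>

lemma esym_le_power_sum:
  assumes "finite I" and "\<And>j. j \<in> I \<Longrightarrow> v j \<ge> 0"
  shows "fact k * esym I k v \<le> (\<Sum>j\<in>I. v j) ^ k"
  unfolding sum_inj_eq_fact_esym[OF assms(1), symmetric] power_sum_PiE[OF assms(1)]
proof (rule sum_mono2)
  fix J assume "J \<in> ({1..k} \<rightarrow>\<^sub>E I) - {J \<in> {1..k} \<rightarrow>\<^sub>E I. inj_on J {1..k}}"
  then show "0 \<le> (\<Prod>l\<in>{1..k}. v (J l))"
    using assms(2) by (intro prod_nonneg) (auto simp: PiE_iff)
qed (use assms(1) in \<open>auto simp: finite_PiE\<close>)

text \<open>Expand the power over maps \<open>g\<close> of \<open>{1..k}\<close> to itself. For a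
  permutation the two sign products cancel, and each of the \<open>fact k\<close> permutations gives
  the full product of the \<open>S l\<close>. Any other \<open>g\<close> misses some
  \<open>l0\<close>, and flipping the sign at \<open>l0\<close> negates the summand, so the sum over
  signs is 0.\<close>

lemma polarization:
  fixes S :: "nat \<Rightarrow> real"
  shows "(\<Sum>\<eta>\<in>{1..k} \<rightarrow>\<^sub>E {-1, 1}. (\<Prod>l\<in>{1..k}. \<eta> l) * (\<Sum>l\<in>{1..k}. \<eta> l * S l) ^ k)
     = 2 ^ k * fact k * (\<Prod>l\<in>{1..k}. S l)"
proof -
  let ?E = "{1..k} \<rightarrow>\<^sub>E {-1, 1::real}"
  have fE: "finite ?E" by (simp add: finite_PiE)
  have "(\<Sum>\<eta>\<in>?E. (\<Prod>l\<in>{1..k}. \<eta> l) * (\<Sum>l\<in>{1..k}. \<eta> l * S l) ^ k)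
      = (\<Sum>\<eta>\<in>?E. \<Sum>g\<in>{1..k} \<rightarrow>\<^sub>E {1..k}. ((\<Prod>l\<in>{1..k}. \<eta> l) * (\<Prod>l\<in>{1..k}. \<eta> (g l))) * (\<Prod>l\<in>{1..k}. S (g l)))"
    by (simp add: power_sum_PiE sum_distrib_left prod.distrib mult.assoc)
  also have "\<dots> = (\<Sum>g\<in>{1..k} \<rightarrow>\<^sub>E {1..k}. (\<Sum>\<eta>\<in>?E. (\<Prod>l\<in>{1..k}. \<eta> l) * (\<Prod>l\<in>{1..k}. \<eta> (g l))) * (\<Prod>l\<in>{1..k}. S (g l)))"
    by (subst sum.swap) (simp add: sum_distrib_right)
  also have "\<dots> = (\<Sum>g\<in>{1..k} \<rightarrow>\<^sub>E {1..k}. if inj_on g {1..k} then 2 ^ k * (\<Prod>l\<in>{1..k}. S l) else 0)"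
  proof (rule sum.cong[OF refl])
    fix g assume g: "g \<in> {1..k} \<rightarrow>\<^sub>E {1..k}"
    show "(\<Sum>\<eta>\<in>?E. (\<Prod>l\<in>{1..k}. \<eta> l) * (\<Prod>l\<in>{1..k}. \<eta> (g l))) * (\<Prod>l\<in>{1..k}. S (g l))
        = (if inj_on g {1..k} then 2 ^ k * (\<Prod>l\<in>{1..k}. S l) else 0)"
    proof (cases "inj_on g {1..k}")
      case True
      have im: "g ` {1..k} = {1..k}"
        by (rule endo_inj_surj[OF _ _ True]) (use g in \<open>auto simp: PiE_iff\<close>)
      have re: "(\<Prod>l\<in>{1..k}. f (g l)) = (\<Prod>l\<in>{1..k}. f l)" for f :: "nat \<Rightarrow> real"
        using prod.reindex[OF True, of f] im by simp
      have one: "(\<Prod>l\<in>{1..k}. \<eta> l) * (\<Prod>l\<in>{1..k}. \<eta> l) = 1" if "\<eta> \<in> ?E" for \<eta>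
      proof -
        have "\<eta> l * \<eta> l = 1" if "l \<in> {1..k}" for l
          using \<open>\<eta> \<in> ?E\<close> that by (auto dest!: PiE_mem)
        then show ?thesis by (subst prod.distrib[symmetric]) (simp add: prod.neutral)
      qed
      have c: "card ?E = 2 ^ k" by (simp add: card_PiE numeral_2_eq_2)
      have "(\<Sum>\<eta>\<in>?E. (\<Prod>l\<in>{1..k}. \<eta> l) * (\<Prod>l\<in>{1..k}. \<eta> (g l))) = (\<Sum>\<eta>\<in>?E. 1)"
        by (rule sum.cong[OF refl]) (simp only: re one)
      then have "(\<Sum>\<eta>\<in>?E. (\<Prod>l\<in>{1..k}. \<eta> l) * (\<Prod>l\<in>{1..k}. \<eta> (g l))) = 2 ^ k"
        using c by simp
      then show ?thesis using True by (simp only: re if_True)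
    next
      case False
      then have "g ` {1..k} \<noteq> {1..k}"
        by (metis eq_card_imp_inj_on finite_atLeastAtMost)
      moreover have "g ` {1..k} \<subseteq> {1..k}" using g by (auto simp: PiE_iff)
      ultimately obtain l0 where l0: "l0 \<in> {1..k}" "l0 \<notin> g ` {1..k}" by blast
      let ?t = "\<lambda>\<eta>. (\<Prod>l\<in>{1..k}. \<eta> l) * (\<Prod>l\<in>{1..k}. \<eta> (g l)) :: real"
      have "(\<Sum>\<eta>\<in>?E. ?t \<eta>) = (\<Sum>\<eta>\<in>?E. ?t (\<eta>(l0 := - \<eta> l0)))"
        by (rule sum.reindex_bij_witness[of _ "\<lambda>\<eta>. \<eta>(l0 := - \<eta> l0)" "\<lambda>\<eta>. \<eta>(l0 := - \<eta> l0)"])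
           (use l0 in \<open>auto simp: PiE_iff extensional_def\<close>)
      also have "\<dots> = (\<Sum>\<eta>\<in>?E. - ?t \<eta>)"
      proof (rule sum.cong[OF refl])
        fix \<eta> assume "\<eta> \<in> ?E"
        have "(\<Prod>l\<in>{1..k}. (\<eta>(l0 := - \<eta> l0)) (g l)) = (\<Prod>l\<in>{1..k}. \<eta> (g l))"
          by (rule prod.cong[OF refl]) (use l0 in auto)
        moreover have "(\<Prod>l\<in>{1..k}. (\<eta>(l0 := - \<eta> l0)) l) = - (\<Prod>l\<in>{1..k}. \<eta> l)"
          using l0 by (subst (1 2) prod.remove[of _ l0]) auto
        ultimately show "?t (\<eta>(l0 := - \<eta> l0)) = - ?t \<eta>" by simp
      qed
      finally have "(\<Sum>\<eta>\<in>?E. ?t \<eta>) = 0" by (simp add: sum_negf)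
      then show ?thesis using False by simp
    qed
  qed
  also have "\<dots> = (\<Sum>g\<in>{g \<in> {1..k} \<rightarrow>\<^sub>E {1..k}. inj_on g {1..k}}. 2 ^ k * (\<Prod>l\<in>{1..k}. S l))"
    by (rule sum.inter_filter[symmetric]) (simp add: finite_PiE)
  also have "\<dots> = 2 ^ k * fact k * (\<Prod>l\<in>{1..k}. S l)"
    using card_bijections_PiE[of "{1..k}" k] by simp
  finally show ?thesis .
qed

text \<open>Divided by \<open>k ^ card I\<close> this is an expectation over a uniformly random
  colouring with \<open>k\<close> colours. A tuple \<open>J\<close> survives if \<open>J l\<close>
  has colour \<open>l\<close> for all \<open>l\<close>: impossible when an index is repeated, and
  true of \<open>k ^ (card I - k)\<close> colourings otherwise. It decouples the symmetric
  polynomial into a product of sums over disjoint blocks.\<close>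

lemma colouring_identity:
  fixes y :: "'i \<Rightarrow> real"
  assumes I: "finite I" and k: "k \<le> card I"
  shows "(\<Sum>c\<in>I \<rightarrow>\<^sub>E {1..k}. \<Prod>l\<in>{1..k}. \<Sum>j\<in>I. if c j = l then y j else 0)
     = real k ^ (card I - k) * (fact k * esym I k y)"
proof -
  let ?C = "I \<rightarrow>\<^sub>E {1..k}"
  have fC: "finite ?C" using I by (simp add: finite_PiE)
  have "(\<Sum>c\<in>?C. \<Prod>l\<in>{1..k}. \<Sum>j\<in>I. if c j = l then y j else 0)
     = (\<Sum>c\<in>?C. \<Sum>J\<in>{1..k} \<rightarrow>\<^sub>E I. \<Prod>l\<in>{1..k}. if c (J l) = l then y (J l) else 0)"
    by (subst prod_sum_PiE) (use I in auto)
  also have "\<dots> = (\<Sum>c\<in>?C. \<Sum>J\<in>{1..k} \<rightarrow>\<^sub>E I. (if \<forall>l\<in>{1..k}. c (J l) = l then \<Prod>l\<in>{1..k}. y (J l) else 0))"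
    by (intro sum.cong refl) (auto intro!: prod.cong)
  also have "\<dots> = (\<Sum>J\<in>{1..k} \<rightarrow>\<^sub>E I. \<Sum>c\<in>?C. (if \<forall>l\<in>{1..k}. c (J l) = l then \<Prod>l\<in>{1..k}. y (J l) else 0))"
    by (rule sum.swap)
  also have "\<dots> = (\<Sum>J\<in>{1..k} \<rightarrow>\<^sub>E I. real (card {c\<in>?C. \<forall>l\<in>{1..k}. c (J l) = l}) * (\<Prod>l\<in>{1..k}. y (J l)))"
    unfolding sum.inter_filter[OF fC, symmetric] by simp
  also have "\<dots> = (\<Sum>J\<in>{1..k} \<rightarrow>\<^sub>E I. if inj_on J {1..k} then real k ^ (card I - k) * (\<Prod>l\<in>{1..k}. y (J l)) else 0)"
  proof (rule sum.cong[OF refl])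
    fix J assume J: "J \<in> {1..k} \<rightarrow>\<^sub>E I"
    show "real (card {c\<in>?C. \<forall>l\<in>{1..k}. c (J l) = l}) * (\<Prod>l\<in>{1..k}. y (J l))
      = (if inj_on J {1..k} then real k ^ (card I - k) * (\<Prod>l\<in>{1..k}. y (J l)) else 0)"
    proof (cases "inj_on J {1..k}")
      case True
      let ?A = "J ` {1..k}"
      \<comment> \<open>The colours still allowed at \<open>j\<close>: one on the range of
        \<open>J\<close>, all of them elsewhere. The admissible colourings thus form a product set,
        which is easy to count.\<close>
      define D where "D = (\<lambda>j. if j \<in> ?A then {the_inv_into {1..k} J j} else {1..k})"
      have sub: "?A \<subseteq> I" using J by (auto simp: PiE_iff)
      have inv: "the_inv_into {1..k} J (J l) = l" if "l \<in> {1..k}" for l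
        using the_inv_into_f_f[OF True that] .
      have "{c\<in>?C. \<forall>l\<in>{1..k}. c (J l) = l} = PiE I D"
      proof (intro set_eqI iffI)
        fix c assume c: "c \<in> {c\<in>?C. \<forall>l\<in>{1..k}. c (J l) = l}"
        then show "c \<in> PiE I D"
          unfolding PiE_iff D_def using inv by auto
      next
        fix c assume c: "c \<in> PiE I D"
        have "c (J l) = l" if "l \<in> {1..k}" for l
        proof -
          have "J l \<in> I" "J l \<in> ?A" using that sub by auto
          then have "c (J l) \<in> {the_inv_into {1..k} J (J l)}" using c by (auto simp: PiE_iff D_def)
          then show ?thesis using inv[OF that] by simp
        qed
        moreover have "c j \<in> {1..k}" if "j \<in> I" for j
        proof (cases "j \<in> ?A")
          case True
          then obtain l where "l \<in> {1..k}" "j = J l" by auto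
          then show ?thesis using calculation by auto
        next
          case False
          then show ?thesis using c that by (auto simp: PiE_iff D_def)
        qed
        ultimately show "c \<in> {c\<in>?C. \<forall>l\<in>{1..k}. c (J l) = l}" using c by (auto simp: PiE_iff)
      qed
      then have "card {c\<in>?C. \<forall>l\<in>{1..k}. c (J l) = l} = (\<Prod>j\<in>I. card (D j))"
        using I by (simp add: card_PiE)
      also have "\<dots> = (\<Prod>j\<in>I. if j \<in> ?A then 1 else k)"
        by (intro prod.cong) (auto simp: D_def)
      also have "\<dots> = k ^ card (I - ?A)"
        using I by (simp add: prod.If_cases Diff_eq)
      also have "card (I - ?A) = card I - k"
        using sub True by (subst card_Diff_subset) (auto simp: card_image)
      finally show ?thesis using True by simp
    next
      case False
      then obtain l l' where ll: "l \<in> {1..k}" "l' \<in> {1..k}" "J l = J l'" "l \<noteq> l'"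
        by (auto simp: inj_on_def)
      have "\<not> (\<forall>l\<in>{1..k}. c (J l) = l)" for c
      proof
        assume "\<forall>l\<in>{1..k}. c (J l) = l"
        then have "c (J l) = l" "c (J l') = l'" using ll by blast+
        then show False using ll by simp
      qed
      then have "{c\<in>?C. \<forall>l\<in>{1..k}. c (J l) = l} = {}" by blast
      then have "card {c\<in>?C. \<forall>l\<in>{1..k}. c (J l) = l} = 0" by (simp only: card.empty)
      then show ?thesis using False by (simp only: if_False of_nat_0 mult_zero_left)
    qed
  qed
  also have "\<dots> = real k ^ (card I - k) * (fact k * esym I k y)"
    unfolding sum_inj_eq_fact_esym[OF I, symmetric]
    by (subst sum.inter_filter[symmetric]) (use I in \<open>auto simp: finite_PiE sum_distrib_left\<close>)
  finally show ?thesis .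
qed

text \<open>For a fixed colouring, polarization turns the product of block sums into
  \<open>k\<close>-th powers of a single sum over \<open>I\<close>, whose weights
  \<open>\<eta> (c j)\<close> are again signs; this is the shape that the moment bounds cover. The
  ratio \<open>k^k / k!\<close>, at most \<open>e^k\<close>, is the source of the powers of
  \<open>e\<close>.\<close>

lemma abs_esym_le_average:
  fixes y :: "'i \<Rightarrow> real"
  assumes I: "finite I" and k: "k \<le> card I" "k > 0"
  shows "\<bar>fact k * esym I k y\<bar> \<le> real k ^ k / fact k *
    ((\<Sum>c\<in>I \<rightarrow>\<^sub>E {1..k}. \<Sum>\<eta>\<in>{1..k} \<rightarrow>\<^sub>E {-1, 1}. \<bar>\<Sum>j\<in>I. \<eta> (c j) * y j\<bar> ^ k) / (real k ^ card I * 2 ^ k))"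
proof -
  let ?C = "I \<rightarrow>\<^sub>E {1..k}" and ?E = "{1..k} \<rightarrow>\<^sub>E {-1, 1::real}"
  have "real k ^ (card I - k) * (fact k * esym I k y) * (2 ^ k * fact k)
      = (\<Sum>c\<in>?C. 2 ^ k * fact k * (\<Prod>l\<in>{1..k}. \<Sum>j\<in>I. if c j = l then y j else 0))"
    unfolding colouring_identity[OF I k(1), symmetric] sum_distrib_left[symmetric]
    by (simp add: mult_ac)
  also have "\<dots> = (\<Sum>c\<in>?C. \<Sum>\<eta>\<in>?E. (\<Prod>l\<in>{1..k}. \<eta> l) * (\<Sum>j\<in>I. \<eta> (c j) * y j) ^ k)"
  proof (rule sum.cong[OF refl])
    fix c assume c: "c \<in> ?C"
    have "(\<Sum>l\<in>{1..k}. \<eta> l * (\<Sum>j\<in>I. if c j = l then y j else 0)) = (\<Sum>j\<in>I. \<eta> (c j) * y j)" for \<eta> :: "nat \<Rightarrow> real"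
    proof -
      have "(\<Sum>l\<in>{1..k}. \<eta> l * (\<Sum>j\<in>I. if c j = l then y j else 0))
          = (\<Sum>l\<in>{1..k}. \<Sum>j\<in>I. if c j = l then \<eta> l * y j else 0)"
        by (simp add: sum_distrib_left if_distrib cong: if_cong)
      also have "\<dots> = (\<Sum>j\<in>I. \<Sum>l\<in>{1..k}. if c j = l then \<eta> l * y j else 0)" by (rule sum.swap)
      also have "\<dots> = (\<Sum>j\<in>I. \<eta> (c j) * y j)"
        by (rule sum.cong[OF refl]) (use c in \<open>auto simp: PiE_iff\<close>)
      finally show ?thesis .
    qed
    then show "2 ^ k * fact k * (\<Prod>l\<in>{1..k}. \<Sum>j\<in>I. if c j = l then y j else 0)
       = (\<Sum>\<eta>\<in>?E. (\<Prod>l\<in>{1..k}. \<eta> l) * (\<Sum>j\<in>I. \<eta> (c j) * y j) ^ k)"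
      by (subst polarization[symmetric]) simp
  qed
  finally have eq: "real k ^ (card I - k) * (fact k * esym I k y) * (2 ^ k * fact k) = \<dots>" .
  have "real k ^ (card I - k) * \<bar>fact k * esym I k y\<bar> * (2 ^ k * fact k)
      = \<bar>real k ^ (card I - k) * (fact k * esym I k y) * (2 ^ k * fact k)\<bar>"
    by (simp add: abs_mult)
  also have "\<dots> \<le> (\<Sum>c\<in>?C. \<Sum>\<eta>\<in>?E. \<bar>\<Sum>j\<in>I. \<eta> (c j) * y j\<bar> ^ k)" (is "_ \<le> ?R")
    unfolding eq
  proof (intro order_trans[OF sum_abs] sum_mono)
    fix c \<eta> assume "\<eta> \<in> ?E"
    then have "\<bar>\<eta> l\<bar> = 1" if "l \<in> {1..k}" for l using that by (auto dest!: PiE_mem)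
    then show "\<bar>(\<Prod>l\<in>{1..k}. \<eta> l) * (\<Sum>j\<in>I. \<eta> (c j) * y j) ^ k\<bar> \<le> \<bar>\<Sum>j\<in>I. \<eta> (c j) * y j\<bar> ^ k"
      by (simp add: abs_mult abs_prod power_abs)
  qed
  finally have le: "real k ^ (card I - k) * \<bar>fact k * esym I k y\<bar> * (2 ^ k * fact k) \<le> ?R" .
  have split: "real k ^ card I = real k ^ (card I - k) * real k ^ k"
    using k by (simp flip: power_add)
  have "\<bar>fact k * esym I k y\<bar> \<le> ?R / (real k ^ (card I - k) * (2 ^ k * fact k))"
    using le k by (subst pos_le_divide_eq) (auto simp: mult_ac)
  also have "\<dots> = real k ^ k / fact k * (?R / (real k ^ card I * 2 ^ k))"
    using k unfolding split by (simp add: field_simps)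
  finally show ?thesis .
qed

section \<open>Smoothing kernels\<close>

text \<open>The slope form lets dominated convergence and limits of bounds act on difference
  quotients directly.\<close>

lemma has_vector_derivative_iff_slope:
  fixes f :: "real \<Rightarrow> 'b::real_normed_vector"
  shows "(f has_vector_derivative D) (at x) \<longleftrightarrow> ((\<lambda>y. (f y - f x) /\<^sub>R (y - x)) \<longlongrightarrow> D) (at x)"
proof -
  have "norm (f y - f x - (y - x) *\<^sub>R D) / norm (y - x) = norm ((f y - f x) /\<^sub>R (y - x) - D)"
    if "y \<noteq> x" for y
  proof -
    have "(f y - f x) /\<^sub>R (y - x) - D = (f y - f x - (y - x) *\<^sub>R D) /\<^sub>R (y - x)"
      using that by (simp add: scaleR_diff_right)
    then show ?thesis by (simp add: divide_inverse mult.commute)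
  qed
  then have "((\<lambda>y. norm (f y - f x - (y - x) *\<^sub>R D) / norm (y - x)) \<longlongrightarrow> 0) (at x)
      \<longleftrightarrow> ((\<lambda>y. norm ((f y - f x) /\<^sub>R (y - x) - D)) \<longlongrightarrow> 0) (at x)"
    by (intro tendsto_cong) (auto simp: eventually_at_filter)
  then show ?thesis
    unfolding has_vector_derivative_def has_derivative_iff_norm
    by (simp add: bounded_linear_scaleR_left tendsto_norm_zero_iff LIM_zero_iff)
qed

lemma norm_divideR_le:
  fixes v :: "'b::real_normed_vector"
  assumes "norm v \<le> c * \<bar>r\<bar>" "r \<noteq> 0"
  shows "norm (v /\<^sub>R r) \<le> c"
proof -
  have "inverse \<bar>r\<bar> * norm v \<le> c" using assms by (simp add: field_simps)
  then show ?thesis by (simp only: norm_scaleR abs_inverse)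
qed

text \<open>Dominated convergence for the difference quotients. The derivative is asked for at the
  single point \<open>x\<close> and almost every \<open>\<omega>\<close>, because
  \<open>\<bar>x - h * u\<bar>\<close> has a kink at \<open>u = x / h\<close>, a null set that moves
  with \<open>x\<close>.\<close>

lemma has_vector_derivative_lebesgue_integral:
  fixes f :: "real \<Rightarrow> 'a \<Rightarrow> 'b::{banach, second_countable_topology}"
  assumes int: "\<And>y. integrable M (f y)"
    and w: "integrable M w"
    and bound: "\<And>y. AE \<omega> in M. norm (f y \<omega> - f x \<omega>) \<le> w \<omega> * \<bar>y - x\<bar>"
    and D: "AE \<omega> in M. ((\<lambda>y. f y \<omega>) has_vector_derivative f' \<omega>) (at x)"
    and meas: "f' \<in> borel_measurable M"
  shows "((\<lambda>y. \<integral>\<omega>. f y \<omega> \<partial>M) has_vector_derivative (\<integral>\<omega>. f' \<omega> \<partial>M)) (at x)"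
  unfolding has_vector_derivative_iff_slope tendsto_at_iff_sequentially
proof (intro allI impI)
  fix X :: "nat \<Rightarrow> real"
  assume X: "\<forall>i. X i \<in> UNIV - {x}" "X \<longlonglongrightarrow> x"
  have "(\<lambda>i. \<integral>\<omega>. (f (X i) \<omega> - f x \<omega>) /\<^sub>R (X i - x) \<partial>M) \<longlonglongrightarrow> (\<integral>\<omega>. f' \<omega> \<partial>M)"
  proof (rule integral_dominated_convergence[OF meas _ w])
    fix i
    show "(\<lambda>\<omega>. (f (X i) \<omega> - f x \<omega>) /\<^sub>R (X i - x)) \<in> borel_measurable M"
      using int by (intro borel_measurable_integrable) auto
    show "AE \<omega> in M. norm ((f (X i) \<omega> - f x \<omega>) /\<^sub>R (X i - x)) \<le> w \<omega>"
      using bound[of "X i"]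
    proof eventually_elim
      case (elim \<omega>)
      then show ?case using X by (intro norm_divideR_le) auto
    qed
  next
    show "AE \<omega> in M. (\<lambda>i. (f (X i) \<omega> - f x \<omega>) /\<^sub>R (X i - x)) \<longlonglongrightarrow> f' \<omega>"
      using D
    proof eventually_elim
      case (elim \<omega>)
      then show ?case
        using X unfolding has_vector_derivative_iff_slope tendsto_at_iff_sequentially by (auto simp: o_def)
    qed
  qed
  then show "((\<lambda>y. ((\<integral>\<omega>. f y \<omega> \<partial>M) - (\<integral>\<omega>. f x \<omega> \<partial>M)) /\<^sub>R (y - x)) \<circ> X) \<longlonglongrightarrow> (\<integral>\<omega>. f' \<omega> \<partial>M)"
    using int by (simp add: o_def)
qed

lemma nth_deriv_0 [simp]: "nth_deriv 0 f = f"
  by (simp add: nth_deriv_def)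

lemma nth_deriv_Suc: "nth_deriv (Suc k) f x = vector_derivative (nth_deriv k f) (at x)"
  by (simp add: nth_deriv_def)

lemma times_differentiable_has_vector_derivative:
  assumes "times_differentiable m f" "i < m"
  shows "(nth_deriv i f has_vector_derivative nth_deriv (Suc i) f x) (at x)"
  using assms by (auto simp: times_differentiable_def nth_deriv_Suc vector_derivative_works)

lemma has_vector_derivative_imp_continuous_on:
  "(\<And>x. (f has_vector_derivative f' x) (at x)) \<Longrightarrow> continuous_on UNIV f"
  by (meson continuous_at_imp_continuous_on has_vector_derivative_continuous)

text \<open>The Henstock--Kurzweil integral needs no integrability of \<open>f'\<close> for the fundamental theorem, so a
  bound that holds almost everywhere makes \<open>f\<close> Lipschitz continuous.\<close>

lemma norm_derivative_le_of_AE: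
  fixes f :: "real \<Rightarrow> 'b::euclidean_space"
  assumes D: "\<And>x. (f has_vector_derivative f' x) (at x)"
    and AE: "AE x in lborel. norm (f' x) \<le> c" and c: "c \<ge> 0"
  shows "norm (f' x) \<le> c"
proof -
  define N where "N = {x. \<not> norm (f' x) \<le> c}"
  have "negligible N"
  proof -
    obtain N' where "{x \<in> space lborel. \<not> norm (f' x) \<le> c} \<subseteq> N'" "emeasure lborel N' = 0" "N' \<in> sets lborel"
      by (rule AE_E[OF AE])
    then have N': "N' \<in> null_sets lborel" "N \<subseteq> N'" by (auto simp: N_def null_sets_def)
    then have "negligible N'"
      by (simp add: negligible_iff_null_sets null_sets_completionI)
    then show ?thesis using N' negligible_subset by blast
  qed
  have lip: "norm (f b - f a) \<le> c * (b - a)" if "a \<le> b" for a b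
  proof -
    have "(f' has_integral f b - f a) {a..b}"
      by (rule fundamental_theorem_of_calculus[OF that]) (rule has_vector_derivative_at_within[OF D])
    then have "((\<lambda>x. if x \<in> N then 0 else f' x) has_integral f b - f a) {a..b}"
      by (rule has_integral_spike[OF \<open>negligible N\<close>, rotated]) auto
    then have "norm (f b - f a) \<le> c * measure lborel (cbox a b)"
      unfolding box_real(2)[symmetric]
      by (rule has_integral_bound[OF c]) (auto simp: N_def c)
    then show ?thesis using that by simp
  qed
  have "((\<lambda>y. (f y - f x) /\<^sub>R (y - x)) \<longlongrightarrow> f' x) (at x)"
    using D[of x] by (simp add: has_vector_derivative_iff_slope)
  moreover have "\<forall>\<^sub>F y in at x. norm ((f y - f x) /\<^sub>R (y - x)) \<le> c"
  proof -
    have "norm ((f y - f x) /\<^sub>R (y - x)) \<le> c" if "y \<noteq> x" for y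
    proof -
      have "norm (f y - f x) \<le> c * \<bar>y - x\<bar>"
        using lip[of x y] lip[of y x] by (cases "x \<le> y") (auto simp: norm_minus_commute)
      then show ?thesis using that by (intro norm_divideR_le) auto
    qed
    then show ?thesis by (auto simp: eventually_at_filter)
  qed
  ultimately show ?thesis
    by (rule tendsto_upperbound[OF tendsto_norm]) simp
qed

text \<open>The first derivative of the smoothed absolute value is an affine function of this
  distribution function, so this is where the kernel itself appears. The half-line is cut at a point
  left of \<open>y\<close>, and the fundamental theorem is applied on the compact rest.\<close>

lemma has_vector_derivative_integral_atMost:
  fixes K :: "real \<Rightarrow> complex"
  assumes int: "integrable lborel K" and cont: "continuous_on UNIV K"
  shows "((\<lambda>y. LINT u|lborel. indicator {..y} u *\<^sub>R K u) has_vector_derivative K y) (at y)"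
proof -
  let ?\<Phi> = "\<lambda>y. LINT u|lborel. indicator {..y} u *\<^sub>R K u"
  define a where "a = y - 1"
  have i1: "integrable lborel (\<lambda>u. indicator A u *\<^sub>R K u)" if "A \<in> sets borel" for A
    using int that by (intro integrable_mult_indicator) auto
  have eq: "?\<Phi> z = ?\<Phi> a + integral {a..z} K" if "a \<le> z" for z
  proof -
    have "?\<Phi> z = (LINT u|lborel. indicator {..<a} u *\<^sub>R K u + indicator {a..z} u *\<^sub>R K u)"
      by (rule Bochner_Integration.integral_cong) (use that in \<open>auto split: split_indicator\<close>)
    also have "\<dots> = (LINT u|lborel. indicator {..<a} u *\<^sub>R K u) + (LINT u|lborel. indicator {a..z} u *\<^sub>R K u)"
      by (rule Bochner_Integration.integral_add) (auto intro: i1)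
    also have "(LINT u|lborel. indicator {..<a} u *\<^sub>R K u) = ?\<Phi> a"
      by (rule integral_cong_AE) (use int AE_lborel_singleton[of a] in \<open>auto split: split_indicator elim!: eventually_mono\<close>)
    also have "(LINT u|lborel. indicator {a..z} u *\<^sub>R K u) = integral {a..z} K"
      using set_borel_integral_eq_integral(2)[of "{a..z}" K] i1[of "{a..z}"]
      by (simp add: set_integrable_def set_lebesgue_integral_def)
    finally show ?thesis .
  qed
  have "((\<lambda>z. integral {a..z} K) has_vector_derivative K y) (at y within {a..y+1})"
    by (rule integral_has_vector_derivative) (auto simp: a_def intro: continuous_on_subset[OF cont])
  then have "((\<lambda>z. integral {a..z} K) has_vector_derivative K y) (at y)"
    by (subst (asm) at_within_interior) (auto simp: a_def)
  then have "((\<lambda>z. ?\<Phi> a + integral {a..z} K) has_vector_derivative 0 + K y) (at y)"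
    by (intro has_vector_derivative_add has_vector_derivative_const)
  then have "((\<lambda>z. ?\<Phi> a + integral {a..z} K) has_vector_derivative K y) (at y)"
    by (simp only: add_0_left)
  then show ?thesis
    by (rule has_vector_derivative_transform_within_open[where S="{a<..}"])
       (use eq[symmetric] in \<open>auto simp: a_def\<close>)
qed

section \<open>Derivatives of the smoothed absolute value\<close>

context
  fixes K :: "real \<Rightarrow> complex" and C :: real and s :: nat
  assumes kc: "kernel_condition C s K" and s: "s \<ge> 3"
begin

lemma kernel_integrable: "integrable lborel K" "(LINT x|lborel. norm (K x)) \<le> C"
  and kernel_integrable_times: "integrable lborel (\<lambda>u. complex_of_real u * K u)"
    "(LINT u|lborel. norm (complex_of_real u * K u)) \<le> C"
  and kernel_integral: "(LINT x|lborel. K x) = 1"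
  using kc by (auto simp: kernel_condition_def)

lemma kernel_constant_nonneg: "C \<ge> 0"
  using kernel_integrable(2) by (rule order_trans[rotated]) simp

lemma kernel_has_vector_derivative:
  "i < s - 2 \<Longrightarrow> (nth_deriv i K has_vector_derivative nth_deriv (Suc i) K x) (at x)"
  using kc times_differentiable_has_vector_derivative by (auto simp: kernel_condition_def)

lemma kernel_continuous: "continuous_on UNIV K"
  using kernel_has_vector_derivative[of 0] s
  by (intro has_vector_derivative_imp_continuous_on) auto

text \<open>An essential supremum says nothing about a single point, and the derivative of order
  \<open>s - 2\<close> need not be continuous. It is however itself a derivative, of the preceding
  order or, for order 0, of the integral over half-lines, so \<open>norm_derivative_le_of_AE\<close>
  makes the bound hold everywhere.\<close>

lemma kernel_deriv_bound:
  assumes "i \<le> s - 2"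
  shows "norm (nth_deriv i K x) \<le> C / 2"
proof -
  have "\<forall>k\<in>{2..s}. 2 * esssup lborel (\<lambda>x. ereal (norm (nth_deriv (k - 2) K x))) \<le> ereal C"
    using kc by (simp add: kernel_condition_def)
  moreover have "i + 2 \<in> {2..s}" using assms s by auto
  ultimately have "2 * esssup lborel (\<lambda>x. ereal (norm (nth_deriv i K x))) \<le> ereal C"
    by fastforce
  then have le: "esssup lborel (\<lambda>x. ereal (norm (nth_deriv i K x))) \<le> ereal (C / 2)"
    by (cases "esssup lborel (\<lambda>x. ereal (norm (nth_deriv i K x)))") auto
  have AE: "AE x in lborel. norm (nth_deriv i K x) \<le> C / 2"
    using esssup_AE[where M = lborel and f = "\<lambda>x. ereal (norm (nth_deriv i K x))"]
  proof eventually_elim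
    case (elim x)
    then have "ereal (norm (nth_deriv i K x)) \<le> ereal (C / 2)" using le by (rule order_trans)
    then show ?case by simp
  qed
  have "\<exists>f. \<forall>x. (f has_vector_derivative nth_deriv i K x) (at x)"
  proof (cases i)
    case 0
    then show ?thesis
      using has_vector_derivative_integral_atMost[OF kernel_integrable(1) kernel_continuous] by auto
  next
    case (Suc i')
    then show ?thesis using kernel_has_vector_derivative[of i'] assms by auto
  qed
  then obtain f where "\<And>x. (f has_vector_derivative nth_deriv i K x) (at x)" by blast
  from norm_derivative_le_of_AE[OF this AE] show ?thesis using kernel_constant_nonneg by simp
qed

context
  fixes h :: real and f :: "real \<Rightarrow> complex"
  assumes h: "h > 0"
  defines "f \<equiv> smoothing K h (\<lambda>t. \<bar>t\<bar>)"
begin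

text \<open>The substitution \<open>t = x - h * u\<close> moves \<open>x\<close> out of the kernel,
  whose derivatives are bounded but not known to be integrable, into the Lipschitz function.\<close>

lemma smoothing_abs_eq: "f x = (LINT u|lborel. K u * complex_of_real \<bar>x - h * u\<bar>)"
proof -
  have "f x = (LINT t|lborel. complex_of_real (1 / h) * K ((x - t) / h) * complex_of_real \<bar>t\<bar>)"
    by (simp add: f_def smoothing_def)
  also have "\<dots> = \<bar>-h\<bar> *\<^sub>R (LINT u|lborel. complex_of_real (1 / h) * K ((x - (x + -h * u)) / h) * complex_of_real \<bar>x + -h * u\<bar>)"
    using h by (intro lborel_integral_real_affine) auto
  also have "\<dots> = (LINT u|lborel. K u * complex_of_real \<bar>x - h * u\<bar>)"
    unfolding integral_scaleR_right[symmetric]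
    by (rule Bochner_Integration.integral_cong) (use h in \<open>auto simp: scaleR_conv_of_real field_simps\<close>)
  finally show ?thesis .
qed

lemma integrable_smoothing_abs: "integrable lborel (\<lambda>u. K u * complex_of_real \<bar>x - h * u\<bar>)"
proof (rule Bochner_Integration.integrable_bound)
  show "integrable lborel (\<lambda>u. \<bar>x\<bar> * norm (K u) + h * norm (complex_of_real u * K u))"
    by (intro Bochner_Integration.integrable_add integrable_mult_right integrable_norm kernel_integrable kernel_integrable_times)
  show "(\<lambda>u. K u * complex_of_real \<bar>x - h * u\<bar>) \<in> borel_measurable lborel"
    using borel_measurable_integrable[OF kernel_integrable(1)] by measurable
  have "norm (K u * complex_of_real \<bar>x - h * u\<bar>) \<le> \<bar>x\<bar> * norm (K u) + h * norm (complex_of_real u * K u)" for u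
  proof -
    have "\<bar>x - h * u\<bar> \<le> \<bar>x\<bar> + h * \<bar>u\<bar>" using h abs_triangle_ineq4[of x "h*u"] by (simp add: abs_mult)
    then have "norm (K u) * \<bar>x - h * u\<bar> \<le> norm (K u) * (\<bar>x\<bar> + h * \<bar>u\<bar>)" by (intro mult_left_mono) auto
    then show ?thesis by (simp add: norm_mult algebra_simps)
  qed
  then show "AE u in lborel. norm (K u * complex_of_real \<bar>x - h * u\<bar>) \<le> norm (\<bar>x\<bar> * norm (K u) + h * norm (complex_of_real u * K u))"
    using h by (auto intro!: AE_I2 order_trans[OF _ abs_ge_self])
qed

text \<open>As \<open>K\<close> integrates to 1 and the absolute value is 1-Lipschitz, the error is
  at most \<open>h\<close> times the first absolute moment of \<open>K\<close>.\<close>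

lemma smoothing_abs_bias: "norm (f x - complex_of_real \<bar>x\<bar>) \<le> C * h"
proof -
  have int: "integrable lborel (\<lambda>u. K u * complex_of_real \<bar>x\<bar>)"
    using kernel_integrable(1) by simp
  have "f x - complex_of_real \<bar>x\<bar> = (LINT u|lborel. K u * complex_of_real \<bar>x - h * u\<bar>) - (LINT u|lborel. K u * complex_of_real \<bar>x\<bar>)"
    by (simp add: smoothing_abs_eq kernel_integral)
  also have "\<dots> = (LINT u|lborel. K u * complex_of_real \<bar>x - h * u\<bar> - K u * complex_of_real \<bar>x\<bar>)"
    by (rule Bochner_Integration.integral_diff[symmetric, OF integrable_smoothing_abs int])
  finally have "norm (f x - complex_of_real \<bar>x\<bar>) = norm \<dots>" by simp
  also have "\<dots> \<le> (LINT u|lborel. h * norm (complex_of_real u * K u))"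
  proof (rule Bochner_Integration.integral_norm_bound_integral)
    fix u
    have "\<bar>\<bar>x - h * u\<bar> - \<bar>x\<bar>\<bar> \<le> h * \<bar>u\<bar>"
      using h abs_triangle_ineq3[of "x - h * u" x] by (simp add: abs_mult)
    then have "norm (K u) * \<bar>\<bar>x - h * u\<bar> - \<bar>x\<bar>\<bar> \<le> norm (K u) * (h * \<bar>u\<bar>)" by (intro mult_left_mono) auto
    moreover have "K u * complex_of_real \<bar>x - h * u\<bar> - K u * complex_of_real \<bar>x\<bar> = K u * complex_of_real (\<bar>x - h * u\<bar> - \<bar>x\<bar>)"
      by (simp add: algebra_simps)
    ultimately show "norm (K u * complex_of_real \<bar>x - h * u\<bar> - K u * complex_of_real \<bar>x\<bar>) \<le> h * norm (complex_of_real u * K u)"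
      by (simp only: norm_mult norm_of_real mult_ac)
  qed (intro Bochner_Integration.integrable_diff integrable_smoothing_abs int integrable_mult_right integrable_norm kernel_integrable_times)+
  also have "\<dots> = h * (LINT u|lborel. norm (complex_of_real u * K u))" by simp
  also have "\<dots> \<le> h * C" using h kernel_integrable_times(2) by (intro mult_left_mono) auto
  finally show ?thesis by (simp add: mult.commute)
qed

lemma has_vector_derivative_abs_affine:
  assumes "u \<noteq> x / h"
  shows "((\<lambda>y. complex_of_real \<bar>y - h * u\<bar>) has_vector_derivative (2 * indicator {..x / h} u - 1)) (at x)"
proof -
  have ne: "x - h * u \<noteq> 0" using assms h by (auto simp: field_simps)
  have sg: "sgn (x - h * u) = 2 * indicator {..x / h} u - 1"
    using h ne by (auto simp: sgn_if indicator_def field_simps)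
  have "((\<lambda>y. \<bar>y - h * u\<bar>) has_real_derivative sgn (x - h * u)) (at x)"
  proof (cases "x > h * u")
    case True
    have "((\<lambda>y. y - h * u) has_real_derivative sgn (x - h * u)) (at x)"
      using True by (auto intro!: derivative_eq_intros)
    then show ?thesis
      by (rule has_field_derivative_transform_within_open[of _ _ _ "{h * u<..}"]) (use True in auto)
  next
    case False
    then have lt: "x < h * u" using ne by simp
    have "((\<lambda>y. - (y - h * u)) has_real_derivative sgn (x - h * u)) (at x)"
      using lt by (auto intro!: derivative_eq_intros)
    then show ?thesis
      by (rule has_field_derivative_transform_within_open[of _ _ _ "{..<h * u}"]) (use lt in auto)
  qed
  then have "((\<lambda>y. complex_of_real \<bar>y - h * u\<bar>) has_vector_derivative complex_of_real (sgn (x - h * u))) (at x)"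
    by (intro has_vector_derivative_of_real) (simp add: has_real_derivative_iff_has_vector_derivative)
  moreover have "complex_of_real (2 * indicator {..x / h} u - 1) = 2 * indicator {..x / h} u - 1"
    by (simp add: indicator_def)
  ultimately show ?thesis unfolding sg by (simp only:)
qed

text \<open>The derivative of \<open>\<bar>x - h * u\<bar>\<close> in \<open>x\<close> is a sign for
  all \<open>u\<close> except \<open>x / h\<close>. It is written through an indicator so that the
  next derivative is covered by \<open>has_vector_derivative_integral_atMost\<close>.\<close>

lemma smoothing_abs_has_vector_derivative:
  "(f has_vector_derivative 2 * (LINT u|lborel. indicator {..x / h} u *\<^sub>R K u) - 1) (at x)"
proof -
  let ?I = "\<lambda>u. complex_of_real (2 * indicator {..x / h} u - 1)"
  have mK: "K \<in> borel_measurable lborel" using kernel_integrable(1) by (rule borel_measurable_integrable)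
  have "((\<lambda>y. LINT u|lborel. K u * complex_of_real \<bar>y - h * u\<bar>) has_vector_derivative (LINT u|lborel. K u * ?I u)) (at x)"
  proof (rule has_vector_derivative_lebesgue_integral)
    show "integrable lborel (\<lambda>u. K u * complex_of_real \<bar>y - h * u\<bar>)" for y by (rule integrable_smoothing_abs)
    show "integrable lborel (\<lambda>u. norm (K u))" by (intro integrable_norm kernel_integrable)
    show "AE u in lborel. norm (K u * complex_of_real \<bar>y - h * u\<bar> - K u * complex_of_real \<bar>x - h * u\<bar>) \<le> norm (K u) * \<bar>y - x\<bar>" for y
    proof (rule AE_I2)
      fix u
      have "\<bar>\<bar>y - h * u\<bar> - \<bar>x - h * u\<bar>\<bar> \<le> \<bar>y - x\<bar>" by linarith
      then have "norm (K u) * \<bar>\<bar>y - h * u\<bar> - \<bar>x - h * u\<bar>\<bar> \<le> norm (K u) * \<bar>y - x\<bar>" by (intro mult_left_mono) auto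
      moreover have "K u * complex_of_real \<bar>y - h * u\<bar> - K u * complex_of_real \<bar>x - h * u\<bar> = K u * complex_of_real (\<bar>y - h * u\<bar> - \<bar>x - h * u\<bar>)"
        by (simp add: algebra_simps)
      ultimately show "norm (K u * complex_of_real \<bar>y - h * u\<bar> - K u * complex_of_real \<bar>x - h * u\<bar>) \<le> norm (K u) * \<bar>y - x\<bar>"
        by (simp only: norm_mult norm_of_real)
    qed
    show "AE u in lborel. ((\<lambda>y. K u * complex_of_real \<bar>y - h * u\<bar>) has_vector_derivative K u * ?I u) (at x)"
      using AE_lborel_singleton[of "x / h"]
    proof eventually_elim
      case (elim u)
      from has_vector_derivative_mult_right[OF has_vector_derivative_abs_affine[OF elim], of "K u"]
      moreover have "?I u = 2 * indicator {..x / h} u - 1" by (simp add: indicator_def)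
      ultimately show ?case by (simp only:)
    qed
    show "(\<lambda>u. K u * ?I u) \<in> borel_measurable lborel" using mK by measurable
  qed
  moreover have "(LINT u|lborel. K u * ?I u) = 2 * (LINT u|lborel. indicator {..x / h} u *\<^sub>R K u) - 1"
  proof -
    have i: "integrable lborel (\<lambda>u. indicator {..x / h} u *\<^sub>R K u)"
      by (intro integrable_mult_indicator kernel_integrable) auto
    then have i': "integrable lborel (\<lambda>u. 2 * (indicator {..x / h} u *\<^sub>R K u))"
      by (rule integrable_mult_right)
    have "(LINT u|lborel. K u * ?I u) = (LINT u|lborel. 2 * (indicator {..x / h} u *\<^sub>R K u) - K u)"
      by (rule Bochner_Integration.integral_cong) (auto simp: indicator_def)
    also have "\<dots> = (LINT u|lborel. 2 * (indicator {..x / h} u *\<^sub>R K u)) - (LINT u|lborel. K u)"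
      by (rule Bochner_Integration.integral_diff[OF i' kernel_integrable(1)])
    also have "\<dots> = 2 * (LINT u|lborel. indicator {..x / h} u *\<^sub>R K u) - 1"
      by (simp only: integral_mult_right_zero kernel_integral)
    finally show ?thesis .
  qed
  ultimately show ?thesis by (simp add: smoothing_abs_eq[abs_def])
qed

lemma nth_deriv_smoothing_abs_1:
  "nth_deriv 1 f x = 2 * (LINT u|lborel. indicator {..x / h} u *\<^sub>R K u) - 1"
  using smoothing_abs_has_vector_derivative[of x] nth_deriv_Suc[of 0 f x] by (simp add: vector_derivative_at)

text \<open>The second distributional derivative of the absolute value is twice the unit mass at 0,
  so smoothing turns it into the rescaled kernel; every further derivative costs a factor
  \<open>1 / h\<close>.\<close>

lemma nth_deriv_smoothing_abs_Suc_Suc: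
  assumes "k \<le> s - 2"
  shows "((nth_deriv (Suc k) f) has_vector_derivative (2 / h ^ (Suc k)) *\<^sub>R nth_deriv k K (x / h)) (at x)
    \<and> nth_deriv (Suc (Suc k)) f = (\<lambda>x. (2 / h ^ (Suc k)) *\<^sub>R nth_deriv k K (x / h))"
  using assms
proof (induction k arbitrary: x)
  case 0
  have scal: "((\<lambda>y. y / h) has_vector_derivative (1 / h)) (at y)" for y
    by (auto intro!: derivative_eq_intros)
  have "((\<lambda>y. LINT u|lborel. indicator {..y / h} u *\<^sub>R K u) has_vector_derivative (1 / h) *\<^sub>R K (y / h)) (at y)" for y
    using vector_diff_chain_at[OF scal[of y] has_vector_derivative_integral_atMost[OF kernel_integrable(1) kernel_continuous]]
    by (simp add: o_def)
  from has_vector_derivative_diff[OF has_vector_derivative_mult_right[OF this, of 2] has_vector_derivative_const[of 1]]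
  have D: "(nth_deriv 1 f has_vector_derivative (2 / h) *\<^sub>R K (y / h)) (at y)" for y
    unfolding nth_deriv_smoothing_abs_1[abs_def] by (simp add: scaleR_conv_of_real)
  then have "nth_deriv (Suc 1) f y = (2 / h) *\<^sub>R K (y / h)" for y
    by (simp add: nth_deriv_Suc vector_derivative_at)
  with D show ?case by auto
next
  case (Suc k)
  then have IH: "nth_deriv (Suc (Suc k)) f = (\<lambda>x. (2 / h ^ (Suc k)) *\<^sub>R nth_deriv k K (x / h))" by auto
  have scal: "((\<lambda>y. y / h) has_vector_derivative (1 / h)) (at y)" for y
    by (auto intro!: derivative_eq_intros)
  have "((\<lambda>y. nth_deriv k K (y / h)) has_vector_derivative (1 / h) *\<^sub>R nth_deriv (Suc k) K (y / h)) (at y)" for y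
    using vector_diff_chain_at[OF scal[of y] kernel_has_vector_derivative[of k]] Suc.prems by (simp add: o_def)
 from bounded_linear.has_vector_derivative[OF bounded_linear_scaleR_right this, of "2 / h ^ Suc k"]
  have D: "(nth_deriv (Suc (Suc k)) f has_vector_derivative (2 / h ^ (Suc (Suc k))) *\<^sub>R nth_deriv (Suc k) K (y / h)) (at y)" for y
    unfolding IH by (simp add: mult.commute)
  then have "nth_deriv (Suc (Suc (Suc k))) f y = (2 / h ^ (Suc (Suc k))) *\<^sub>R nth_deriv (Suc k) K (y / h)" for y
    by (subst nth_deriv_Suc) (rule vector_derivative_at)
  with D show ?case by auto
qed

lemma nth_deriv_smoothing_abs:
  assumes "i < s"
  shows "(nth_deriv i f has_vector_derivative nth_deriv (Suc i) f x) (at x)"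
proof (cases i)
  case 0
  then show ?thesis using smoothing_abs_has_vector_derivative[of x] nth_deriv_smoothing_abs_1[of x] by simp
next
  case (Suc k)
  then show ?thesis using nth_deriv_smoothing_abs_Suc_Suc[of k x] assms by simp
qed

lemma nth_deriv_smoothing_abs_bound:
  assumes "1 \<le> k" "k \<le> s"
  shows "norm (nth_deriv k f x) \<le> C / h ^ (k - 1)"
proof (cases "k = 1")
  case True
  let ?A = "{..x / h}"
  have i: "integrable lborel (\<lambda>u. complex_of_real (2 * indicator ?A u - 1) * K u)"
    by (rule Bochner_Integration.integrable_bound[OF kernel_integrable(1)])
       (use borel_measurable_integrable[OF kernel_integrable(1)] in \<open>auto simp: indicator_def\<close>)
  have i2: "integrable lborel (\<lambda>u. indicator ?A u *\<^sub>R K u)"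
    by (intro integrable_mult_indicator kernel_integrable) auto
  have "nth_deriv k f x = (LINT u|lborel. 2 * (indicator ?A u *\<^sub>R K u) - K u)"
    unfolding True nth_deriv_smoothing_abs_1
    by (simp only: Bochner_Integration.integral_diff[OF integrable_mult_right[OF i2] kernel_integrable(1)]
      integral_mult_right_zero kernel_integral)
  \<comment> \<open>Recombined, the weight is a sign, so the bound is the integral of
    \<open>norm (K u)\<close> with no loss from the two separate terms.\<close>
  also have "\<dots> = (LINT u|lborel. complex_of_real (2 * indicator ?A u - 1) * K u)"
    by (rule Bochner_Integration.integral_cong) (auto simp: indicator_def)
  finally have "norm (nth_deriv k f x) \<le> (LINT u|lborel. norm (K u))"
    by (simp only:) (rule Bochner_Integration.integral_norm_bound_integral[OF i integrable_norm[OF kernel_integrable(1)]],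
      auto simp: indicator_def norm_mult)
  then show ?thesis using True kernel_integrable(2) by simp
next
  case False
  then obtain k' where k': "k = Suc (Suc k')" using assms by (intro that[of "k - 2"]) auto
  have "norm (nth_deriv k f x) = 2 / h ^ Suc k' * norm (nth_deriv k' K (x / h))"
    using nth_deriv_smoothing_abs_Suc_Suc[of k' x] k' assms h by simp
  also have "\<dots> \<le> 2 / h ^ Suc k' * (C / 2)"
    using h k' assms by (intro mult_left_mono kernel_deriv_bound) auto
  finally show ?thesis using k' by simp
qed

end
end

section \<open>Fourier inversion\<close>

lemma integrable_iexp_times:
  fixes Q :: "real \<Rightarrow> complex"
  assumes "integrable lborel Q"
  shows "integrable lborel (\<lambda>\<zeta>. iexp (c * \<zeta>) * Q \<zeta>)"
proof (rule Bochner_Integration.integrable_bound[OF assms])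
  show "(\<lambda>\<zeta>. iexp (c * \<zeta>) * Q \<zeta>) \<in> borel_measurable lborel"
    using borel_measurable_integrable[OF assms] by measurable
qed (simp add: norm_mult)

lemma fourier_inversion_eq:
  "fourier_inversion Q x = complex_of_real (1 / sqrt (2 * pi)) * (LINT \<zeta>|lborel. iexp (x * \<zeta>) * Q \<zeta>)"
  by (simp add: fourier_inversion_def mult.commute)

lemma fourier_inversion_has_vector_derivative:
  assumes Q: "integrable lborel Q" and Q1: "integrable lborel (\<lambda>\<zeta>. \<i> * complex_of_real \<zeta> * Q \<zeta>)"
  shows "(fourier_inversion Q has_vector_derivative
    fourier_inversion (\<lambda>\<zeta>. \<i> * complex_of_real \<zeta> * Q \<zeta>) x) (at x)"
proof -
  have "((\<lambda>y. LINT \<zeta>|lborel. iexp (y * \<zeta>) * Q \<zeta>) has_vector_derivative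
      (LINT \<zeta>|lborel. iexp (x * \<zeta>) * (\<i> * complex_of_real \<zeta> * Q \<zeta>))) (at x)"
  proof (rule has_vector_derivative_lebesgue_integral)
    show "integrable lborel (\<lambda>\<zeta>. iexp (y * \<zeta>) * Q \<zeta>)" for y by (rule integrable_iexp_times[OF Q])
    show "integrable lborel (\<lambda>\<zeta>. norm (\<i> * complex_of_real \<zeta> * Q \<zeta>))" by (rule integrable_norm[OF Q1])
    show "(\<lambda>\<zeta>. iexp (x * \<zeta>) * (\<i> * complex_of_real \<zeta> * Q \<zeta>)) \<in> borel_measurable lborel"
      by (rule borel_measurable_integrable[OF integrable_iexp_times[OF Q1]])
    show "AE \<zeta> in lborel. norm (iexp (y * \<zeta>) * Q \<zeta> - iexp (x * \<zeta>) * Q \<zeta>)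
        \<le> norm (\<i> * complex_of_real \<zeta> * Q \<zeta>) * \<bar>y - x\<bar>" for y
    proof (rule AE_I2)
      fix \<zeta>
      have "iexp (y * \<zeta>) * Q \<zeta> - iexp (x * \<zeta>) * Q \<zeta> = iexp (x * \<zeta>) * ((iexp ((y - x) * \<zeta>) - 1) * Q \<zeta>)"
        by (simp add: exp_add[symmetric] algebra_simps)
      then have "norm (iexp (y * \<zeta>) * Q \<zeta> - iexp (x * \<zeta>) * Q \<zeta>) = norm (iexp ((y - x) * \<zeta>) - 1) * norm (Q \<zeta>)"
        by (simp only: norm_mult norm_exp_i_times mult_1_left)
      \<comment> \<open>Order 0 of the Taylor estimate for the exponential:
        \<open>\<bar>exp (i t) - 1\<bar> \<le> \<bar>t\<bar>\<close>.\<close>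
      also have "\<dots> \<le> \<bar>(y - x) * \<zeta>\<bar> * norm (Q \<zeta>)"
        using iexp_approx1[of "(y - x) * \<zeta>" 0] by (intro mult_right_mono) auto
      finally show "norm (iexp (y * \<zeta>) * Q \<zeta> - iexp (x * \<zeta>) * Q \<zeta>) \<le> norm (\<i> * complex_of_real \<zeta> * Q \<zeta>) * \<bar>y - x\<bar>"
        by (simp add: norm_mult abs_mult mult_ac)
    qed
    show "AE \<zeta> in lborel. ((\<lambda>y. iexp (y * \<zeta>) * Q \<zeta>) has_vector_derivative iexp (x * \<zeta>) * (\<i> * complex_of_real \<zeta> * Q \<zeta>)) (at x)"
    proof (rule AE_I2)
      fix \<zeta>
      have "((\<lambda>z. exp (\<i> * (z * complex_of_real \<zeta>)) * Q \<zeta>) has_field_derivative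
          iexp (x * \<zeta>) * (\<i> * complex_of_real \<zeta> * Q \<zeta>)) (at (complex_of_real x))"
        by (auto intro!: derivative_eq_intros)
      from has_vector_derivative_real_field[OF this]
      show "((\<lambda>y. iexp (y * \<zeta>) * Q \<zeta>) has_vector_derivative iexp (x * \<zeta>) * (\<i> * complex_of_real \<zeta> * Q \<zeta>)) (at x)"
        by simp
    qed
  qed
  from has_vector_derivative_mult_right[OF this, of "complex_of_real (1 / sqrt (2 * pi))"]
  show ?thesis by (simp only: fourier_inversion_eq[abs_def])
qed

text \<open>Fubini for an absolutely convergent double integral. The parameter \<open>c\<close>
  serves both signs of the exponent: \<open>c = 1\<close> for the inversion and
  \<open>c = -1\<close> for its complex conjugate.\<close>

lemma fourier_multiplication_formula:
  fixes \<phi> \<psi> :: "real \<Rightarrow> complex"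
  assumes \<phi>: "integrable lborel \<phi>" and \<psi>: "integrable lborel \<psi>"
  shows "(LINT x|lborel. \<phi> x * (LINT \<zeta>|lborel. iexp (c * x * \<zeta>) * \<psi> \<zeta>))
    = (LINT \<zeta>|lborel. \<psi> \<zeta> * (LINT x|lborel. iexp (c * \<zeta> * x) * \<phi> x))"
proof -
  note [measurable] = borel_measurable_integrable[OF \<phi>] borel_measurable_integrable[OF \<psi>]
  have [measurable]: "\<phi> \<in> borel_measurable borel" "\<psi> \<in> borel_measurable borel"
    using borel_measurable_integrable[OF \<phi>] borel_measurable_integrable[OF \<psi>] by simp_all
  have "integrable (lborel \<Otimes>\<^sub>M lborel) (\<lambda>(x, \<zeta>). iexp (c * x * \<zeta>) * \<phi> x * \<psi> \<zeta>)"
  proof (rule lborel_pair.Fubini_integrable)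
    show "(\<lambda>(x, \<zeta>). iexp (c * x * \<zeta>) * \<phi> x * \<psi> \<zeta>) \<in> borel_measurable (lborel \<Otimes>\<^sub>M lborel)"
      by measurable
    show "integrable lborel (\<lambda>x. LINT \<zeta>|lborel. norm (case (x, \<zeta>) of (x, \<zeta>) \<Rightarrow> iexp (c * x * \<zeta>) * \<phi> x * \<psi> \<zeta>))"
      using \<phi> by (simp add: norm_mult)
    show "AE x in lborel. integrable lborel (\<lambda>\<zeta>. case (x, \<zeta>) of (x, \<zeta>) \<Rightarrow> iexp (c * x * \<zeta>) * \<phi> x * \<psi> \<zeta>)"
    proof (rule AE_I2)
      fix x
      show "integrable lborel (\<lambda>\<zeta>. case (x, \<zeta>) of (x, \<zeta>) \<Rightarrow> iexp (c * x * \<zeta>) * \<phi> x * \<psi> \<zeta>)"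
        using integrable_mult_right[OF integrable_iexp_times[OF \<psi>, of "c * x"], of "\<phi> x"]
        by (simp add: mult_ac)
    qed
  qed
  from lborel_pair.Fubini_integral[OF this]
  have "(LINT \<zeta>|lborel. LINT x|lborel. iexp (c * x * \<zeta>) * \<phi> x * \<psi> \<zeta>)
    = (LINT x|lborel. LINT \<zeta>|lborel. iexp (c * x * \<zeta>) * \<phi> x * \<psi> \<zeta>)" .
  moreover have "(LINT x|lborel. iexp (c * x * \<zeta>) * \<phi> x * \<psi> \<zeta>) = \<psi> \<zeta> * (LINT x|lborel. iexp (c * \<zeta> * x) * \<phi> x)" for \<zeta>
    by (subst integral_mult_right_zero[symmetric]) (simp add: mult_ac)
  moreover have "(LINT \<zeta>|lborel. iexp (c * x * \<zeta>) * \<phi> x * \<psi> \<zeta>) = \<phi> x * (LINT \<zeta>|lborel. iexp (c * x * \<zeta>) * \<psi> \<zeta>)" for x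
    by (subst integral_mult_right_zero[symmetric]) (simp add: mult_ac)
  ultimately show ?thesis by (simp only:)
qed

section \<open>Gaussian damping\<close>

lemma std_normal_fourier:
  "(LINT x|lborel. iexp (t * x) * complex_of_real (exp (- x\<^sup>2 / 2))) = complex_of_real (sqrt (2 * pi) * exp (- t\<^sup>2 / 2))"
proof -
  have "char std_normal_distribution t = (LINT x|lborel. std_normal_density x *\<^sub>R iexp (t * x))"
    unfolding char_def by (subst integral_density) auto
  also have "\<dots> = (LINT x|lborel. complex_of_real (1 / sqrt (2 * pi)) * (iexp (t * x) * complex_of_real (exp (- x\<^sup>2 / 2))))"
    by (simp add: std_normal_density_def scaleR_conv_of_real mult_ac)
  also have "\<dots> = complex_of_real (1 / sqrt (2 * pi)) * (LINT x|lborel. iexp (t * x) * complex_of_real (exp (- x\<^sup>2 / 2)))"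
    by (rule integral_mult_right_zero)
  finally have eq: "complex_of_real (1 / sqrt (2 * pi)) * (LINT x|lborel. iexp (t * x) * complex_of_real (exp (- x\<^sup>2 / 2)))
      = complex_of_real (exp (- t\<^sup>2 / 2))"
    by (simp add: char_std_normal_distribution)
  have "(LINT x|lborel. iexp (t * x) * complex_of_real (exp (- x\<^sup>2 / 2)))
      = complex_of_real (sqrt (2 * pi)) * (complex_of_real (1 / sqrt (2 * pi)) * (LINT x|lborel. iexp (t * x) * complex_of_real (exp (- x\<^sup>2 / 2))))"
    by simp
  also have "\<dots> = complex_of_real (sqrt (2 * pi) * exp (- t\<^sup>2 / 2))"
    unfolding eq by simp
  finally show ?thesis .
qed

text \<open>The transform of the damping factor is expressed by the normal density of standard
  deviation \<open>r\<close>: as the damping disappears, this becomes an approximate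
  identity.\<close>

lemma gaussian_fourier:
  assumes r: "r > 0"
  shows "(LINT x|lborel. iexp (u * x) * complex_of_real (exp (- (r * x)\<^sup>2 / 2)))
    = complex_of_real (2 * pi * normal_density 0 r u)"
proof -
  have "complex_of_real (sqrt (2 * pi) * exp (- (u / r)\<^sup>2 / 2)) = (LINT x|lborel. iexp (u / r * x) * complex_of_real (exp (- x\<^sup>2 / 2)))"
    by (rule std_normal_fourier[symmetric])
  also have "\<dots> = \<bar>r\<bar> *\<^sub>R (LINT x|lborel. iexp (u / r * (0 + r * x)) * complex_of_real (exp (- (0 + r * x)\<^sup>2 / 2)))"
    by (rule lborel_integral_real_affine) (use r in simp)
  also have "\<dots> = \<bar>r\<bar> *\<^sub>R (LINT x|lborel. iexp (u * x) * complex_of_real (exp (- (r * x)\<^sup>2 / 2)))"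
    using r by simp
  finally have "(LINT x|lborel. iexp (u * x) * complex_of_real (exp (- (r * x)\<^sup>2 / 2)))
      = (1 / r) *\<^sub>R complex_of_real (sqrt (2 * pi) * exp (- (u / r)\<^sup>2 / 2))"
    using r by simp
  also have "\<dots> = complex_of_real (1 / r * (sqrt (2 * pi) * exp (- (u / r)\<^sup>2 / 2)))"
    by (simp add: scaleR_conv_of_real)
  also have "1 / r * (sqrt (2 * pi) * exp (- (u / r)\<^sup>2 / 2)) = 2 * pi * normal_density 0 r u"
  proof -
    have c: "2 * pi * (1 / (sqrt (2 * pi) * r)) = 1 / r * sqrt (2 * pi)"
      using r by (simp add: field_simps)
    have "sqrt (2 * pi * r\<^sup>2) = sqrt (2 * pi) * r" using r by (simp add: real_sqrt_mult)
    moreover have "- (u / r)\<^sup>2 / 2 = - u\<^sup>2 / (2 * r\<^sup>2)" by (simp add: power_divide)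
    ultimately have "normal_density 0 r u = (1 / (sqrt (2 * pi) * r)) * exp (- (u / r)\<^sup>2 / 2)"
      by (simp only: normal_density_def diff_zero)
    then have "2 * pi * normal_density 0 r u = (2 * pi * (1 / (sqrt (2 * pi) * r))) * exp (- (u / r)\<^sup>2 / 2)"
      by (simp only: mult.assoc)
    also note c
    finally show ?thesis by (simp only: mult.assoc)
  qed
  finally show ?thesis .
qed

lemma integrable_gaussian:
  fixes r :: real
  assumes r: "r > 0"
  shows "integrable lborel (\<lambda>x. exp (- (r * x)\<^sup>2 / 2))"
proof -
  have "integrable lborel (\<lambda>x. sqrt (2 * pi * (1 / r)\<^sup>2) * normal_density 0 (1 / r) x)"
    using r by (intro integrable_mult_right integrable_normal_density) auto
  moreover have "sqrt (2 * pi * (1 / r)\<^sup>2) * normal_density 0 (1 / r) x = exp (- (r * x)\<^sup>2 / 2)" for x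
    using r by (simp add: normal_density_def power_divide power_mult_distrib)
  ultimately show ?thesis by simp
qed

lemma scaled_normal_density:
  assumes "r > 0"
  shows "r * normal_density 0 r (r * z) = std_normal_density z"
proof -
  have "sqrt (2 * pi * r\<^sup>2) = sqrt (2 * pi) * r" using assms by (simp add: real_sqrt_mult)
  moreover have "- (r * z - 0)\<^sup>2 / (2 * r\<^sup>2) = - z\<^sup>2 / 2" using assms by (simp add: power_mult_distrib)
  moreover have "r * (1 / (sqrt (2 * pi) * r)) = 1 / sqrt (2 * pi)" using assms by simp
  ultimately show ?thesis
    unfolding std_normal_density_def by (simp only: normal_density_def mult.assoc[symmetric])
qed

lemma norm_fourier_inversion_le:
  assumes "(LINT \<zeta>|lborel. norm (Q \<zeta>)) \<le> B"
  shows "norm (fourier_inversion Q x) \<le> B / sqrt (2 * pi)"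
proof -
  have "norm (LINT \<zeta>|lborel. iexp (x * \<zeta>) * Q \<zeta>) \<le> (LINT \<zeta>|lborel. norm (iexp (x * \<zeta>) * Q \<zeta>))"
    by (rule integral_norm_bound)
  also have "\<dots> \<le> B" using assms by (simp add: norm_mult)
  finally show ?thesis
    by (simp add: fourier_inversion_eq norm_mult norm_divide divide_right_mono)
qed

lemma fourier_inversion_measurable:
  assumes [measurable]: "Q \<in> borel_measurable borel"
  shows "fourier_inversion Q \<in> borel_measurable borel"
  unfolding fourier_inversion_eq[abs_def] by measurable

text \<open>The damping makes every integral absolutely convergent, so Fubini turns the left side
  into the double integral of \<open>Q \<zeta> * cnj (Q \<xi>)\<close> against the normal density at
  \<open>\<zeta> - \<xi>\<close>. Then \<open>u v \<le> u^2 / 2 + v^2 / 2\<close>, and the density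
  has total mass 1 in either variable. With nonnegative integrals the inequality also covers an
  infinite right side.\<close>

lemma damped_bessel:
  assumes Q: "integrable lborel Q" and r: "r > 0"
  shows "(\<integral>\<^sup>+x. ennreal ((norm (fourier_inversion Q x))\<^sup>2 * exp (- (r * x)\<^sup>2 / 2)) \<partial>lborel)
    \<le> (\<integral>\<^sup>+\<zeta>. ennreal ((norm (Q \<zeta>))\<^sup>2) \<partial>lborel)"
proof -
  let ?K = "fourier_inversion Q" and ?g = "\<lambda>x. exp (- (r * x)\<^sup>2 / 2)"
  let ?c = "complex_of_real (1 / sqrt (2 * pi))"
  have [measurable]: "Q \<in> borel_measurable borel" using borel_measurable_integrable[OF Q] by simp
  note [measurable] = fourier_inversion_measurable[OF this]
  have [measurable]: "cnj \<in> borel_measurable borel"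
    by (intro borel_measurable_continuous_onI continuous_intros)
  let ?\<phi> = "\<lambda>x. cnj (?K x) * complex_of_real (?g x)"
  define B where "B = (LINT \<zeta>|lborel. norm (Q \<zeta>)) / sqrt (2 * pi)"
  have KB: "norm (?K x) \<le> B" for x unfolding B_def by (rule norm_fourier_inversion_le) simp
  have B0: "B \<ge> 0" using KB[of 0] norm_ge_zero order_trans by blast
  have \<phi>: "integrable lborel ?\<phi>"
  proof (rule Bochner_Integration.integrable_bound)
    show "integrable lborel (\<lambda>x. B * ?g x)" by (intro integrable_mult_right integrable_gaussian r)
    show "AE x in lborel. norm (?\<phi> x) \<le> norm (B * ?g x)"
      using KB B0 by (intro AE_I2) (auto simp: norm_mult abs_mult intro!: mult_right_mono)
  qed measurable
  have K2: "integrable lborel (\<lambda>x. (norm (?K x))\<^sup>2 * ?g x)"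
  proof (rule Bochner_Integration.integrable_bound)
    show "integrable lborel (\<lambda>x. B\<^sup>2 * ?g x)" by (intro integrable_mult_right integrable_gaussian r)
    show "AE x in lborel. norm ((norm (?K x))\<^sup>2 * ?g x) \<le> norm (B\<^sup>2 * ?g x)"
      using KB B0 by (intro AE_I2) (auto simp: abs_mult intro!: mult_right_mono power_mono)
  qed measurable
  \<comment> \<open>The transform of a product is a convolution: here of \<open>cnj Q\<close> with
    the normal density.\<close>
  have Phi: "(LINT x|lborel. iexp (\<zeta> * x) * ?\<phi> x)
      = complex_of_real (sqrt (2 * pi)) * (LINT \<xi>|lborel. cnj (Q \<xi>) * complex_of_real (normal_density 0 r (\<zeta> - \<xi>)))" for \<zeta>
  proof -
    have int: "integrable lborel (\<lambda>x. iexp (\<zeta> * x) * complex_of_real (?g x))"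
      by (intro integrable_iexp_times integrable_of_real integrable_gaussian r)
    have cQ: "integrable lborel (\<lambda>\<xi>. cnj (Q \<xi>))" using Q by simp
    have cK: "cnj (?K x) = ?c * (LINT \<xi>|lborel. iexp (- 1 * x * \<xi>) * cnj (Q \<xi>))" for x
    proof -
      have "cnj (LINT \<xi>|lborel. iexp (x * \<xi>) * Q \<xi>) = (LINT \<xi>|lborel. cnj (iexp (x * \<xi>) * Q \<xi>))"
        by (rule Bochner_Integration.integral_cnj[symmetric])
      also have "\<dots> = (LINT \<xi>|lborel. iexp (- 1 * x * \<xi>) * cnj (Q \<xi>))"
        by (simp add: exp_cnj)
      finally show ?thesis by (simp add: fourier_inversion_eq)
    qed
    have inner: "(LINT x|lborel. iexp (- 1 * \<xi> * x) * (iexp (\<zeta> * x) * complex_of_real (?g x)))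
        = complex_of_real (2 * pi * normal_density 0 r (\<zeta> - \<xi>))" for \<xi>
    proof -
      have "iexp (- 1 * \<xi> * x) * iexp (\<zeta> * x) = iexp ((\<zeta> - \<xi>) * x)" for x
        by (simp add: exp_add[symmetric] algebra_simps)
      then have "iexp (- 1 * \<xi> * x) * (iexp (\<zeta> * x) * complex_of_real (?g x)) = iexp ((\<zeta> - \<xi>) * x) * complex_of_real (?g x)" for x
        by (simp only: mult.assoc[symmetric])
      then show ?thesis using gaussian_fourier[OF r, of "\<zeta> - \<xi>"] by (simp only:)
    qed
    have "(LINT x|lborel. iexp (\<zeta> * x) * ?\<phi> x)
       = (LINT x|lborel. ?c * ((iexp (\<zeta> * x) * complex_of_real (?g x)) * (LINT \<xi>|lborel. iexp (- 1 * x * \<xi>) * cnj (Q \<xi>))))"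
      unfolding cK by (simp only: mult_ac)
    also have "\<dots> = ?c * (LINT x|lborel. (iexp (\<zeta> * x) * complex_of_real (?g x)) * (LINT \<xi>|lborel. iexp (- 1 * x * \<xi>) * cnj (Q \<xi>)))"
      by (rule integral_mult_right_zero)
    also have "\<dots> = ?c * (LINT \<xi>|lborel. cnj (Q \<xi>) * (LINT x|lborel. iexp (- 1 * \<xi> * x) * (iexp (\<zeta> * x) * complex_of_real (?g x))))"
      by (rule arg_cong[OF fourier_multiplication_formula[OF int cQ]])
    also have "\<dots> = ?c * (LINT \<xi>|lborel. cnj (Q \<xi>) * complex_of_real (2 * pi * normal_density 0 r (\<zeta> - \<xi>)))"
      unfolding inner ..
    also have "\<dots>
        = ?c * (LINT \<xi>|lborel. complex_of_real (2 * pi) * (cnj (Q \<xi>) * complex_of_real (normal_density 0 r (\<zeta> - \<xi>))))"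
      by (simp add: mult_ac)
    also have "\<dots> = (?c * complex_of_real (2 * pi)) * (LINT \<xi>|lborel. cnj (Q \<xi>) * complex_of_real (normal_density 0 r (\<zeta> - \<xi>)))"
      by (simp only: integral_mult_right_zero mult.assoc)
    also have "?c * complex_of_real (2 * pi) = complex_of_real (sqrt (2 * pi))"
      by (simp only: of_real_mult[symmetric]) (simp add: real_div_sqrt)
    finally show ?thesis .
  qed
  have "complex_of_real (LINT x|lborel. (norm (?K x))\<^sup>2 * ?g x) = (LINT x|lborel. complex_of_real ((norm (?K x))\<^sup>2 * ?g x))"
    by (rule integral_complex_of_real[symmetric])
  also have "\<dots> = (LINT x|lborel. ?c * (?\<phi> x * (LINT \<zeta>|lborel. iexp (1 * x * \<zeta>) * Q \<zeta>)))"
  proof (rule Bochner_Integration.integral_cong[OF refl])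
    fix x
    have "complex_of_real ((norm (?K x))\<^sup>2 * ?g x) = ?K x * cnj (?K x) * complex_of_real (?g x)"
      by (simp only: complex_norm_square of_real_mult)
    also have "\<dots> = (?c * (LINT \<zeta>|lborel. iexp (x * \<zeta>) * Q \<zeta>)) * ?\<phi> x"
      by (subst (1) fourier_inversion_eq) (simp only: mult_ac)
    finally show "complex_of_real ((norm (?K x))\<^sup>2 * ?g x) = ?c * (?\<phi> x * (LINT \<zeta>|lborel. iexp (1 * x * \<zeta>) * Q \<zeta>))"
      by (simp only: mult_ac mult_1_left)
  qed
  also have "\<dots> = ?c * (LINT x|lborel. ?\<phi> x * (LINT \<zeta>|lborel. iexp (1 * x * \<zeta>) * Q \<zeta>))"
    by (rule integral_mult_right_zero)
  also have "\<dots> = ?c * (LINT \<zeta>|lborel. Q \<zeta> * (LINT x|lborel. iexp (1 * \<zeta> * x) * ?\<phi> x))"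
    by (rule arg_cong[OF fourier_multiplication_formula[OF \<phi> Q]])
  also have "\<dots> = ?c * (LINT \<zeta>|lborel. complex_of_real (sqrt (2 * pi)) * (Q \<zeta> * (LINT \<xi>|lborel. cnj (Q \<xi>) * complex_of_real (normal_density 0 r (\<zeta> - \<xi>)))))"
  proof -
    have "Q \<zeta> * (LINT x|lborel. iexp (1 * \<zeta> * x) * ?\<phi> x)
        = complex_of_real (sqrt (2 * pi)) * (Q \<zeta> * (LINT \<xi>|lborel. cnj (Q \<xi>) * complex_of_real (normal_density 0 r (\<zeta> - \<xi>))))" for \<zeta>
      unfolding mult_1_left Phi by (rule mult.left_commute)
    then show ?thesis by (simp only:)
  qed
  also have "\<dots> = (LINT \<zeta>|lborel. Q \<zeta> * (LINT \<xi>|lborel. cnj (Q \<xi>) * complex_of_real (normal_density 0 r (\<zeta> - \<xi>))))"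
    by simp
  finally have eq: "complex_of_real (LINT x|lborel. (norm (?K x))\<^sup>2 * ?g x) = \<dots>" .
  let ?N = "\<lambda>\<zeta> \<xi>. normal_density 0 r (\<zeta> - \<xi>)"
  \<comment> \<open>If \<open>f\<close> is not integrable, its Bochner integral is 0 and the
    inequality still holds.\<close>
  have norm_int: "ennreal (norm (integral\<^sup>L lborel f)) \<le> (\<integral>\<^sup>+x. ennreal (norm (f x)) \<partial>lborel)" for f :: "real \<Rightarrow> complex"
    by (cases "integrable lborel f") (auto simp: integral_norm_bound_ennreal not_integrable_integral_eq)
  have "(\<integral>\<^sup>+x. ennreal ((norm (?K x))\<^sup>2 * ?g x) \<partial>lborel) = ennreal (LINT x|lborel. (norm (?K x))\<^sup>2 * ?g x)"
    by (rule nn_integral_eq_integral[OF K2]) auto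
  also have "\<dots> \<le> ennreal (norm (complex_of_real (LINT x|lborel. (norm (?K x))\<^sup>2 * ?g x)))"
    by (intro ennreal_leI) (simp only: norm_of_real abs_ge_self)
  also have "\<dots> \<le> (\<integral>\<^sup>+\<zeta>. ennreal (norm (Q \<zeta> * (LINT \<xi>|lborel. cnj (Q \<xi>) * complex_of_real (?N \<zeta> \<xi>)))) \<partial>lborel)"
    unfolding eq by (rule norm_int)
  also have "\<dots> \<le> (\<integral>\<^sup>+\<zeta>. \<integral>\<^sup>+\<xi>. ennreal (norm (Q \<zeta>) * (norm (Q \<xi>) * ?N \<zeta> \<xi>)) \<partial>lborel \<partial>lborel)"
  proof (rule nn_integral_mono)
    fix \<zeta>
    have "ennreal (norm (Q \<zeta> * (LINT \<xi>|lborel. cnj (Q \<xi>) * complex_of_real (?N \<zeta> \<xi>))))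
        = ennreal (norm (Q \<zeta>)) * ennreal (norm (LINT \<xi>|lborel. cnj (Q \<xi>) * complex_of_real (?N \<zeta> \<xi>)))"
      by (simp add: norm_mult ennreal_mult)
    also have "\<dots> \<le> ennreal (norm (Q \<zeta>)) * (\<integral>\<^sup>+\<xi>. ennreal (norm (cnj (Q \<xi>) * complex_of_real (?N \<zeta> \<xi>))) \<partial>lborel)"
      by (intro mult_left_mono norm_int) auto
    also have "\<dots> = (\<integral>\<^sup>+\<xi>. ennreal (norm (Q \<zeta>) * (norm (Q \<xi>) * ?N \<zeta> \<xi>)) \<partial>lborel)"
      by (subst nn_integral_cmult[symmetric]) (auto simp: norm_mult ennreal_mult normal_density_nonneg intro!: nn_integral_cong)
    finally show "ennreal (norm (Q \<zeta> * (LINT \<xi>|lborel. cnj (Q \<xi>) * complex_of_real (?N \<zeta> \<xi>)))) \<le> \<dots>" .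
  qed
  also have "\<dots> \<le> (\<integral>\<^sup>+\<zeta>. \<integral>\<^sup>+\<xi>. ennreal ((norm (Q \<zeta>))\<^sup>2 / 2 * ?N \<zeta> \<xi>) + ennreal ((norm (Q \<xi>))\<^sup>2 / 2 * ?N \<zeta> \<xi>) \<partial>lborel \<partial>lborel)"
  proof (intro nn_integral_mono)
    fix \<zeta> \<xi>
    have "norm (Q \<zeta>) * norm (Q \<xi>) \<le> (norm (Q \<zeta>))\<^sup>2 / 2 + (norm (Q \<xi>))\<^sup>2 / 2"
      using sum_squares_bound[of "norm (Q \<zeta>)" "norm (Q \<xi>)"] by simp
    then have "norm (Q \<zeta>) * norm (Q \<xi>) * ?N \<zeta> \<xi> \<le> ((norm (Q \<zeta>))\<^sup>2 / 2 + (norm (Q \<xi>))\<^sup>2 / 2) * ?N \<zeta> \<xi>"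
      by (intro mult_right_mono normal_density_nonneg)
    then have "ennreal (norm (Q \<zeta>) * (norm (Q \<xi>) * ?N \<zeta> \<xi>)) \<le> ennreal ((norm (Q \<zeta>))\<^sup>2 / 2 * ?N \<zeta> \<xi> + (norm (Q \<xi>))\<^sup>2 / 2 * ?N \<zeta> \<xi>)"
      by (intro ennreal_leI) (simp only: distrib_right mult.assoc)
    also have "\<dots> = ennreal ((norm (Q \<zeta>))\<^sup>2 / 2 * ?N \<zeta> \<xi>) + ennreal ((norm (Q \<xi>))\<^sup>2 / 2 * ?N \<zeta> \<xi>)"
      by (rule ennreal_plus) (auto simp: normal_density_nonneg)
    finally show "ennreal (norm (Q \<zeta>) * (norm (Q \<xi>) * ?N \<zeta> \<xi>)) \<le> ennreal ((norm (Q \<zeta>))\<^sup>2 / 2 * ?N \<zeta> \<xi>) + ennreal ((norm (Q \<xi>))\<^sup>2 / 2 * ?N \<zeta> \<xi>)" .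
  qed
  also have "\<dots> = (\<integral>\<^sup>+\<zeta>. \<integral>\<^sup>+\<xi>. ennreal ((norm (Q \<zeta>))\<^sup>2 / 2 * ?N \<zeta> \<xi>) \<partial>lborel \<partial>lborel)
      + (\<integral>\<^sup>+\<zeta>. \<integral>\<^sup>+\<xi>. ennreal ((norm (Q \<xi>))\<^sup>2 / 2 * ?N \<zeta> \<xi>) \<partial>lborel \<partial>lborel)"
    by (subst nn_integral_add[symmetric]) (auto intro!: nn_integral_cong nn_integral_add)
  also have "(\<integral>\<^sup>+\<zeta>. \<integral>\<^sup>+\<xi>. ennreal ((norm (Q \<xi>))\<^sup>2 / 2 * ?N \<zeta> \<xi>) \<partial>lborel \<partial>lborel)
      = (\<integral>\<^sup>+\<xi>. \<integral>\<^sup>+\<zeta>. ennreal ((norm (Q \<xi>))\<^sup>2 / 2 * ?N \<xi> \<zeta>) \<partial>lborel \<partial>lborel)"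
    by (subst lborel_pair.Fubini') (auto simp: normal_density_def power2_commute)
  also have "(\<integral>\<^sup>+\<zeta>. \<integral>\<^sup>+\<xi>. ennreal ((norm (Q \<zeta>))\<^sup>2 / 2 * ?N \<zeta> \<xi>) \<partial>lborel \<partial>lborel) = (\<integral>\<^sup>+\<zeta>. ennreal ((norm (Q \<zeta>))\<^sup>2 / 2) \<partial>lborel)"
  proof (rule nn_integral_cong)
    fix \<zeta>
    have "(\<integral>\<^sup>+\<xi>. ennreal ((norm (Q \<zeta>))\<^sup>2 / 2 * ?N \<zeta> \<xi>) \<partial>lborel) = ennreal ((norm (Q \<zeta>))\<^sup>2 / 2) * (\<integral>\<^sup>+\<xi>. ennreal (normal_density \<zeta> r \<xi>) \<partial>lborel)"
      by (subst nn_integral_cmult[symmetric])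
         (auto simp: ennreal_mult[symmetric] normal_density_def power2_commute intro!: nn_integral_cong)
    also have "(\<integral>\<^sup>+\<xi>. ennreal (normal_density \<zeta> r \<xi>) \<partial>lborel) = 1"
      by (subst nn_integral_eq_integral) (use r in \<open>auto simp: normal_density_nonneg\<close>)
    finally show "(\<integral>\<^sup>+\<xi>. ennreal ((norm (Q \<zeta>))\<^sup>2 / 2 * ?N \<zeta> \<xi>) \<partial>lborel) = ennreal ((norm (Q \<zeta>))\<^sup>2 / 2)" by simp
  qed
  also have "(\<integral>\<^sup>+\<zeta>. ennreal ((norm (Q \<zeta>))\<^sup>2 / 2) \<partial>lborel) + (\<integral>\<^sup>+\<zeta>. ennreal ((norm (Q \<zeta>))\<^sup>2 / 2) \<partial>lborel) = (\<integral>\<^sup>+\<zeta>. ennreal ((norm (Q \<zeta>))\<^sup>2) \<partial>lborel)"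
    by (subst nn_integral_add[symmetric]) (auto simp: ennreal_plus[symmetric] simp del: ennreal_plus intro!: nn_integral_cong)
  finally show ?thesis .
qed

text \<open>Let the damping parameter tend to 0; Fatou's lemma suffices because the damped bound
  does not depend on it.\<close>

lemma bessel:
  assumes Q: "integrable lborel Q"
  shows "(\<integral>\<^sup>+x. ennreal ((norm (fourier_inversion Q x))\<^sup>2) \<partial>lborel)
    \<le> (\<integral>\<^sup>+\<zeta>. ennreal ((norm (Q \<zeta>))\<^sup>2) \<partial>lborel)"
proof -
  have [measurable]: "Q \<in> borel_measurable borel" using borel_measurable_integrable[OF Q] by simp
  note [measurable] = fourier_inversion_measurable[OF this]
  let ?u = "\<lambda>n x. ennreal ((norm (fourier_inversion Q x))\<^sup>2 * exp (- (1 / real (Suc n) * x)\<^sup>2 / 2))"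
  have lim: "(\<lambda>n. ?u n x) \<longlonglongrightarrow> ennreal ((norm (fourier_inversion Q x))\<^sup>2)" for x
  proof -
    have "(\<lambda>n. exp (- (1 / real (Suc n) * x)\<^sup>2 / 2)) \<longlonglongrightarrow> exp (- (0 * x)\<^sup>2 / 2)"
      using LIMSEQ_inverse_real_of_nat by (intro tendsto_intros) (auto simp: inverse_eq_divide)
    from tendsto_mult[OF tendsto_const this, of "(norm (fourier_inversion Q x))\<^sup>2"]
    show ?thesis by (intro tendsto_ennrealI) simp
  qed
  have "(\<integral>\<^sup>+x. ennreal ((norm (fourier_inversion Q x))\<^sup>2) \<partial>lborel) = (\<integral>\<^sup>+x. liminf (\<lambda>n. ?u n x) \<partial>lborel)"
    by (intro nn_integral_cong) (metis lim lim_imp_Liminf trivial_limit_sequentially)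
  also have "\<dots> \<le> liminf (\<lambda>n. \<integral>\<^sup>+x. ?u n x \<partial>lborel)"
    by (rule nn_integral_liminf) measurable
  also have "\<dots> \<le> liminf (\<lambda>n. \<integral>\<^sup>+\<zeta>. ennreal ((norm (Q \<zeta>))\<^sup>2) \<partial>lborel)"
    by (intro Liminf_mono always_eventually allI damped_bessel[OF Q]) auto
  finally show ?thesis by (simp add: Liminf_const)
qed

text \<open>Abel summation: the damped integral of the inversion is \<open>sqrt (2 * pi)\<close>
  times a Gaussian average of \<open>Q\<close> around 0. As the damping disappears, the left side
  converges with majorant \<open>norm (fourier_inversion Q x)\<close>, and the average tends to
  \<open>Q 0\<close> since \<open>Q\<close> is bounded and continuous.\<close>

lemma integral_fourier_inversion:
  assumes Q: "integrable lborel Q" and K: "integrable lborel (fourier_inversion Q)"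
    and cont: "continuous_on UNIV Q" and bdd: "\<And>\<zeta>. norm (Q \<zeta>) \<le> B"
  shows "(LINT x|lborel. fourier_inversion Q x) = complex_of_real (sqrt (2 * pi)) * Q 0"
proof -
  let ?K = "fourier_inversion Q" and ?c = "complex_of_real (1 / sqrt (2 * pi))"
  let ?r = "\<lambda>n. 1 / real (Suc n)"
  have [measurable]: "Q \<in> borel_measurable borel" using borel_measurable_integrable[OF Q] by simp
  note [measurable] = fourier_inversion_measurable[OF this]
  have B0: "B \<ge> 0" using bdd[of 0] norm_ge_zero order_trans by blast
  have r0: "?r n > 0" for n by simp
  have rlim: "?r \<longlonglongrightarrow> 0"
    using LIMSEQ_inverse_real_of_nat by (simp add: inverse_eq_divide)
  have eq: "(LINT x|lborel. complex_of_real (exp (- (?r n * x)\<^sup>2 / 2)) * ?K x)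
      = complex_of_real (sqrt (2 * pi)) * (LINT z|lborel. complex_of_real (std_normal_density z) * Q (?r n * z))" for n
  proof -
    let ?g = "\<lambda>x. complex_of_real (exp (- (?r n * x)\<^sup>2 / 2))"
    have g: "integrable lborel ?g" by (intro integrable_of_real integrable_gaussian r0)
    have "(LINT x|lborel. ?g x * ?K x) = (LINT x|lborel. ?c * (?g x * (LINT \<zeta>|lborel. iexp (1 * x * \<zeta>) * Q \<zeta>)))"
    proof (rule Bochner_Integration.integral_cong[OF refl])
      fix x
      have "?K x = ?c * (LINT \<zeta>|lborel. iexp (1 * x * \<zeta>) * Q \<zeta>)" by (simp add: fourier_inversion_eq)
      then show "?g x * ?K x = ?c * (?g x * (LINT \<zeta>|lborel. iexp (1 * x * \<zeta>) * Q \<zeta>))"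
        by (simp only: mult_ac)
    qed
    also have "\<dots> = ?c * (LINT x|lborel. ?g x * (LINT \<zeta>|lborel. iexp (1 * x * \<zeta>) * Q \<zeta>))"
      by (rule integral_mult_right_zero)
    also have "\<dots> = ?c * (LINT \<zeta>|lborel. Q \<zeta> * (LINT x|lborel. iexp (1 * \<zeta> * x) * ?g x))"
      by (rule arg_cong[OF fourier_multiplication_formula[OF g Q]])
    also have "\<dots> = ?c * (LINT \<zeta>|lborel. Q \<zeta> * complex_of_real (2 * pi * normal_density 0 (?r n) \<zeta>))"
      by (simp only: mult_1_left gaussian_fourier[OF r0])
    also have "\<dots> = ?c * (\<bar>?r n\<bar> *\<^sub>R (LINT z|lborel. Q (0 + ?r n * z) * complex_of_real (2 * pi * normal_density 0 (?r n) (0 + ?r n * z))))"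
      by (subst lborel_integral_real_affine[where c = "?r n" and t = 0]) auto
    also have "\<dots> = (LINT z|lborel. ?c * (\<bar>?r n\<bar> *\<^sub>R (Q (0 + ?r n * z) * complex_of_real (2 * pi * normal_density 0 (?r n) (0 + ?r n * z)))))"
      by (simp only: integral_mult_right_zero integral_scaleR_right)
    also have "\<dots> = (LINT z|lborel. complex_of_real (sqrt (2 * pi)) * (complex_of_real (std_normal_density z) * Q (?r n * z)))"
    proof (rule Bochner_Integration.integral_cong[OF refl])
      fix z
      note nd = scaled_normal_density[OF r0, of n z]
      have sq: "1 / sqrt (2 * pi) * (2 * pi) = sqrt (2 * pi)" by (simp add: real_div_sqrt)
      have "?c * (\<bar>?r n\<bar> *\<^sub>R (Q (0 + ?r n * z) * complex_of_real (2 * pi * normal_density 0 (?r n) (0 + ?r n * z))))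
        = complex_of_real ((1 / sqrt (2 * pi) * (2 * pi)) * (?r n * normal_density 0 (?r n) (?r n * z))) * Q (?r n * z)"
        by (simp only: scaleR_conv_of_real of_real_mult add_0_left abs_of_pos[OF r0] mult_ac)
      also have "\<dots> = complex_of_real (sqrt (2 * pi)) * (complex_of_real (std_normal_density z) * Q (?r n * z))"
        unfolding nd sq by (simp only: of_real_mult mult.assoc)
      finally show "?c * (\<bar>?r n\<bar> *\<^sub>R (Q (0 + ?r n * z) * complex_of_real (2 * pi * normal_density 0 (?r n) (0 + ?r n * z))))
        = complex_of_real (sqrt (2 * pi)) * (complex_of_real (std_normal_density z) * Q (?r n * z))" .
    qed
    finally show ?thesis by (simp only: integral_mult_right_zero)
  qed
  have lim1: "(\<lambda>n. LINT x|lborel. complex_of_real (exp (- (?r n * x)\<^sup>2 / 2)) * ?K x) \<longlonglongrightarrow> (LINT x|lborel. ?K x)"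
  proof (rule integral_dominated_convergence[where w = "\<lambda>x. norm (?K x)"])
    show "AE x in lborel. (\<lambda>n. complex_of_real (exp (- (?r n * x)\<^sup>2 / 2)) * ?K x) \<longlonglongrightarrow> ?K x"
    proof (rule AE_I2)
      fix x
      have "(\<lambda>n. complex_of_real (exp (- (?r n * x)\<^sup>2 / 2)) * ?K x) \<longlonglongrightarrow> complex_of_real (exp (- (0 * x)\<^sup>2 / 2)) * ?K x"
        by (intro tendsto_intros rlim) auto
      then show "(\<lambda>n. complex_of_real (exp (- (?r n * x)\<^sup>2 / 2)) * ?K x) \<longlonglongrightarrow> ?K x" by simp
    qed
    show "AE x in lborel. norm (complex_of_real (exp (- (?r n * x)\<^sup>2 / 2)) * ?K x) \<le> norm (?K x)" for n
      by (intro AE_I2) (auto simp: norm_mult intro!: mult_left_le_one_le)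
  qed (use K in auto)
  have "(\<lambda>n. LINT z|lborel. complex_of_real (std_normal_density z) * Q (?r n * z)) \<longlonglongrightarrow> (LINT z|lborel. complex_of_real (std_normal_density z) * Q 0)"
  proof (rule integral_dominated_convergence[where w = "\<lambda>z. B * std_normal_density z"])
    show "AE z in lborel. (\<lambda>n. complex_of_real (std_normal_density z) * Q (?r n * z)) \<longlonglongrightarrow> complex_of_real (std_normal_density z) * Q 0"
    proof (rule AE_I2)
      fix z
      have "(\<lambda>n. ?r n * z) \<longlonglongrightarrow> 0" using tendsto_mult_left_zero[OF rlim, of z] by simp
      moreover have "isCont Q 0" using cont by (simp add: continuous_on_eq_continuous_at)
      ultimately have "(\<lambda>n. Q (?r n * z)) \<longlonglongrightarrow> Q 0" by (rule isCont_tendsto_compose[rotated])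
      then show "(\<lambda>n. complex_of_real (std_normal_density z) * Q (?r n * z)) \<longlonglongrightarrow> complex_of_real (std_normal_density z) * Q 0"
        by (intro tendsto_intros)
    qed
    show "AE z in lborel. norm (complex_of_real (std_normal_density z) * Q (?r n * z)) \<le> B * std_normal_density z" for n
      using bdd by (intro AE_I2) (auto simp: norm_mult mult.commute[of _ "std_normal_density _"] intro!: mult_left_mono)
  qed auto
  then have "(\<lambda>n. complex_of_real (sqrt (2 * pi)) * (LINT z|lborel. complex_of_real (std_normal_density z) * Q (?r n * z)))
      \<longlonglongrightarrow> complex_of_real (sqrt (2 * pi)) * (LINT z|lborel. complex_of_real (std_normal_density z) * Q 0)"
    by (intro tendsto_intros)
  moreover have "(LINT z|lborel. complex_of_real (std_normal_density z) * Q 0) = Q 0"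
    by (subst integral_mult_left_zero) simp
  ultimately have "(\<lambda>n. complex_of_real (sqrt (2 * pi)) * (LINT z|lborel. complex_of_real (std_normal_density z) * Q (?r n * z)))
      \<longlonglongrightarrow> complex_of_real (sqrt (2 * pi)) * Q 0"
    by (simp only:)
  with lim1 show ?thesis unfolding eq by (rule LIMSEQ_unique)
qed

section \<open>Windows supported in \<open>[-1, 1]\<close>\<close>

lemma integrable_of_continuous_support:
  fixes f :: "real \<Rightarrow> 'b::{banach, second_countable_topology}"
  assumes "continuous_on UNIV f" and "\<And>x. \<bar>x\<bar> > 1 \<Longrightarrow> f x = 0"
  shows "integrable lborel f"
proof -
  have "integrable lborel (\<lambda>x. indicator {-1..1} x *\<^sub>R f x)"
    by (rule borel_integrable_compact) (auto intro: continuous_on_subset[OF assms(1)])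
  moreover have "indicator {-1..1} x *\<^sub>R f x = f x" for x
    using assms(2)[of x] by (auto simp: indicator_def abs_if split: if_splits)
  ultimately show ?thesis by simp
qed

lemma ennreal_linear_combination:
  assumes "0 \<le> a" "0 \<le> u" "0 \<le> b" "0 \<le> v"
  shows "ennreal (a * u + b * v) = ennreal a * ennreal u + ennreal b * ennreal v"
  using assms by (simp add: ennreal_mult)

lemma tendsto_odd_rational:
  shows "((\<lambda>x::real. x / (1 + x\<^sup>2)) \<longlongrightarrow> 0) at_top"
proof (rule Lim_null_comparison)
  show "((\<lambda>x::real. inverse x) \<longlongrightarrow> 0) at_top" by (rule tendsto_inverse_0_at_top[OF filterlim_ident])
  show "\<forall>\<^sub>F x::real in at_top. norm (x / (1 + x\<^sup>2)) \<le> inverse x"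
    using eventually_gt_at_top[of 0]
  proof eventually_elim
    case (elim x)
    then show ?case by (simp add: divide_simps power2_eq_square add_pos_pos)
  qed
qed

text \<open>The integrands are the squares of \<open>x^l / (1 + x^2)\<close>, with
  \<open>a = 1\<close> for \<open>l = 0\<close> and \<open>a = -1\<close> for \<open>l = 1\<close>.
  The common form of the two antiderivatives, with limits \<open>pi / 4\<close> and
  \<open>- pi / 4\<close>, explains why both integrals agree.\<close>

lemma rational_weight_integral:
  fixes a :: real
  assumes a: "a \<in> {-1, 1}"
  defines "f \<equiv> \<lambda>x::real. (if a = 1 then 1 else x\<^sup>2) / (1 + x\<^sup>2)\<^sup>2"
  shows "integrable lborel f" "(LINT x|lborel. f x) = pi / 2"
proof -
  define F where "F = (\<lambda>x::real. (arctan x + a * (x / (1 + x\<^sup>2))) / 2)"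
  have pos: "1 + x\<^sup>2 > 0" for x :: real by (simp add: add_pos_nonneg)
  have ne: "1 + x\<^sup>2 \<noteq> 0" for x :: real using pos[of x] by simp
  have D: "(F has_real_derivative f x) (at x)" for x
  proof -
    have "(F has_real_derivative (1 / (1 + x\<^sup>2) + a * ((1 * (1 + x\<^sup>2) - x * (2 * x)) / ((1 + x\<^sup>2) * (1 + x\<^sup>2)))) / 2) (at x)"
      unfolding F_def using ne[of x]
      by (auto intro!: derivative_eq_intros simp: inverse_eq_divide) (simp add: algebra_simps power2_eq_square)
    moreover have "(1 / (1 + x\<^sup>2) + a * ((1 * (1 + x\<^sup>2) - x * (2 * x)) / ((1 + x\<^sup>2) * (1 + x\<^sup>2)))) / 2 = f x"
    proof -
      have "1 / (1 + x\<^sup>2) = (1 + x\<^sup>2) / (1 + x\<^sup>2)\<^sup>2" using ne[of x] by (simp add: power2_eq_square)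
      moreover have "(1 * (1 + x\<^sup>2) - x * (2 * x)) / ((1 + x\<^sup>2) * (1 + x\<^sup>2)) = (1 - x\<^sup>2) / (1 + x\<^sup>2)\<^sup>2"
        by (simp add: power2_eq_square)
      moreover have "((1 + x\<^sup>2) / (1 + x\<^sup>2)\<^sup>2 + a * ((1 - x\<^sup>2) / (1 + x\<^sup>2)\<^sup>2)) / 2 = ((1 + x\<^sup>2) + a * (1 - x\<^sup>2)) / 2 / (1 + x\<^sup>2)\<^sup>2"
        by (simp add: add_divide_distrib)
      ultimately show ?thesis using a by (auto simp: f_def)
    qed
    ultimately show ?thesis by simp
  qed
  have cont: "isCont f x" for x
    unfolding f_def using ne[of x] by (cases "a = 1") (auto intro!: continuous_intros)
  have top: "(F \<longlongrightarrow> pi / 4) at_top"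
    using tendsto_divide[OF tendsto_add[OF tendsto_arctan_at_top tendsto_mult[OF tendsto_const[of a] tendsto_odd_rational]] tendsto_const[of 2]]
    by (simp add: F_def)
  have bot: "(F \<longlongrightarrow> - (pi / 4)) at_bot"
  proof -
    have "((\<lambda>x. - F x) \<longlongrightarrow> - (pi / 4)) at_top" by (intro tendsto_intros top)
    moreover have "- F x = F (- x)" for x by (simp add: F_def arctan_minus add_divide_distrib diff_divide_distrib)
    ultimately show ?thesis unfolding filterlim_at_bot_mirror by simp
  qed
  have nn: "f x \<ge> 0" for x unfolding f_def by simp
  note FTC = interval_integral_FTC_nonneg[where a = "-\<infinity>" and b = \<infinity> and F = F and f = f and A = "- (pi / 4)" and B = "pi / 4"]
  have lims: "((F \<circ> real_of_ereal) \<longlongrightarrow> - (pi / 4)) (at_right (- \<infinity>))" "((F \<circ> real_of_ereal) \<longlongrightarrow> pi / 4) (at_left \<infinity>)"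
    using top bot by (simp_all add: ereal_tendsto_simps)
  have "set_integrable lborel (einterval (-\<infinity>) \<infinity>) f" "(LBINT x=-\<infinity>..\<infinity>. f x) = pi / 4 - - (pi / 4)"
    by (rule FTC; use D cont nn lims in simp)+
  then show "integrable lborel f" "(LINT x|lborel. f x) = pi / 2"
    by (simp_all add: set_integrable_def interval_lebesgue_integral_def set_lebesgue_integral_def)
qed

lemma fourier_inversion_deriv:
  fixes P P' :: "real \<Rightarrow> complex"
  assumes D: "\<And>\<zeta>. (P has_vector_derivative P' \<zeta>) (at \<zeta>)" and cont: "continuous_on UNIV P'"
    and supp: "\<And>\<zeta>. \<bar>\<zeta>\<bar> > 1 \<Longrightarrow> P \<zeta> = 0" "\<And>\<zeta>. \<bar>\<zeta>\<bar> > 1 \<Longrightarrow> P' \<zeta> = 0"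
  shows "fourier_inversion P' x = - \<i> * complex_of_real x * fourier_inversion P x"
proof -
  have contP: "continuous_on UNIV P" by (rule has_vector_derivative_imp_continuous_on[OF D])
  have int: "integrable lborel P" "integrable lborel P'"
    using integrable_of_continuous_support contP cont supp by blast+
  let ?f = "\<lambda>\<zeta>. \<i> * complex_of_real x * (iexp (x * \<zeta>) * P \<zeta>) + iexp (x * \<zeta>) * P' \<zeta>"
  let ?F = "\<lambda>\<zeta>. iexp (x * \<zeta>) * P \<zeta>"
  have DF: "(?F has_vector_derivative ?f \<zeta>) (at \<zeta>)" for \<zeta>
  proof -
    have "((\<lambda>z. exp (\<i> * (complex_of_real x * z))) has_field_derivative \<i> * complex_of_real x * iexp (x * \<zeta>)) (at (complex_of_real \<zeta>))"
      by (auto intro!: derivative_eq_intros)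
    from has_vector_derivative_real_field[OF this]
    have "((\<lambda>\<zeta>. iexp (x * \<zeta>)) has_vector_derivative \<i> * complex_of_real x * iexp (x * \<zeta>)) (at \<zeta>)"
      by simp
    from has_vector_derivative_mult[OF this D[of \<zeta>]] show ?thesis by (simp add: algebra_simps)
  qed
  \<comment> \<open>Integration by parts on \<open>[-2, 2]\<close>: at its endpoints
    \<open>P\<close> vanishes directly by hypothesis, while at \<open>-1\<close> and
    \<open>1\<close> this would take a continuity argument.\<close>
  have "continuous_on {-2..2} ?f"
    by (intro continuous_intros continuous_on_subset[OF contP] continuous_on_subset[OF cont]) auto
  then have "(LINT \<zeta>|lborel. indicator {-2..2} \<zeta> *\<^sub>R ?f \<zeta>) = ?F 2 - ?F (-2)"
    by (intro integral_FTC_atLeastAtMost has_vector_derivative_at_within[OF DF]) auto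
  moreover have "indicator {-2..2} \<zeta> *\<^sub>R ?f \<zeta> = ?f \<zeta>" for \<zeta>
    using supp[of \<zeta>] by (auto simp: indicator_def)
  ultimately have "(LINT \<zeta>|lborel. ?f \<zeta>) = 0" using supp(1)[of 2] supp(1)[of "-2"] by simp
  moreover have "(LINT \<zeta>|lborel. ?f \<zeta>) = \<i> * complex_of_real x * (LINT \<zeta>|lborel. iexp (x * \<zeta>) * P \<zeta>) + (LINT \<zeta>|lborel. iexp (x * \<zeta>) * P' \<zeta>)"
    by (subst Bochner_Integration.integral_add)
       (use int in \<open>simp_all add: integrable_iexp_times integrable_mult_right del: of_real_mult\<close>)
  ultimately have "(LINT \<zeta>|lborel. iexp (x * \<zeta>) * P' \<zeta>) = - \<i> * complex_of_real x * (LINT \<zeta>|lborel. iexp (x * \<zeta>) * P \<zeta>)"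
    by (simp add: add_eq_0_iff)
  then show ?thesis unfolding fourier_inversion_eq by (simp only: mult_ac)
qed

lemma nth_deriv_fourier_inversion:
  assumes cont: "continuous_on UNIV Q" and supp: "\<And>\<zeta>. \<bar>\<zeta>\<bar> > 1 \<Longrightarrow> Q \<zeta> = 0"
  shows "nth_deriv k (fourier_inversion Q) = fourier_inversion (\<lambda>\<zeta>. (\<i> * complex_of_real \<zeta>) ^ k * Q \<zeta>)
    \<and> (\<forall>x. (nth_deriv k (fourier_inversion Q) has_vector_derivative
        nth_deriv (Suc k) (fourier_inversion Q) x) (at x))"
proof -
  have int: "integrable lborel (\<lambda>\<zeta>. (\<i> * complex_of_real \<zeta>) ^ k * Q \<zeta>)" for k
    by (rule integrable_of_continuous_support) (use supp in \<open>auto intro!: continuous_intros cont\<close>)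
  have D: "(fourier_inversion (\<lambda>\<zeta>. (\<i> * complex_of_real \<zeta>) ^ k * Q \<zeta>) has_vector_derivative
      fourier_inversion (\<lambda>\<zeta>. (\<i> * complex_of_real \<zeta>) ^ Suc k * Q \<zeta>) x) (at x)" for k x
    using fourier_inversion_has_vector_derivative[OF int[of k]] int[of "Suc k"] by (simp only: power_Suc mult.assoc)
  have eq: "nth_deriv k (fourier_inversion Q) = fourier_inversion (\<lambda>\<zeta>. (\<i> * complex_of_real \<zeta>) ^ k * Q \<zeta>)" for k
  proof (induction k)
    case 0
    then show ?case by simp
  next
    case (Suc k)
    show ?case
    proof
      fix x
      show "nth_deriv (Suc k) (fourier_inversion Q) x = fourier_inversion (\<lambda>\<zeta>. (\<i> * complex_of_real \<zeta>) ^ Suc k * Q \<zeta>) x"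
        unfolding nth_deriv_Suc Suc by (rule vector_derivative_at[OF D])
    qed
  qed
  show ?thesis using eq[of k] eq[of "Suc k"] D[of k] by (simp only:) simp
qed

text \<open>The constants fit exactly. By Bessel, \<open>(1 + x^2) * norm (K x)\<close> has squared
  norm at most \<open>2 C^2 / pi\<close>, and \<open>x^l / (1 + x^2)\<close> has
  \<open>pi / 2\<close>, so Cauchy-Schwarz gives \<open>C\<close>. For the derivatives,
  \<open>\<bar>\<zeta>\<bar> ^ k \<le> 1\<close> on the support bounds all orders at once by the
  integral of \<open>norm (Q \<zeta>)\<close> over \<open>sqrt (2 * pi)\<close>, which is at most
  \<open>C / 2\<close>.\<close>

lemma fourier_window_kernel_condition:
  assumes W: "fourier_window C Q" and K: "K = fourier_inversion Q"
  shows "kernel_condition C s K"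
proof -
  define Q1 where "Q1 = nth_deriv 1 Q"
  define Q2 where "Q2 = nth_deriv 2 Q"
  have td: "times_differentiable 2 Q" and cont2: "continuous_on UNIV Q2"
    and Q0: "Q 0 = complex_of_real (1 / sqrt (2 * pi))"
    and cl: "closure {\<zeta>. Q \<zeta> \<noteq> 0} = {-1..1}"
    and L1: "(LINT \<zeta>|lborel. norm (Q \<zeta>)) \<le> C / sqrt (2 / pi)"
    and L2: "sqrt (LINT \<zeta>|lborel. (norm (Q \<zeta>))\<^sup>2) \<le> C / sqrt (2 * pi)"
      "sqrt (LINT \<zeta>|lborel. (norm (Q2 \<zeta>))\<^sup>2) \<le> C / sqrt (2 * pi)"
    using W by (auto simp: fourier_window_def Q2_def)
  have D1: "(Q has_vector_derivative Q1 \<zeta>) (at \<zeta>)" for \<zeta>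
    using times_differentiable_has_vector_derivative[OF td, of 0] by (simp add: Q1_def)
  have D2: "(Q1 has_vector_derivative Q2 \<zeta>) (at \<zeta>)" for \<zeta>
    using times_differentiable_has_vector_derivative[OF td, of 1] by (simp add: Q1_def Q2_def numeral_2_eq_2)
  note cont = has_vector_derivative_imp_continuous_on[OF D1] and cont1 = has_vector_derivative_imp_continuous_on[OF D2]
  have supp: "Q \<zeta> = 0" if "\<bar>\<zeta>\<bar> > 1" for \<zeta>
    using closure_subset[of "{\<zeta>. Q \<zeta> \<noteq> 0}"] that unfolding cl by fastforce
  have dz: "g' \<zeta> = 0" if D: "\<And>\<zeta>. (g has_vector_derivative g' \<zeta>) (at \<zeta>)" and z: "\<And>\<zeta>. \<bar>\<zeta>\<bar> > 1 \<Longrightarrow> g \<zeta> = 0" and "\<bar>\<zeta>\<bar> > 1"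
    for g g' :: "real \<Rightarrow> complex" and \<zeta>
  proof -
    have "open {\<zeta>::real. \<bar>\<zeta>\<bar> > 1}" by (intro open_Collect_less continuous_intros)
    from has_vector_derivative_transform_within_open[OF D[of \<zeta>] this] that
    have "((\<lambda>_. 0) has_vector_derivative g' \<zeta>) (at \<zeta>)" by simp
    then show ?thesis using has_vector_derivative_const vector_derivative_unique_at by metis
  qed
  note supp1 = dz[OF D1 supp]
  note supp2 = dz[OF D2 supp1]
  have int: "integrable lborel Q" by (rule integrable_of_continuous_support[OF cont supp])
  have int2: "integrable lborel Q2" by (rule integrable_of_continuous_support[OF cont2 supp2])
  have x2K: "fourier_inversion Q2 x = - (complex_of_real x)\<^sup>2 * K x" for x
    using fourier_inversion_deriv[OF D2 cont2 supp1 supp2, of x] fourier_inversion_deriv[OF D1 cont1 supp supp1, of x]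
    unfolding K power2_eq_square by (simp add: algebra_simps)
  have C0: "C \<ge> 0"
  proof -
    have "0 \<le> C / sqrt (2 * pi)" using L2(1) by (rule order_trans[rotated]) simp
    then show ?thesis using pi_gt_zero by (auto simp: zero_le_divide_iff)
  qed
  have [measurable]: "K \<in> borel_measurable borel"
    using fourier_inversion_measurable borel_measurable_integrable[OF int] unfolding K by simp
  have L2nn: "(\<integral>\<^sup>+x. ennreal ((norm (fourier_inversion P x))\<^sup>2) \<partial>lborel) \<le> ennreal (C\<^sup>2 / (2 * pi))"
    if P: "continuous_on UNIV P" "\<And>\<zeta>. \<bar>\<zeta>\<bar> > 1 \<Longrightarrow> P \<zeta> = 0" and b: "sqrt (LINT \<zeta>|lborel. (norm (P \<zeta>))\<^sup>2) \<le> C / sqrt (2 * pi)" for P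
  proof -
    have "(\<integral>\<^sup>+x. ennreal ((norm (fourier_inversion P x))\<^sup>2) \<partial>lborel) \<le> (\<integral>\<^sup>+\<zeta>. ennreal ((norm (P \<zeta>))\<^sup>2) \<partial>lborel)"
      by (rule bessel[OF integrable_of_continuous_support[OF P]])
    also have "\<dots> = ennreal (LINT \<zeta>|lborel. (norm (P \<zeta>))\<^sup>2)"
      by (rule nn_integral_eq_integral) (use P in \<open>auto intro!: integrable_of_continuous_support continuous_intros\<close>)
    also have "(LINT \<zeta>|lborel. (norm (P \<zeta>))\<^sup>2) \<le> C\<^sup>2 / (2 * pi)"
    proof -
      have "(sqrt (LINT \<zeta>|lborel. (norm (P \<zeta>))\<^sup>2))\<^sup>2 \<le> (C / sqrt (2 * pi))\<^sup>2"
        using b by (intro power_mono) auto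
      then show ?thesis by (simp add: power_divide)
    qed
    finally show ?thesis by (simp add: ennreal_leI)
  qed
  let ?w = "\<lambda>x. (1 + x\<^sup>2) * norm (K x)"
  have weight: "(\<integral>\<^sup>+x. ennreal ((?w x)\<^sup>2) \<partial>lborel) \<le> ennreal (2 * C\<^sup>2 / pi)"
  proof -
    have "(?w x)\<^sup>2 \<le> 2 * (norm (fourier_inversion Q x))\<^sup>2 + 2 * (norm (fourier_inversion Q2 x))\<^sup>2" for x
    proof -
      have "norm (fourier_inversion Q2 x) = x\<^sup>2 * norm (K x)" by (simp add: x2K norm_mult norm_power)
      then have "?w x = norm (fourier_inversion Q x) + norm (fourier_inversion Q2 x)" by (simp add: K distrib_right)
      then show ?thesis
        using sum_squares_bound[of "norm (fourier_inversion Q x)" "norm (fourier_inversion Q2 x)"] by (simp add: power2_sum)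
    qed
    then have "(\<integral>\<^sup>+x. ennreal ((?w x)\<^sup>2) \<partial>lborel) \<le> (\<integral>\<^sup>+x. 2 * ennreal ((norm (fourier_inversion Q x))\<^sup>2) + 2 * ennreal ((norm (fourier_inversion Q2 x))\<^sup>2) \<partial>lborel)"
      by (intro nn_integral_mono) (simp add: ennreal_leI ennreal_mult''[symmetric] ennreal_plus[symmetric] ennreal_numeral[symmetric] del: ennreal_plus ennreal_numeral)
    also have "\<dots> = 2 * (\<integral>\<^sup>+x. ennreal ((norm (fourier_inversion Q x))\<^sup>2) \<partial>lborel) + 2 * (\<integral>\<^sup>+x. ennreal ((norm (fourier_inversion Q2 x))\<^sup>2) \<partial>lborel)"
      using fourier_inversion_measurable borel_measurable_integrable[OF int] borel_measurable_integrable[OF int2]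
      by (subst nn_integral_add) (auto simp: nn_integral_cmult)
    also have "\<dots> \<le> 2 * ennreal (C\<^sup>2 / (2 * pi)) + 2 * ennreal (C\<^sup>2 / (2 * pi))"
      by (intro add_mono mult_left_mono L2nn cont cont2 supp supp2 L2) auto
    also have "\<dots> = ennreal (2 * C\<^sup>2 / pi)"
      by (simp add: ennreal_mult''[symmetric] ennreal_plus[symmetric] ennreal_numeral[symmetric] del: ennreal_plus ennreal_numeral)
    finally show ?thesis .
  qed
  have moment: "integrable lborel (\<lambda>x. complex_of_real (x ^ l) * K x) \<and> (LINT x|lborel. norm (complex_of_real (x ^ l) * K x)) \<le> C" if l: "l \<in> {0, 1}" for l :: nat
  proof -
    define a :: real where "a = (if l = 0 then 1 else -1)"
    define f where "f = (\<lambda>x::real. (if a = 1 then 1 else x\<^sup>2) / (1 + x\<^sup>2)\<^sup>2)"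
    have fl: "f x = (x ^ l / (1 + x\<^sup>2))\<^sup>2" for x using l by (auto simp: f_def a_def power_divide)
    have f: "integrable lborel f" "(LINT x|lborel. f x) = pi / 2"
      using rational_weight_integral[of a] by (auto simp: f_def a_def)
    have f0: "f x \<ge> 0" for x by (simp add: fl)
    \<comment> \<open>Only \<open>C \<ge> 0\<close> has been shown so far, while the weight
      \<open>t\<close> below divides by the constant; the slack \<open>e\<close> keeps it
      positive.\<close>
    have bound: "(\<integral>\<^sup>+x. ennreal (norm (complex_of_real (x ^ l) * K x)) \<partial>lborel) \<le> ennreal (C + e)" if e: "e > 0" for e
    proof -
      define C' where "C' = C + e"
      have C': "C' > 0" "C \<le> C'" using e C0 by (auto simp: C'_def)
      \<comment> \<open>This balances the two terms of the quadratic inequality below: each of them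
        contributes \<open>C' / 2\<close> to the integral.\<close>
      define t where "t = pi / (2 * C')"
      have t: "t > 0" using C' by (simp add: t_def)
      have pw: "norm (complex_of_real (x ^ l) * K x) \<le> t / 2 * (?w x)\<^sup>2 + 1 / (2 * t) * f x" for x
      proof -
        have pos: "1 + x\<^sup>2 > 0" by (simp add: add_pos_nonneg)
        have "norm (complex_of_real (x ^ l) * K x) = \<bar>x ^ l / (1 + x\<^sup>2)\<bar> * ?w x"
          using pos by (simp add: norm_mult norm_power abs_mult power_abs)
        also have "\<dots> \<le> t / 2 * (?w x)\<^sup>2 + 1 / (2 * t) * f x"
        proof -
          let ?u = "\<bar>x ^ l / (1 + x\<^sup>2)\<bar>"
          have "0 \<le> (t * ?w x - ?u)\<^sup>2" by simp
          then have "2 * t * (?u * ?w x) \<le> t\<^sup>2 * (?w x)\<^sup>2 + ?u\<^sup>2"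
            by (simp add: power2_diff power_mult_distrib mult_ac)
          then have "?u * ?w x \<le> (t\<^sup>2 * (?w x)\<^sup>2 + ?u\<^sup>2) / (2 * t)"
            using t by (simp add: pos_le_divide_eq mult_ac)
          also have "\<dots> = t / 2 * (?w x)\<^sup>2 + 1 / (2 * t) * ?u\<^sup>2"
          proof -
            have "(t\<^sup>2 * v + u) / (2 * t) = t / 2 * v + 1 / (2 * t) * u" for u v
              using t by (simp add: field_simps power2_eq_square)
            then show ?thesis .
          qed
          finally show ?thesis unfolding fl power2_abs .
        qed
        finally show ?thesis .
      qed
      have "(\<integral>\<^sup>+x. ennreal (norm (complex_of_real (x ^ l) * K x)) \<partial>lborel) \<le> (\<integral>\<^sup>+x. ennreal (t / 2) * ennreal ((?w x)\<^sup>2) + ennreal (1 / (2 * t)) * ennreal (f x) \<partial>lborel)"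
      proof (rule nn_integral_mono)
        fix x
        have "ennreal (norm (complex_of_real (x ^ l) * K x)) \<le> ennreal (t / 2 * (?w x)\<^sup>2 + 1 / (2 * t) * f x)"
          by (rule ennreal_leI[OF pw])
        also have "\<dots> = ennreal (t / 2) * ennreal ((?w x)\<^sup>2) + ennreal (1 / (2 * t)) * ennreal (f x)"
          using t f0[of x] by (intro ennreal_linear_combination) auto
        finally show "ennreal (norm (complex_of_real (x ^ l) * K x)) \<le> \<dots>" .
      qed
      also have "\<dots> = ennreal (t / 2) * (\<integral>\<^sup>+x. ennreal ((?w x)\<^sup>2) \<partial>lborel) + ennreal (1 / (2 * t)) * (\<integral>\<^sup>+x. ennreal (f x) \<partial>lborel)"
        using borel_measurable_integrable[OF f(1)] by (subst nn_integral_add) (auto simp: nn_integral_cmult)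
      also have "(\<integral>\<^sup>+x. ennreal (f x) \<partial>lborel) = ennreal (pi / 2)"
        using nn_integral_eq_integral[OF f(1)] f0 f(2) by simp
      also have "ennreal (t / 2) * (\<integral>\<^sup>+x. ennreal ((?w x)\<^sup>2) \<partial>lborel) + ennreal (1 / (2 * t)) * ennreal (pi / 2)
          \<le> ennreal (t / 2) * ennreal (2 * C'\<^sup>2 / pi) + ennreal (1 / (2 * t)) * ennreal (pi / 2)"
        using C' C0 by (intro add_mono mult_left_mono order_trans[OF weight] ennreal_leI divide_right_mono power_mono) auto
      also have "\<dots> = ennreal (t / 2 * (2 * C'\<^sup>2 / pi) + 1 / (2 * t) * (pi / 2))"
        using t by (intro ennreal_linear_combination[symmetric]) auto
      also have "t / 2 * (2 * C'\<^sup>2 / pi) + 1 / (2 * t) * (pi / 2) = C'"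
        using C' by (simp add: t_def field_simps power2_eq_square)
      finally show ?thesis by (simp add: C'_def)
    qed
    have i: "integrable lborel (\<lambda>x. complex_of_real (x ^ l) * K x)"
    proof (rule integrableI_bounded)
      show "(\<integral>\<^sup>+x. ennreal (norm (complex_of_real (x ^ l) * K x)) \<partial>lborel) < \<infinity>"
        using bound[of 1] by (simp add: le_less_trans)
    qed measurable
    moreover have "(LINT x|lborel. norm (complex_of_real (x ^ l) * K x)) \<le> C"
    proof (rule field_le_epsilon)
      fix e :: real assume e: "e > 0"
      have "ennreal (LINT x|lborel. norm (complex_of_real (x ^ l) * K x)) = (\<integral>\<^sup>+x. ennreal (norm (complex_of_real (x ^ l) * K x)) \<partial>lborel)"
        by (rule nn_integral_eq_integral[symmetric, OF integrable_norm[OF i]]) simp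
      also have "\<dots> \<le> ennreal (C + e)" by (rule bound[OF e])
      finally show "(LINT x|lborel. norm (complex_of_real (x ^ l) * K x)) \<le> C + e"
        using C0 e by (subst (asm) ennreal_le_iff) auto
    qed
    ultimately show ?thesis by blast
  qed
  have "(LINT x|lborel. K x) = 1"
  proof -
    have "bounded (Q ` {-1..1})"
      by (intro compact_imp_bounded compact_continuous_image continuous_on_subset[OF cont]) auto
    then obtain B where "\<forall>q\<in>Q ` {-1..1}. norm q \<le> B" unfolding bounded_iff by blast
    then have B: "\<And>\<zeta>. \<zeta> \<in> {-1..1} \<Longrightarrow> norm (Q \<zeta>) \<le> B" by blast
    have "norm (Q \<zeta>) \<le> max B 0" for \<zeta>
      using B[of \<zeta>] supp[of \<zeta>] by (cases "\<zeta> \<in> {-1..1}") (auto simp: le_max_iff_disj abs_if split: if_splits)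
    moreover have "integrable lborel (fourier_inversion Q)" using moment[of 0] by (simp add: K)
    ultimately have "(LINT x|lborel. K x) = complex_of_real (sqrt (2 * pi)) * Q 0"
      unfolding K by (intro integral_fourier_inversion[OF int _ cont]) auto
    then show ?thesis by (simp add: Q0 flip: of_real_mult)
  qed
  moreover have nd: "nth_deriv k K = fourier_inversion (\<lambda>\<zeta>. (\<i> * complex_of_real \<zeta>) ^ k * Q \<zeta>)"
    "(nth_deriv k K has_vector_derivative nth_deriv (Suc k) K x) (at x)" for k x
    using nth_deriv_fourier_inversion[OF cont supp, of k] unfolding K by auto
  moreover have "times_differentiable (s - 2) K"
    unfolding times_differentiable_def using nd(2) differentiableI_vector by blast
  moreover have "2 * esssup lborel (\<lambda>x. ereal (norm (nth_deriv k K x))) \<le> ereal C" for k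
  proof -
    have "norm (nth_deriv k K x) \<le> C / 2" for x
    proof -
      have iQ: "integrable lborel (\<lambda>\<zeta>. norm ((\<i> * complex_of_real \<zeta>) ^ k * Q \<zeta>))"
        by (rule integrable_of_continuous_support) (use supp in \<open>auto intro!: continuous_intros cont\<close>)
      have "(LINT \<zeta>|lborel. norm ((\<i> * complex_of_real \<zeta>) ^ k * Q \<zeta>)) \<le> (LINT \<zeta>|lborel. norm (Q \<zeta>))"
      proof (rule integral_mono[OF iQ integrable_norm[OF int]])
        fix \<zeta>
        show "norm ((\<i> * complex_of_real \<zeta>) ^ k * Q \<zeta>) \<le> norm (Q \<zeta>)"
        proof (cases "\<bar>\<zeta>\<bar> > 1")
          case False
          then have "\<bar>\<zeta>\<bar> ^ k \<le> 1" by (intro power_le_one) auto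
          then show ?thesis by (simp add: norm_mult norm_power mult_left_le_one_le)
        qed (simp add: supp)
      qed
      also note L1
      finally have "norm (nth_deriv k K x) \<le> C / sqrt (2 / pi) / sqrt (2 * pi)"
        unfolding nd(1) by (rule norm_fourier_inversion_le)
      also have "sqrt (2 / pi) * sqrt (2 * pi) = 2" by (simp flip: real_sqrt_mult)
      then have "C / sqrt (2 / pi) / sqrt (2 * pi) = C / 2" by (simp only: divide_divide_eq_left)
      finally show ?thesis .
    qed
    moreover have "nth_deriv k K \<in> borel_measurable borel"
      using has_vector_derivative_imp_continuous_on[OF nd(2)] by (rule borel_measurable_continuous_onI)
    ultimately have "esssup lborel (\<lambda>x. ereal (norm (nth_deriv k K x))) \<le> ereal (C / 2)"
      by (intro esssup_I) (auto intro!: AE_I2)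
    then have "2 * esssup lborel (\<lambda>x. ereal (norm (nth_deriv k K x))) \<le> 2 * ereal (C / 2)"
      by (intro ereal_mult_left_mono) auto
    then show ?thesis by simp
  qed
  ultimately show ?thesis using moment unfolding kernel_condition_def by auto
qed

section \<open>Moments of independent sums\<close>

text \<open>Convexity of the even power, obtained from Bernoulli's inequality at
  \<open>y / x\<close>; the division is why \<open>x = 0\<close> is treated apart.\<close>

lemma even_power_tangent:
  fixes x y :: real
  assumes "k > 0"
  shows "x ^ (2 * k) + real (2 * k) * (x ^ (2 * k - 1) * y) \<le> (x + y) ^ (2 * k)"
proof (cases "x = 0")
  case True
  have "0 \<le> y ^ (2 * k)" by (simp add: zero_le_even_power)
  then show ?thesis using assms True by (simp add: power_0_left)
next
  case False
  have "x ^ (2 * k) * (1 + real (2 * k) * (y / x)) \<le> x ^ (2 * k) * (1 + y / x) ^ (2 * k)"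
    by (intro mult_left_mono Bernoulli_inequality_even) auto
  also have "\<dots> = (x * (1 + y / x)) ^ (2 * k)" by (rule power_mult_distrib[symmetric])
  also have "x * (1 + y / x) = x + y" using False by (simp add: field_simps)
  also have "x ^ (2 * k) * (1 + real (2 * k) * (y / x)) = x ^ (2 * k) + real (2 * k) * (x ^ (2 * k - 1) * y)"
  proof -
    have "x ^ (2 * k) = x * x ^ (2 * k - 1)" using assms by (simp add: power_eq_if)
    then have "x ^ (2 * k) * (y / x) = x ^ (2 * k - 1) * y" using False by simp
    then show ?thesis by (simp only: distrib_left mult_1_right mult.left_commute[of "x ^ (2 * k)"])
  qed
  finally show ?thesis .
qed

lemma power_add_le:
  fixes x y :: real
  shows "(x + y) ^ (2 * k) \<le> 2 ^ (2 * k) * (x ^ (2 * k) + y ^ (2 * k))"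
proof -
  have "(x + y) ^ (2 * k) = \<bar>x + y\<bar> ^ (2 * k)" by (rule power_even_abs[symmetric]) simp
  also have "\<dots> \<le> (2 * max \<bar>x\<bar> \<bar>y\<bar>) ^ (2 * k)"
    by (intro power_mono) auto
  also have "\<dots> = 2 ^ (2 * k) * max \<bar>x\<bar> \<bar>y\<bar> ^ (2 * k)" by (rule power_mult_distrib)
  also have "max \<bar>x\<bar> \<bar>y\<bar> ^ (2 * k) \<le> \<bar>x\<bar> ^ (2 * k) + \<bar>y\<bar> ^ (2 * k)"
    by (auto simp: max_def)
  also have "\<dots> = x ^ (2 * k) + y ^ (2 * k)" by (simp add: power_even_abs)
  finally show ?thesis by simp
qed

text \<open>A crude substitute for Young's inequality with weights \<open>1 - k / s\<close> and
  \<open>k / s\<close>. It reduces mixed terms to pure moments of order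
  \<open>2 * s\<close>.\<close>

lemma power_mult_power_le:
  fixes a t :: real
  assumes "k \<le> s"
  shows "a ^ (2 * (s - k)) * t ^ (2 * k) \<le> a ^ (2 * s) + t ^ (2 * s)"
proof -
  let ?m = "max \<bar>a\<bar> \<bar>t\<bar>"
  have "a ^ (2 * (s - k)) * t ^ (2 * k) = \<bar>a\<bar> ^ (2 * (s - k)) * \<bar>t\<bar> ^ (2 * k)"
    by (simp add: power_even_abs)
  also have "\<dots> \<le> ?m ^ (2 * (s - k)) * ?m ^ (2 * k)"
    by (intro mult_mono power_mono) auto
  also have "\<dots> = ?m ^ (2 * s)" using assms by (simp flip: power_add distrib_left)
  also have "\<dots> \<le> \<bar>a\<bar> ^ (2 * s) + \<bar>t\<bar> ^ (2 * s)" by (auto simp: max_def)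
  also have "\<dots> = a ^ (2 * s) + t ^ (2 * s)" by (simp add: power_even_abs)
  finally show ?thesis .
qed

text \<open>Cauchy-Schwarz with the weights split into square roots. It serves averages over
  colourings, binomial weights, the mean over coordinates and the final sum of three errors.\<close>

lemma weighted_sum_square_le:
  fixes p b :: "'i \<Rightarrow> real"
  assumes "\<And>i. i \<in> I \<Longrightarrow> p i \<ge> 0"
  shows "(\<Sum>i\<in>I. p i * b i)\<^sup>2 \<le> (\<Sum>i\<in>I. p i) * (\<Sum>i\<in>I. p i * (b i)\<^sup>2)"
proof -
  have "(\<Sum>i\<in>I. sqrt (p i) * (sqrt (p i) * b i))\<^sup>2 \<le> (\<Sum>i\<in>I. (sqrt (p i))\<^sup>2) * (\<Sum>i\<in>I. (sqrt (p i) * b i)\<^sup>2)"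
    by (rule Cauchy_Schwarz_ineq_sum)
  moreover have "(\<Sum>i\<in>I. sqrt (p i) * (sqrt (p i) * b i)) = (\<Sum>i\<in>I. p i * b i)"
    using assms by (intro sum.cong) (auto simp flip: mult.assoc)
  moreover have "(\<Sum>i\<in>I. (sqrt (p i))\<^sup>2) = (\<Sum>i\<in>I. p i)" "(\<Sum>i\<in>I. (sqrt (p i) * b i)\<^sup>2) = (\<Sum>i\<in>I. p i * (b i)\<^sup>2)"
    using assms by (auto intro!: sum.cong simp: power_mult_distrib)
  ultimately show ?thesis by simp
qed

lemma sum_power_div_fact_le_exp:
  fixes x :: real
  assumes "x \<ge> 0" "finite I"
  shows "(\<Sum>k\<in>I. x ^ k / fact k) \<le> exp x"
proof -
  have "(\<lambda>k. x ^ k / fact k) sums exp x"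
    using exp_converges[of x] by (simp add: scaleR_conv_of_real divide_inverse mult.commute)
  then have "summable (\<lambda>k. x ^ k / fact k)" "(\<Sum>k. x ^ k / fact k) = exp x"
    by (simp_all add: sums_iff)
  moreover from this(1) have "(\<Sum>k\<in>I. x ^ k / fact k) \<le> (\<Sum>k. x ^ k / fact k)"
    by (rule sum_le_suminf) (use assms in auto)
  ultimately show ?thesis by simp
qed

lemma power_le_fact_mult_exp: "real k ^ k \<le> fact k * exp (real k)"
  using sum_power_div_fact_le_exp[of "real k" "{k}"] by (simp add: field_simps)

text \<open>Relative to \<open>n ^ k\<close>, the right side is the product of the
  \<open>1 - i / n\<close> over \<open>i < k\<close>, hence at least 1 minus the sum of the
  \<open>i / n\<close>, which is at most \<open>k^2 / (2 n)\<close>.\<close>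

lemma falling_factorial_lower_bound:
  assumes "k \<le> n"
  shows "real n ^ k * (1 - real k ^ 2 / (2 * real n)) \<le> fact k * real (n choose k)"
  using assms
proof (induction k)
  case 0
  then show ?case by simp
next
  case (Suc k)
  have n: "real n > 0" "real n - real k \<ge> 0" using Suc.prems by auto
  have step: "fact (Suc k) * real (n choose Suc k) = fact k * real (n choose k) * (real n - real k)"
  proof -
    have "fact (n - k) = (real n - real k) * fact (n - Suc k)"
      using Suc.prems by (subst fact_reduce) (auto simp: of_nat_diff)
    then show ?thesis
      using Suc.prems fact_binomial[of "Suc k" n, where 'a = real] fact_binomial[of k n, where 'a = real] by simp
  qed
  have "real n ^ Suc k * (1 - real (Suc k) ^ 2 / (2 * real n))
      \<le> real n ^ k * (1 - real k ^ 2 / (2 * real n)) * (real n - real k)"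
  proof -
    have "real n * (1 - real (Suc k) ^ 2 / (2 * real n)) = real n - (real k ^ 2 + 2 * real k + 1) / 2"
      using n by (simp add: field_simps power2_eq_square)
    also have "\<dots> \<le> real n - real k ^ 2 / 2 - real k + real k * (real k ^ 2 / (2 * real n))"
      using n by (simp add: field_simps)
    also have "\<dots> = (1 - real k ^ 2 / (2 * real n)) * (real n - real k)"
      using n by (simp add: field_simps)
    finally have "real n ^ k * (real n * (1 - real (Suc k) ^ 2 / (2 * real n))) \<le> real n ^ k * ((1 - real k ^ 2 / (2 * real n)) * (real n - real k))"
      by (intro mult_left_mono) auto
    then show ?thesis by (simp only: power_Suc2 mult.assoc)
  qed
  also have "\<dots> \<le> fact k * real (n choose k) * (real n - real k)"
    using Suc n by (intro mult_right_mono) auto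
  finally show ?case unfolding step .
qed

section \<open>Even moments of independent centred sums\<close>

context prob_space
begin

lemma integrable_even_power_add:
  fixes X Y :: "'a \<Rightarrow> real"
  assumes [measurable]: "X \<in> borel_measurable M" "Y \<in> borel_measurable M"
    and int: "integrable M (\<lambda>\<omega>. X \<omega> ^ (2 * k))" "integrable M (\<lambda>\<omega>. Y \<omega> ^ (2 * k))"
  shows "integrable M (\<lambda>\<omega>. (X \<omega> + Y \<omega>) ^ (2 * k))"
proof (rule Bochner_Integration.integrable_bound)
  show "integrable M (\<lambda>\<omega>. 2 ^ (2 * k) * (X \<omega> ^ (2 * k) + Y \<omega> ^ (2 * k)))" using int by simp
  show "AE \<omega> in M. norm ((X \<omega> + Y \<omega>) ^ (2 * k)) \<le> norm (2 ^ (2 * k) * (X \<omega> ^ (2 * k) + Y \<omega> ^ (2 * k)))"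
    using power_add_le by (intro AE_I2) (auto simp: power_abs power_even_abs intro: order_trans[OF _ abs_ge_self])
qed measurable

lemma integrable_even_power_sum:
  fixes X :: "'i \<Rightarrow> 'a \<Rightarrow> real"
  assumes "finite I" "k > 0"
    and "\<And>i. i \<in> I \<Longrightarrow> X i \<in> borel_measurable M" "\<And>i. i \<in> I \<Longrightarrow> integrable M (\<lambda>\<omega>. X i \<omega> ^ (2 * k))"
  shows "integrable M (\<lambda>\<omega>. (\<Sum>i\<in>I. c i * X i \<omega>) ^ (2 * k))"
  using assms
proof (induction I rule: finite_induct)
  case (insert i I)
  have "integrable M (\<lambda>\<omega>. (c i * X i \<omega> + (\<Sum>i\<in>I. c i * X i \<omega>)) ^ (2 * k))"
    using insert by (intro integrable_even_power_add insert.IH borel_measurable_sum borel_measurable_times)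
      (auto simp: power_mult_distrib)
  then show ?case using insert by simp
qed (simp add: power_0_left)

lemma integrable_lower_power:
  fixes X :: "'a \<Rightarrow> real"
  assumes [measurable]: "X \<in> borel_measurable M" and int: "integrable M (\<lambda>\<omega>. X \<omega> ^ (2 * k))" and "j \<le> 2 * k"
  shows "integrable M (\<lambda>\<omega>. X \<omega> ^ j)"
proof (rule Bochner_Integration.integrable_bound)
  show "integrable M (\<lambda>\<omega>. 1 + X \<omega> ^ (2 * k))" using int by simp
  have "\<bar>x\<bar> ^ j \<le> 1 + x ^ (2 * k)" for x :: real
  proof (cases "\<bar>x\<bar> \<le> 1")
    case True
    then have "\<bar>x\<bar> ^ j \<le> 1" by (intro power_le_one) auto
    then show ?thesis by (simp add: zero_le_even_power add_increasing2)
  next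
    case False
    then have "\<bar>x\<bar> ^ j \<le> \<bar>x\<bar> ^ (2 * k)" using assms(3) by (intro power_increasing) auto
    then show ?thesis by (simp add: power_even_abs)
  qed
  then show "AE \<omega> in M. norm (X \<omega> ^ j) \<le> norm (1 + X \<omega> ^ (2 * k))"
    by (intro AE_I2) (auto simp: power_abs intro: order_trans[OF _ abs_ge_self])
qed measurable

text \<open>The tangent line of the even power at \<open>\<Sum>\<^sub>A\<close> has a slope independent of the omitted summands.\<close>

lemma even_moment_partial_sum_le:
  fixes X :: "'i \<Rightarrow> 'a \<Rightarrow> real"
  assumes I: "finite I" and indep: "indep_vars (\<lambda>_. borel) X I" and k: "k > 0"
    and int: "\<And>i. i \<in> I \<Longrightarrow> integrable M (\<lambda>\<omega>. X i \<omega> ^ (2 * k))"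
    and mean: "\<And>i. i \<in> I \<Longrightarrow> integrable M (X i) \<and> expectation (X i) = 0"
    and A: "A \<subseteq> I"
  shows "expectation (\<lambda>\<omega>. (\<Sum>i\<in>A. X i \<omega>) ^ (2 * k)) \<le> expectation (\<lambda>\<omega>. (\<Sum>i\<in>I. X i \<omega>) ^ (2 * k))"
proof -
  have fA: "finite A" using A I finite_subset by blast
  have meas: "X i \<in> borel_measurable M" if "i \<in> I" for i
    using indep that by (auto simp: indep_vars_def)
  let ?S = "\<lambda>B \<omega>. \<Sum>i\<in>B. X i \<omega>"
  have intS: "integrable M (\<lambda>\<omega>. ?S B \<omega> ^ (2 * k))" if "B \<subseteq> I" for B
    using integrable_even_power_sum[of B k X "\<lambda>_. 1"] that finite_subset[OF that I] meas int k by auto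
  have mS: "?S B \<in> borel_measurable M" if "B \<subseteq> I" for B
    using that meas by (intro borel_measurable_sum) auto
  have cross: "integrable M (\<lambda>\<omega>. X j \<omega> * ?S A \<omega> ^ (2 * k - 1)) \<and> expectation (\<lambda>\<omega>. X j \<omega> * ?S A \<omega> ^ (2 * k - 1)) = 0" if j: "j \<in> I - A" for j
  proof -
    have "indep_vars (\<lambda>_. borel) X (insert j A)" using indep j A by (intro indep_vars_subset[OF indep]) auto
    then have "indep_var borel (X j) borel (?S A)" using j fA by (intro indep_vars_sum) auto
    then have "indep_var borel ((\<lambda>x. x) \<circ> X j) borel ((\<lambda>y. y ^ (2 * k - 1)) \<circ> ?S A)"
      by (rule indep_var_compose) auto
    then have iv: "indep_var borel (X j) borel (\<lambda>\<omega>. ?S A \<omega> ^ (2 * k - 1))" by (simp add: o_def)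
    have i1: "integrable M (\<lambda>\<omega>. ?S A \<omega> ^ (2 * k - 1))" by (rule integrable_lower_power[OF mS[OF A] intS[OF A]]) simp
    show ?thesis
      using indep_var_lebesgue_integral[OF iv _ i1] indep_var_integrable[OF iv _ i1] mean[of j] j by auto
  qed
  have IA: "?S I \<omega> = ?S A \<omega> + ?S (I - A) \<omega>" for \<omega>
    using sum.subset_diff[OF A I, of "\<lambda>i. X i \<omega>"] by simp
  have crossS: "?S A \<omega> ^ (2 * k - 1) * ?S (I - A) \<omega> = (\<Sum>j\<in>I - A. X j \<omega> * ?S A \<omega> ^ (2 * k - 1))" for \<omega>
    unfolding sum_distrib_right[symmetric] by (rule mult.commute)
  have i2: "integrable M (\<lambda>\<omega>. ?S A \<omega> ^ (2 * k - 1) * ?S (I - A) \<omega>)"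
    unfolding crossS using cross by (intro Bochner_Integration.integrable_sum) auto
  have e2: "expectation (\<lambda>\<omega>. ?S A \<omega> ^ (2 * k - 1) * ?S (I - A) \<omega>) = 0"
    unfolding crossS using cross by (subst Bochner_Integration.integral_sum) auto
  have "expectation (\<lambda>\<omega>. ?S A \<omega> ^ (2 * k)) = expectation (\<lambda>\<omega>. ?S A \<omega> ^ (2 * k) + real (2 * k) * (?S A \<omega> ^ (2 * k - 1) * ?S (I - A) \<omega>))"
    using intS[OF A] i2 e2 by simp
  also have "\<dots> \<le> expectation (\<lambda>\<omega>. ?S I \<omega> ^ (2 * k))"
    using intS[OF A] i2 intS[OF subset_refl] unfolding IA
    by (intro integral_mono even_power_tangent k) auto
  finally show ?thesis .
qed

text \<open>Where the two patterns agree the terms coincide, elsewhere they are opposite, so the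
  \<open>w\<close>-sum is a difference of two partial sums of the \<open>e\<close>-sum. Each partial
  sum has at most the moment of the full sum; the constant is \<open>2^(2k)\<close> for the power of
  a difference times 2 for the two parts.\<close>

lemma even_moment_sign_change_le:
  fixes X :: "'i \<Rightarrow> 'a \<Rightarrow> real"
  assumes I: "finite I" and indep: "indep_vars (\<lambda>_. borel) X I" and k: "k > 0"
    and int: "\<And>i. i \<in> I \<Longrightarrow> integrable M (\<lambda>\<omega>. X i \<omega> ^ (2 * k))"
    and mean: "\<And>i. i \<in> I \<Longrightarrow> integrable M (X i) \<and> expectation (X i) = 0"
    and signs: "\<And>i. i \<in> I \<Longrightarrow> w i \<in> {-1, 1}" "\<And>i. i \<in> I \<Longrightarrow> e i \<in> {-1, 1}"
  shows "expectation (\<lambda>\<omega>. (\<Sum>i\<in>I. w i * X i \<omega>) ^ (2 * k))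
    \<le> 2 ^ (2 * k + 1) * expectation (\<lambda>\<omega>. (\<Sum>i\<in>I. e i * X i \<omega>) ^ (2 * k))"
proof -
  let ?Y = "\<lambda>i \<omega>. e i * X i \<omega>"
  define A where "A = {i \<in> I. w i = e i}"
  have A: "A \<subseteq> I" "I - A \<subseteq> I" by (auto simp: A_def)
  have meas: "X i \<in> borel_measurable M" if "i \<in> I" for i
    using indep that by (auto simp: indep_vars_def)
  have indepY: "indep_vars (\<lambda>_. borel) ?Y I"
    by (rule indep_vars_compose2[OF indep]) auto
  have intY: "integrable M (\<lambda>\<omega>. ?Y i \<omega> ^ (2 * k))" if "i \<in> I" for i
    using int[OF that] by (simp add: power_mult_distrib)
  have meanY: "integrable M (?Y i) \<and> expectation (?Y i) = 0" if "i \<in> I" for i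
    using mean[OF that] by simp
  let ?E = "expectation (\<lambda>\<omega>. (\<Sum>i\<in>I. ?Y i \<omega>) ^ (2 * k))"
  have le: "expectation (\<lambda>\<omega>. (\<Sum>i\<in>B. ?Y i \<omega>) ^ (2 * k)) \<le> ?E" if "B \<subseteq> I" for B
    by (rule even_moment_partial_sum_le[OF I indepY k intY meanY that])
  have intS: "integrable M (\<lambda>\<omega>. (\<Sum>i\<in>B. ?Y i \<omega>) ^ (2 * k))" if "B \<subseteq> I" for B
    using integrable_even_power_sum[of B k X e] that finite_subset[OF that I] meas int k by auto
  have split: "(\<Sum>i\<in>I. w i * X i \<omega>) = (\<Sum>i\<in>A. ?Y i \<omega>) + - (\<Sum>i\<in>I - A. ?Y i \<omega>)" for \<omega>
  proof -
    have "(\<Sum>i\<in>A. w i * X i \<omega>) = (\<Sum>i\<in>A. ?Y i \<omega>)" by (rule sum.cong) (auto simp: A_def)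
    moreover have "w i = - e i" if "i \<in> I - A" for i using signs[of i] that by (auto simp: A_def)
    then have "(\<Sum>i\<in>I - A. w i * X i \<omega>) = - (\<Sum>i\<in>I - A. ?Y i \<omega>)"
      unfolding sum_negf[symmetric] by (intro sum.cong) auto
    ultimately show ?thesis using sum.subset_diff[OF A(1) I, of "\<lambda>i. w i * X i \<omega>"] by simp
  qed
  have pw: "(\<Sum>i\<in>I. w i * X i \<omega>) ^ (2 * k) \<le> 2 ^ (2 * k) * ((\<Sum>i\<in>A. ?Y i \<omega>) ^ (2 * k) + (\<Sum>i\<in>I - A. ?Y i \<omega>) ^ (2 * k))" for \<omega>
    using power_add_le[of "\<Sum>i\<in>A. ?Y i \<omega>" "- (\<Sum>i\<in>I - A. ?Y i \<omega>)" k] unfolding split by simp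
  have "expectation (\<lambda>\<omega>. (\<Sum>i\<in>I. w i * X i \<omega>) ^ (2 * k))
      \<le> expectation (\<lambda>\<omega>. 2 ^ (2 * k) * ((\<Sum>i\<in>A. ?Y i \<omega>) ^ (2 * k) + (\<Sum>i\<in>I - A. ?Y i \<omega>) ^ (2 * k)))"
    using integrable_even_power_sum[OF I k meas int] intS A
    by (intro integral_mono pw) auto
  also have "\<dots> = 2 ^ (2 * k) * (expectation (\<lambda>\<omega>. (\<Sum>i\<in>A. ?Y i \<omega>) ^ (2 * k)) + expectation (\<lambda>\<omega>. (\<Sum>i\<in>I - A. ?Y i \<omega>) ^ (2 * k)))"
    using intS A by simp
  also have "\<dots> \<le> 2 ^ (2 * k) * (?E + ?E)" by (intro mult_left_mono add_mono le A) auto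
  finally show ?thesis by simp
qed

text \<open>Pythagoras for orthogonal random coefficients. The fixed vectors lie in a real inner
  product space so that complex derivatives of the smoothed function can take their place.\<close>

lemma expectation_norm_square_orthogonal_sum:
  fixes G :: "'i \<Rightarrow> 'b::{real_inner, banach, second_countable_topology}"
  assumes I: "finite I"
    and int: "\<And>i j. i \<in> I \<Longrightarrow> j \<in> I \<Longrightarrow> integrable M (\<lambda>\<omega>. X i \<omega> * X j \<omega> :: real)"
    and orth: "\<And>i j. i \<in> I \<Longrightarrow> j \<in> I \<Longrightarrow> i \<noteq> j \<Longrightarrow> expectation (\<lambda>\<omega>. X i \<omega> * X j \<omega>) = 0"
  shows "integrable M (\<lambda>\<omega>. (norm (\<Sum>i\<in>I. X i \<omega> *\<^sub>R G i))\<^sup>2)"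
    and "expectation (\<lambda>\<omega>. (norm (\<Sum>i\<in>I. X i \<omega> *\<^sub>R G i))\<^sup>2) = (\<Sum>i\<in>I. (norm (G i))\<^sup>2 * expectation (\<lambda>\<omega>. (X i \<omega>)\<^sup>2))"
proof -
  have eq: "(norm (\<Sum>i\<in>I. X i \<omega> *\<^sub>R G i))\<^sup>2 = (\<Sum>i\<in>I. \<Sum>j\<in>I. (G i \<bullet> G j) * (X i \<omega> * X j \<omega>))" for \<omega>
    by (simp add: power2_norm_eq_inner inner_sum_left inner_sum_right mult_ac inner_commute)
  show "integrable M (\<lambda>\<omega>. (norm (\<Sum>i\<in>I. X i \<omega> *\<^sub>R G i))\<^sup>2)"
    unfolding eq using int by (intro Bochner_Integration.integrable_sum integrable_mult_right) auto
  have "expectation (\<lambda>\<omega>. (norm (\<Sum>i\<in>I. X i \<omega> *\<^sub>R G i))\<^sup>2) = (\<Sum>i\<in>I. \<Sum>j\<in>I. (G i \<bullet> G j) * expectation (\<lambda>\<omega>. X i \<omega> * X j \<omega>))"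
    unfolding eq using int by (subst Bochner_Integration.integral_sum; (intro Bochner_Integration.integrable_sum integrable_mult_right)?; auto)+
  also have "\<dots> = (\<Sum>i\<in>I. \<Sum>j\<in>I. if j = i then (norm (G i))\<^sup>2 * expectation (\<lambda>\<omega>. (X i \<omega>)\<^sup>2) else 0)"
    using orth by (intro sum.cong) (auto simp: dot_square_norm power2_eq_square[of "X i \<omega>" for i \<omega>])
  also have "\<dots> = (\<Sum>i\<in>I. (norm (G i))\<^sup>2 * expectation (\<lambda>\<omega>. (X i \<omega>)\<^sup>2))"
    using I by simp
  finally show "expectation (\<lambda>\<omega>. (norm (\<Sum>i\<in>I. X i \<omega> *\<^sub>R G i))\<^sup>2) = \<dots>" .
qed

end

text \<open>For \<open>k > n\<close> this is \<open>0 / 0 = 0\<close>.\<close>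
definition ustat :: "nat \<Rightarrow> nat \<Rightarrow> (nat \<Rightarrow> real) \<Rightarrow> real" where
  "ustat n k y = esym {1..n} k y / real (n choose k)"

lemma ustat_0 [simp]: "ustat n 0 y = 1"
proof -
  have "{A. A \<subseteq> {1..n} \<and> card A = 0} = {{}}" using finite_subset[of _ "{1..n}"] by auto
  then show ?thesis by (simp add: ustat_def esym_def)
qed

section \<open>From Rademacher moments to fixed signs\<close>

context noisy_observations
begin

definition noise :: "'d \<Rightarrow> nat \<Rightarrow> 'w \<Rightarrow> real" where
  "noise a j \<omega> = x j \<omega> $ a - \<theta> $ a"

lemma noise_indep: "indep_vars (\<lambda>_. borel) (noise a) {1..n}"
proof -
  have "(\<lambda>v::real ^ 'd. v $ a - \<theta> $ a) \<in> borel_measurable borel"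
    by (intro borel_measurable_continuous_onI continuous_intros)
  then show ?thesis
    unfolding noise_def[abs_def] by (intro indep_vars_compose2[OF independent]) auto
qed

lemma noise_measurable: "j \<in> {1..n} \<Longrightarrow> noise a j \<in> borel_measurable M"
  using noise_indep[of a] by (auto simp: indep_vars_def)

lemma noise_mean:
  assumes "j \<in> {1..n}"
  shows "integrable M (noise a j)" "expectation (noise a j) = 0"
proof -
  have bl: "bounded_linear (\<lambda>v::real ^ 'd. v $ a)" by (rule bounded_linear_vec_nth)
  have i: "integrable M (\<lambda>\<omega>. x j \<omega> $ a)"
    using mean[OF assms] by (intro integrable_bounded_linear[OF bl]) auto
  have "expectation (\<lambda>\<omega>. x j \<omega> $ a) = \<theta> $ a"
    using integral_bounded_linear[OF bl, of M "x j"] mean[OF assms] by auto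
  with i show "integrable M (noise a j)" "expectation (noise a j) = 0"
    by (auto simp: noise_def[abs_def] prob_space)
qed

definition sign_patterns :: "(nat \<Rightarrow> real) set" where
  "sign_patterns = {1..n} \<rightarrow>\<^sub>E {-1, 1}"

lemma sign_patterns: "finite sign_patterns" "card sign_patterns = 2 ^ n"
  by (simp_all add: sign_patterns_def finite_PiE card_PiE numeral_2_eq_2)

definition sign_event :: "(nat \<Rightarrow> real) \<Rightarrow> 'w set" where
  "sign_event e = {\<omega> \<in> space M. \<forall>j\<in>{1..n}. \<epsilon>' j \<omega> = e j}"

text \<open>The case distinction is there because an intersection over no indices is
  \<open>UNIV\<close> and not \<open>space M\<close>.\<close>

lemma sign_event_eq:
  "sign_event e = (if n = 0 then space M else (\<Inter>j\<in>{1..n}. \<epsilon>' j -` {e j} \<inter> space M))"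
  by (auto simp: sign_event_def)

lemma sign_event_measurable: "sign_event e \<in> sets M"
proof -
  have "\<epsilon>' j \<in> borel_measurable M" if "j \<in> {1..n}" for j
    using signs_independent that by (auto simp: indep_vars_def)
  then have "\<epsilon>' j -` {e j} \<inter> space M \<in> sets M" if "j \<in> {1..n}" for j
    using that by (auto intro: measurable_sets)
  then have "n \<noteq> 0 \<Longrightarrow> (\<Inter>j\<in>{1..n}. \<epsilon>' j -` {e j} \<inter> space M) \<in> sets M"
    by (intro sets.finite_INT) auto
  then show ?thesis unfolding sign_event_eq by (simp split: if_split)
qed

lemma prob_sign_event:
  assumes e: "e \<in> sign_patterns"
  shows "prob (sign_event e) = (1 / 2) ^ n"
proof (cases "n = 0")
  case True
  then show ?thesis unfolding sign_event_eq by (simp add: prob_space)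
next
  case False
  have "prob (\<Inter>j\<in>{1..n}. \<epsilon>' j -` {e j} \<inter> space M) = (\<Prod>j\<in>{1..n}. prob (\<epsilon>' j -` {e j} \<inter> space M))"
    by (rule indep_varsD_finite[OF signs_independent]) (use False in auto)
  also have "\<dots> = (\<Prod>j\<in>{1..n}. 1 / 2)"
  proof (rule prod.cong[OF refl])
    fix j assume j: "j \<in> {1..n}"
    then have "e j \<in> {-1, 1}" using e by (auto simp: sign_patterns_def)
    moreover have "\<epsilon>' j -` {c} \<inter> space M = {\<omega> \<in> space M. \<epsilon>' j \<omega> = c}" for c by auto
    ultimately show "prob (\<epsilon>' j -` {e j} \<inter> space M) = 1 / 2" using signs[OF j] by auto
  qed
  finally show ?thesis using False by (simp add: sign_event_eq)
qed

definition signed_mean :: "'d \<Rightarrow> (nat \<Rightarrow> real) \<Rightarrow> 'w \<Rightarrow> real" where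
  "signed_mean a e \<omega> = (\<Sum>j\<in>{1..n}. e j * noise a j \<omega>) / real n"

lemma signed_mean_measurable: "signed_mean a e \<in> borel_measurable M"
  unfolding signed_mean_def[abs_def]
  by (intro borel_measurable_divide borel_measurable_sum borel_measurable_times noise_measurable) auto

text \<open>Each variable is measurable for one of the two independent sigma-algebras, and both are
  real-valued, as \<open>indep_var\<close> demands.\<close>

lemma sign_event_noise_indep:
  "indep_var borel (indicator (sign_event e) :: 'w \<Rightarrow> real) borel (\<lambda>\<omega>. signed_mean a e \<omega> ^ k)"
proof -
  let ?P = "Pi\<^sub>M {1..n} (\<lambda>_. borel) :: (nat \<Rightarrow> real) measure" and ?Q = "Pi\<^sub>M {1..n} (\<lambda>_. borel) :: (nat \<Rightarrow> real ^ 'd) measure"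
  let ?s = "\<lambda>\<omega>. \<lambda>j\<in>{1..n}. \<epsilon>' j \<omega>" and ?v = "\<lambda>\<omega>. \<lambda>j\<in>{1..n}. x j \<omega> - \<theta>"
  let ?A = "vimage_algebra (space M) ?s ?P" and ?B = "vimage_algebra (space M) ?v ?Q"
  have s: "?s \<in> measurable ?A ?P" by (rule measurable_vimage_algebra1) (auto simp: space_PiM)
  have v: "?v \<in> measurable ?B ?Q" by (rule measurable_vimage_algebra1) (auto simp: space_PiM)
  have X: "(indicator (sign_event e) :: 'w \<Rightarrow> real) \<in> borel_measurable ?A"
  proof -
    have "(\<lambda>u. if \<forall>j\<in>{1..n}. u j = e j then 1 else 0 :: real) \<in> borel_measurable ?P" by measurable
    from measurable_compose[OF s this]
    show ?thesis by (rule measurable_cong[THEN iffD1, rotated]) (auto simp: sign_event_def indicator_def)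
  qed
  have Y: "(\<lambda>\<omega>. signed_mean a e \<omega> ^ k) \<in> borel_measurable ?B"
  proof -
    have [measurable]: "(\<lambda>v::real ^ 'd. v $ a) \<in> borel_measurable borel"
      by (intro borel_measurable_continuous_onI continuous_intros)
    have "(\<lambda>u::nat \<Rightarrow> real ^ 'd. ((\<Sum>j\<in>{1..n}. e j * (u j $ a)) / real n) ^ k) \<in> borel_measurable ?Q" by measurable
    from measurable_compose[OF v this]
    show ?thesis by (rule measurable_cong[THEN iffD1, rotated]) (auto simp: signed_mean_def noise_def intro!: sum.cong)
  qed
  have sub: "sigma_sets (space M) {f -` B \<inter> space M | B. B \<in> sets borel} \<subseteq> sets N"
    if "f \<in> borel_measurable N" "space N = space M" for f :: "'w \<Rightarrow> real" and N
    unfolding that(2)[symmetric] using measurable_sets[OF that(1)] by (intro sets.sigma_sets_subset) auto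
  have "indep_set (sigma_sets (space M) {indicator (sign_event e) -` B \<inter> space M | B. B \<in> sets (borel :: real measure)})
     (sigma_sets (space M) {(\<lambda>\<omega>. signed_mean a e \<omega> ^ k) -` B \<inter> space M | B. B \<in> sets borel})"
    using signs_independent_noise sub[OF X] sub[OF Y] unfolding indep_set_def
    by (elim indep_sets_mono_sets) (auto split: bool.splits)
  then show ?thesis
    unfolding indep_var_eq using signed_mean_measurable[of a e] sign_event_measurable[of e] by auto
qed

text \<open>The product rule is used for nonnegative integrals since the moments for a fixed pattern
  are not yet known to be finite; their finiteness is deduced from this identity.\<close>

lemma nn_integral_sign_event:
  assumes e: "e \<in> sign_patterns"
  shows "(\<integral>\<^sup>+\<omega>. ennreal (signed_mean a e \<omega> ^ (2 * k)) * indicator (sign_event e) \<omega> \<partial>M)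
    = ennreal ((1 / 2) ^ n) * (\<integral>\<^sup>+\<omega>. ennreal (signed_mean a e \<omega> ^ (2 * k)) \<partial>M)"
proof -
  let ?X = "indicator (sign_event e) :: 'w \<Rightarrow> real" and ?Y = "\<lambda>\<omega>. signed_mean a e \<omega> ^ (2 * k)"
  have b: "(\<lambda>_. borel) = case_bool borel (borel :: real measure)"
    by (rule ext) (simp split: bool.split)
  have nn: "0 \<le> ?Y \<omega>" for \<omega> by (rule zero_le_even_power) simp
  have "(\<integral>\<^sup>+\<omega>. (\<Prod>i\<in>UNIV. ennreal (case_bool ?X ?Y i \<omega>)) \<partial>M) = (\<Prod>i\<in>UNIV. \<integral>\<^sup>+\<omega>. ennreal (case_bool ?X ?Y i \<omega>) \<partial>M)"
  proof (rule indep_vars_nn_integral)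
    have "indep_vars (\<lambda>_. borel) (case_bool ?X ?Y) UNIV"
      using sign_event_noise_indep[of e a "2 * k"] unfolding indep_var_def b[symmetric] .
    then show "indep_vars (\<lambda>_. borel) (\<lambda>i \<omega>. ennreal (case_bool ?X ?Y i \<omega>)) UNIV"
      by (rule indep_vars_compose2) auto
  qed auto
  then have "(\<integral>\<^sup>+\<omega>. ennreal (?X \<omega>) * ennreal (?Y \<omega>) \<partial>M) = (\<integral>\<^sup>+\<omega>. ennreal (?X \<omega>) \<partial>M) * (\<integral>\<^sup>+\<omega>. ennreal (?Y \<omega>) \<partial>M)"
    by (simp add: UNIV_bool mult.commute)
  moreover have "(\<integral>\<^sup>+\<omega>. ennreal (?X \<omega>) \<partial>M) = ennreal ((1 / 2) ^ n)"
    using sign_event_measurable[of e] prob_sign_event[OF e]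
    by (simp add: ennreal_indicator emeasure_eq_measure)
  ultimately show ?thesis by (simp add: ennreal_indicator mult.commute)
qed

text \<open>On \<open>sign_event e\<close> the symmetrized mean is \<open>signed_mean a e\<close>,
  so by independence the average of the fixed-pattern moments over all \<open>2 ^ n\<close> patterns
  is bounded by the given moment. Hence every one of them is finite, and at least one does not
  exceed the average.\<close>

lemma signed_mean_moment:
  assumes k: "k \<in> {1..s}"
  shows signed_mean_power_integrable: "e \<in> sign_patterns \<Longrightarrow> integrable M (\<lambda>\<omega>. signed_mean a e \<omega> ^ (2 * k))"
    and ex_signed_mean_moment: "\<exists>e\<in>sign_patterns. expectation (\<lambda>\<omega>. signed_mean a e \<omega> ^ (2 * k)) \<le> \<sigma> ^ (2 * k) * 2 ^ (k - 1) * fact k"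
proof -
  define B where "B = \<sigma> ^ (2 * k) * 2 ^ (k - 1) * fact k"
  let ?T = "\<lambda>\<omega>. \<bar>(\<Sum>j\<in>{1..n}. \<epsilon>' j \<omega> * (x j \<omega> $ a - \<theta> $ a)) / real n\<bar> ^ (2 * k)"
  let ?I = "\<lambda>e. \<integral>\<^sup>+\<omega>. ennreal (signed_mean a e \<omega> ^ (2 * k)) \<partial>M"
  have B0: "B \<ge> 0" using noise_level by (simp add: B_def)
  have T: "integrable M ?T" "expectation ?T \<le> B" using moments[OF k, of a] by (auto simp: B_def)
  have eqT: "?T \<omega> = signed_mean a e \<omega> ^ (2 * k)" if "\<omega> \<in> sign_event e" for \<omega> e
  proof -
    have "(\<Sum>j\<in>{1..n}. \<epsilon>' j \<omega> * (x j \<omega> $ a - \<theta> $ a)) = (\<Sum>j\<in>{1..n}. e j * noise a j \<omega>)"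
      using that by (intro sum.cong) (auto simp: sign_event_def noise_def)
    then show ?thesis unfolding signed_mean_def by (simp only:) (rule power_even_abs, simp)
  qed
  \<comment> \<open>The events of different patterns are disjoint, so at most one summand is
    nonzero; where some sign is neither 1 nor -1, the left side is 0.\<close>
  have disj: "(\<Sum>e\<in>sign_patterns. ennreal (signed_mean a e \<omega> ^ (2 * k)) * indicator (sign_event e) \<omega>) \<le> ennreal (?T \<omega>)"
    if \<omega>: "\<omega> \<in> space M" for \<omega>
  proof (cases "\<exists>e0\<in>sign_patterns. \<omega> \<in> sign_event e0")
    case True
    then obtain e0 where e0: "e0 \<in> sign_patterns" "\<omega> \<in> sign_event e0" by blast
    have uniq: "e = e0" if "e \<in> sign_patterns" "\<omega> \<in> sign_event e" for e
      using that e0 unfolding sign_patterns_def sign_event_def by (intro PiE_ext) auto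
    have "(\<Sum>e\<in>sign_patterns. ennreal (signed_mean a e \<omega> ^ (2 * k)) * indicator (sign_event e) \<omega>)
       = (\<Sum>e\<in>sign_patterns. if e = e0 then ennreal (signed_mean a e0 \<omega> ^ (2 * k)) else 0)"
    proof (rule sum.cong[OF refl])
      fix e assume "e \<in> sign_patterns"
      then have ev: "indicator (sign_event e) \<omega> = (if e = e0 then 1 else 0 :: ennreal)"
        using uniq[of e] e0(2) by (metis indicator_simps)
      show "ennreal (signed_mean a e \<omega> ^ (2 * k)) * indicator (sign_event e) \<omega>
          = (if e = e0 then ennreal (signed_mean a e0 \<omega> ^ (2 * k)) else 0)"
        unfolding ev by (cases "e = e0") (simp_all only: if_True if_False simp_thms mult_1_right mult_zero_right)
    qed
    also have "\<dots> = ennreal (?T \<omega>)"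
      unfolding eqT[OF e0(2)] using e0(1) sign_patterns(1) by (simp only: sum.delta if_True)
    finally show ?thesis by simp
  next
    case False
    then have "(\<Sum>e\<in>sign_patterns. ennreal (signed_mean a e \<omega> ^ (2 * k)) * indicator (sign_event e) \<omega>) = 0"
      by (intro sum.neutral) auto
    then show ?thesis by simp
  qed
  have meas: "(\<lambda>\<omega>. ennreal (signed_mean a e \<omega> ^ (2 * k)) * indicator (sign_event e) \<omega>) \<in> borel_measurable M" for e
    using signed_mean_measurable[of a e] sign_event_measurable[of e] by auto
  have "(\<Sum>e\<in>sign_patterns. ennreal ((1 / 2) ^ n) * ?I e)
      = (\<Sum>e\<in>sign_patterns. \<integral>\<^sup>+\<omega>. ennreal (signed_mean a e \<omega> ^ (2 * k)) * indicator (sign_event e) \<omega> \<partial>M)"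
    by (intro sum.cong refl nn_integral_sign_event[symmetric])
  also have "\<dots> = (\<integral>\<^sup>+\<omega>. (\<Sum>e\<in>sign_patterns. ennreal (signed_mean a e \<omega> ^ (2 * k)) * indicator (sign_event e) \<omega>) \<partial>M)"
    using meas by (intro nn_integral_sum[symmetric]) auto
  also have "\<dots> \<le> (\<integral>\<^sup>+\<omega>. ennreal (?T \<omega>) \<partial>M)" by (intro nn_integral_mono disj)
  also have "\<dots> = ennreal (expectation ?T)" by (rule nn_integral_eq_integral[OF T(1)]) auto
  also have "\<dots> \<le> ennreal B" using T(2) by (rule ennreal_leI)
  finally have total: "(\<Sum>e\<in>sign_patterns. ennreal ((1 / 2) ^ n) * ?I e) \<le> ennreal B" .
  have int: "integrable M (\<lambda>\<omega>. signed_mean a e \<omega> ^ (2 * k))" if e: "e \<in> sign_patterns" for e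
  proof (rule integrableI_bounded)
    have "ennreal ((1 / 2) ^ n) * ?I e \<le> (\<Sum>e\<in>sign_patterns. ennreal ((1 / 2) ^ n) * ?I e)"
      by (rule member_le_sum) (use e sign_patterns in auto)
    also note total
    finally have "ennreal ((1 / 2) ^ n) * ?I e < \<infinity>" by (simp add: le_less_trans)
    then have "?I e < \<infinity>" by (auto simp: ennreal_mult_less_top)
    then show "(\<integral>\<^sup>+\<omega>. ennreal (norm (signed_mean a e \<omega> ^ (2 * k))) \<partial>M) < \<infinity>"
      by (simp add: power_abs power_even_abs)
  qed (use signed_mean_measurable[of a e] in measurable)
  then show "e \<in> sign_patterns \<Longrightarrow> integrable M (\<lambda>\<omega>. signed_mean a e \<omega> ^ (2 * k))" .
  show "\<exists>e\<in>sign_patterns. expectation (\<lambda>\<omega>. signed_mean a e \<omega> ^ (2 * k)) \<le> \<sigma> ^ (2 * k) * 2 ^ (k - 1) * fact k"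
  proof (rule ccontr)
    assume "\<not> ?thesis"
    then have gt: "B < expectation (\<lambda>\<omega>. signed_mean a e \<omega> ^ (2 * k))" if "e \<in> sign_patterns" for e
      using that by (auto simp: B_def not_le)
    have I: "?I e = ennreal (expectation (\<lambda>\<omega>. signed_mean a e \<omega> ^ (2 * k)))" if "e \<in> sign_patterns" for e
      using int[OF that] by (intro nn_integral_eq_integral) (auto simp: zero_le_even_power)
    have E0: "expectation (\<lambda>\<omega>. signed_mean a e \<omega> ^ (2 * k)) \<ge> 0" for e
      by (intro Bochner_Integration.integral_nonneg) (auto simp: zero_le_even_power)
    have "(\<Sum>e\<in>sign_patterns. ennreal ((1 / 2) ^ n) * ?I e) = (\<Sum>e\<in>sign_patterns. ennreal ((1 / 2) ^ n * expectation (\<lambda>\<omega>. signed_mean a e \<omega> ^ (2 * k))))"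
      by (intro sum.cong) (auto simp: I ennreal_mult E0)
    also have "\<dots> = ennreal (\<Sum>e\<in>sign_patterns. (1 / 2) ^ n * expectation (\<lambda>\<omega>. signed_mean a e \<omega> ^ (2 * k)))"
      by (rule sum_ennreal) (auto simp: E0)
    finally have le: "(\<Sum>e\<in>sign_patterns. (1 / 2) ^ n * expectation (\<lambda>\<omega>. signed_mean a e \<omega> ^ (2 * k))) \<le> B"
      using total B0 by (simp add: ennreal_le_iff)
    have "B = (\<Sum>e\<in>sign_patterns. (1 / 2) ^ n * B)"
      by (simp add: sign_patterns power_divide)
    also have "\<dots> < (\<Sum>e\<in>sign_patterns. (1 / 2) ^ n * expectation (\<lambda>\<omega>. signed_mean a e \<omega> ^ (2 * k)))"
    proof (rule sum_strict_mono[OF sign_patterns(1)])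
      show "sign_patterns \<noteq> {}" using sign_patterns(2) by auto
    qed (use gt in auto)
    finally show False using le by simp
  qed
qed

text \<open>Two signed sums that differ in the sign at \<open>j\<close> alone have the difference
  \<open>2 * noise a j\<close>, so single noise variables inherit integrability from the signed
  means.\<close>

lemma noise_power_integrable:
  assumes k: "k \<in> {1..s}" and j: "j \<in> {1..n}"
  shows "integrable M (\<lambda>\<omega>. noise a j \<omega> ^ (2 * k))"
proof -
  define e where "e = (\<lambda>i\<in>{1..n}. 1 :: real)"
  define e' where "e' = e(j := -1)"
  have e: "e \<in> sign_patterns" "e' \<in> sign_patterns"
    using j by (auto simp: e_def e'_def sign_patterns_def PiE_iff extensional_def)
  have eq: "noise a j \<omega> = real n / 2 * (signed_mean a e \<omega> + - signed_mean a e' \<omega>)" for \<omega>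
  proof -
    have n: "real n \<noteq> 0" using j by auto
    have "signed_mean a e \<omega> - signed_mean a e' \<omega> = (\<Sum>i\<in>{1..n}. (e i - e' i) * noise a i \<omega>) / real n"
      by (simp add: signed_mean_def diff_divide_distrib[symmetric] sum_subtractf[symmetric] left_diff_distrib)
    also have "(\<Sum>i\<in>{1..n}. (e i - e' i) * noise a i \<omega>) = (\<Sum>i\<in>{1..n}. if i = j then 2 * noise a j \<omega> else 0)"
      by (intro sum.cong) (auto simp: e'_def e_def)
    also have "\<dots> = 2 * noise a j \<omega>" using j by simp
    finally show ?thesis using n by simp
  qed
  have "integrable M (\<lambda>\<omega>. (signed_mean a e \<omega> + - signed_mean a e' \<omega>) ^ (2 * k))"
    using signed_mean_power_integrable[OF k e(1)] signed_mean_power_integrable[OF k e(2)]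
      signed_mean_measurable by (intro integrable_even_power_add) auto
  then show ?thesis unfolding eq power_mult_distrib by simp
qed

lemma signed_mean_moment_le:
  assumes k: "k \<in> {1..s}" and w: "\<And>j. j \<in> {1..n} \<Longrightarrow> w j \<in> {-1, 1}"
  shows "integrable M (\<lambda>\<omega>. signed_mean a w \<omega> ^ (2 * k))"
    and "expectation (\<lambda>\<omega>. signed_mean a w \<omega> ^ (2 * k)) \<le> 2 ^ (2 * k + 1) * (\<sigma> ^ (2 * k) * 2 ^ (k - 1) * fact k)"
proof -
  have k0: "k > 0" using k by simp
  show "integrable M (\<lambda>\<omega>. signed_mean a w \<omega> ^ (2 * k))"
    unfolding signed_mean_def power_divide
    using noise_power_integrable[OF k] noise_measurable
    by (intro integrable_divide integrable_even_power_sum k0) auto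
  obtain e where e: "e \<in> sign_patterns" "expectation (\<lambda>\<omega>. signed_mean a e \<omega> ^ (2 * k)) \<le> \<sigma> ^ (2 * k) * 2 ^ (k - 1) * fact k"
    using ex_signed_mean_moment[OF k, of a] by blast
  have ee: "e j \<in> {-1, 1}" if "j \<in> {1..n}" for j
    using e(1) that PiE_mem[of e "{1..n}" "\<lambda>_. {-1, 1}" j] by (simp add: sign_patterns_def)
  have "expectation (\<lambda>\<omega>. (\<Sum>j\<in>{1..n}. w j * noise a j \<omega>) ^ (2 * k))
      \<le> 2 ^ (2 * k + 1) * expectation (\<lambda>\<omega>. (\<Sum>j\<in>{1..n}. e j * noise a j \<omega>) ^ (2 * k))"
    by (rule even_moment_sign_change_le[OF _ noise_indep k0 noise_power_integrable[OF k] _ w ee]) (auto simp: noise_mean)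
  then have "expectation (\<lambda>\<omega>. signed_mean a w \<omega> ^ (2 * k)) \<le> 2 ^ (2 * k + 1) * expectation (\<lambda>\<omega>. signed_mean a e \<omega> ^ (2 * k))"
    unfolding signed_mean_def power_divide by (simp add: divide_right_mono)
  also have "\<dots> \<le> 2 ^ (2 * k + 1) * (\<sigma> ^ (2 * k) * 2 ^ (k - 1) * fact k)"
    by (intro mult_left_mono e) auto
  finally show "expectation (\<lambda>\<omega>. signed_mean a w \<omega> ^ (2 * k)) \<le> \<dots>" .
qed

end

text \<open>\<open>P\<close> consists of pairs of a colouring and a sign vector, so every summand is
  a power of a signed mean. The square enters the average by Jensen, \<open>exp (2 * real k)\<close>
  bounds the square of \<open>k^k / k!\<close>, and the leading 2 is the price of replacing the
  falling factorial by \<open>n ^ k\<close>.\<close>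

lemma ustat_square_le:
  fixes y :: "nat \<Rightarrow> real"
  assumes k: "0 < k" "k \<le> n" and nk: "(real n ^ k)\<^sup>2 \<le> 2 * (fact k * real (n choose k))\<^sup>2"
  defines "P \<equiv> ({1..n} \<rightarrow>\<^sub>E {1..k}) \<times> ({1..k} \<rightarrow>\<^sub>E {-1, 1::real})"
  shows "(ustat n k y)\<^sup>2 \<le> 2 * exp (2 * real k) *
    ((\<Sum>p\<in>P. ((\<Sum>j\<in>{1..n}. snd p (fst p j) * y j) / real n) ^ (2 * k)) / real (card P))"
proof -
  let ?t = "\<lambda>p. (\<Sum>j\<in>{1..n}. snd p (fst p j) * y j) / real n"
  let ?N = "real (card P)" and ?b = "fact k * real (n choose k)"
  have fP: "finite P" by (simp add: P_def finite_PiE)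
  have N: "?N = real k ^ n * 2 ^ k"
    by (simp add: P_def card_cartesian_product card_PiE numeral_2_eq_2)
  then have Npos: "?N > 0" using k by simp
  have n: "real n > 0" using k by simp
  have b: "?b > 0" using k by simp
  define v where "v = (\<Sum>p\<in>P. 1 / ?N * \<bar>?t p\<bar> ^ k)"
  have v0: "v \<ge> 0" unfolding v_def by (intro sum_nonneg) auto
  have "\<bar>fact k * esym {1..n} k y\<bar> \<le> real k ^ k / fact k *
    ((\<Sum>c\<in>{1..n} \<rightarrow>\<^sub>E {1..k}. \<Sum>\<eta>\<in>{1..k} \<rightarrow>\<^sub>E {-1, 1}. \<bar>\<Sum>j\<in>{1..n}. \<eta> (c j) * y j\<bar> ^ k) / (real k ^ card {1..n} * 2 ^ k))"
    by (rule abs_esym_le_average) (use k in auto)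
  also have "(\<Sum>c\<in>{1..n} \<rightarrow>\<^sub>E {1..k}. \<Sum>\<eta>\<in>{1..k} \<rightarrow>\<^sub>E {-1, 1}. \<bar>\<Sum>j\<in>{1..n}. \<eta> (c j) * y j\<bar> ^ k)
      = (\<Sum>p\<in>P. \<bar>\<Sum>j\<in>{1..n}. snd p (fst p j) * y j\<bar> ^ k)"
    unfolding P_def sum.cartesian_product by (simp add: case_prod_beta)
  also have "\<dots> = (\<Sum>p\<in>P. real n ^ k * \<bar>?t p\<bar> ^ k)"
    using n by (intro sum.cong refl) (simp add: power_divide)
  also have "\<dots> / (real k ^ card {1..n} * 2 ^ k) = real n ^ k * v"
    unfolding v_def by (simp add: N sum_distrib_left sum_divide_distrib)
  also have "real k ^ k / fact k * (real n ^ k * v) \<le> exp (real k) * (real n ^ k * v)"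
    using power_le_fact_mult_exp[of k] v0 by (intro mult_right_mono) (auto simp: field_simps)
  finally have le: "\<bar>fact k * esym {1..n} k y\<bar> \<le> exp (real k) * (real n ^ k * v)" .
  have "ustat n k y = fact k * esym {1..n} k y / ?b" by (simp add: ustat_def)
  then have "(ustat n k y)\<^sup>2 = \<bar>fact k * esym {1..n} k y\<bar>\<^sup>2 / ?b\<^sup>2"
    by (simp only: power_divide power2_abs)
  also have "\<dots> \<le> (exp (real k) * (real n ^ k * v))\<^sup>2 / ?b\<^sup>2"
    by (intro divide_right_mono power_mono le) auto
  also have "\<dots> = exp (2 * real k) * v\<^sup>2 * ((real n ^ k)\<^sup>2 / ?b\<^sup>2)"
    unfolding exp_double by (simp add: power_mult_distrib mult_ac)
  also have "\<dots> \<le> exp (2 * real k) * v\<^sup>2 * 2"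
  proof (rule mult_left_mono)
    have "?b\<^sup>2 > 0" using b by (rule zero_less_power)
    then show "(real n ^ k)\<^sup>2 / ?b\<^sup>2 \<le> 2" using nk by (simp only: pos_divide_le_eq)
  qed simp
  also have "v\<^sup>2 \<le> (\<Sum>p\<in>P. 1 / ?N) * (\<Sum>p\<in>P. 1 / ?N * (\<bar>?t p\<bar> ^ k)\<^sup>2)"
    unfolding v_def by (rule weighted_sum_square_le) auto
  also have "(\<Sum>p\<in>P. 1 / ?N) = 1" using Npos by simp
  also have "(\<Sum>p\<in>P. 1 / ?N * (\<bar>?t p\<bar> ^ k)\<^sup>2) = (\<Sum>p\<in>P. ?t p ^ (2 * k)) / ?N"
  proof -
    have "(\<bar>z\<bar> ^ k)\<^sup>2 = z ^ (2 * k)" for z :: real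
      by (simp only: power_mult[symmetric] mult.commute[of k] power_even_abs even_mult_iff even_numeral simp_thms)
    then show ?thesis by (simp add: sum_divide_distrib)
  qed
  finally show ?thesis by (simp add: mult_ac)
qed

section \<open>Second moments of the fluctuation and of the remainder\<close>

context noisy_observations
begin

text \<open>Regrouped by the index \<open>j\<close>, each factor involves at most two noise
  variables of the same observation. Second moments and the hypothesis on pairs of coordinates
  therefore control products of any length.\<close>

lemma noise_products:
  assumes s: "s \<ge> 1" and A: "A \<subseteq> {1..n}" and B: "B \<subseteq> {1..n}"
  shows integrable_noise_products: "integrable M (\<lambda>\<omega>. (\<Prod>j\<in>A. noise a j \<omega>) * (\<Prod>j\<in>B. noise b j \<omega>))"
    and expectation_noise_products: "expectation (\<lambda>\<omega>. (\<Prod>j\<in>A. noise a j \<omega>) * (\<Prod>j\<in>B. noise b j \<omega>))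
      = (\<Prod>j\<in>{1..n}. expectation (\<lambda>\<omega>. (if j \<in> A then noise a j \<omega> else 1) * (if j \<in> B then noise b j \<omega> else 1)))"
proof -
  let ?F = "\<lambda>j v. (if j \<in> A then v $ a - \<theta> $ a else 1) * (if j \<in> B then v $ b - \<theta> $ b else 1)"
  let ?X = "\<lambda>j \<omega>. (if j \<in> A then noise a j \<omega> else 1) * (if j \<in> B then noise b j \<omega> else 1)"
  have [measurable]: "(\<lambda>v::real ^ 'd. v $ c) \<in> borel_measurable borel" for c
    by (intro borel_measurable_continuous_onI continuous_intros)
  have indep: "indep_vars (\<lambda>_. borel) ?X {1..n}"
    unfolding noise_def by (rule indep_vars_compose2[OF independent, of ?F]) measurable
  have int: "integrable M (?X j)" if j: "j \<in> {1..n}" for j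
  proof -
    have "integrable M (\<lambda>\<omega>. noise a j \<omega> * noise b j \<omega>)"
    proof (cases "a = b")
      case True
      then show ?thesis using noise_power_integrable[of 1 j a] j s by (simp add: power2_eq_square)
    next
      case False
      then show ?thesis using uncorrelated[OF j False] by (simp add: noise_def)
    qed
    then show ?thesis using noise_mean[OF j] by (cases "j \<in> A"; cases "j \<in> B") auto
  qed
  have eq: "(\<Prod>j\<in>A. noise a j \<omega>) * (\<Prod>j\<in>B. noise b j \<omega>) = (\<Prod>j\<in>{1..n}. ?X j \<omega>)" for \<omega>
  proof -
    have "(\<Prod>j\<in>A. noise a j \<omega>) = (\<Prod>j\<in>{1..n}. if j \<in> A then noise a j \<omega> else 1)"
      "(\<Prod>j\<in>B. noise b j \<omega>) = (\<Prod>j\<in>{1..n}. if j \<in> B then noise b j \<omega> else 1)"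
      using A B by (simp_all add: prod.inter_restrict[symmetric] Int_absorb1)
    then show ?thesis by (simp only: prod.distrib)
  qed
  show "integrable M (\<lambda>\<omega>. (\<Prod>j\<in>A. noise a j \<omega>) * (\<Prod>j\<in>B. noise b j \<omega>))"
    unfolding eq by (rule indep_vars_integrable[OF _ indep int]) auto
  show "expectation (\<lambda>\<omega>. (\<Prod>j\<in>A. noise a j \<omega>) * (\<Prod>j\<in>B. noise b j \<omega>)) = (\<Prod>j\<in>{1..n}. expectation (?X j))"
    unfolding eq by (rule indep_vars_lebesgue_integral[OF _ indep int]) auto
qed

text \<open>An index in exactly one of the two sets contributes a mean, which is 0. If the sets are
  equal, the coordinates differ, and any common index contributes a vanishing covariance. So
  monomials of different orders, index sets or coordinates are all mutually orthogonal.\<close>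

lemma noise_products_orthogonal:
  assumes s: "s \<ge> 1" and A: "A \<subseteq> {1..n}" and B: "B \<subseteq> {1..n}" and ne: "A \<noteq> {}" "(a, A) \<noteq> (b, B)"
  shows "expectation (\<lambda>\<omega>. (\<Prod>j\<in>A. noise a j \<omega>) * (\<Prod>j\<in>B. noise b j \<omega>)) = 0"
proof -
  have "\<exists>j\<in>{1..n}. expectation (\<lambda>\<omega>. (if j \<in> A then noise a j \<omega> else 1) * (if j \<in> B then noise b j \<omega> else 1)) = 0"
  proof (cases "A = B")
    case True
    obtain j where j: "j \<in> A" using ne by auto
    then have "j \<in> {1..n}" using A by auto
    moreover have "a \<noteq> b" using True ne by auto
    ultimately show ?thesis
      using uncorrelated[of j a b] j True by (intro bexI[of _ j]) (auto simp: noise_def)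
  next
    case False
    then obtain j where j: "(j \<in> A \<and> j \<notin> B) \<or> (j \<notin> A \<and> j \<in> B)" by blast
    then have "j \<in> {1..n}" using A B by auto
    then show ?thesis using j noise_mean(2)[of j] by (intro bexI[of _ j]) auto
  qed
  then show ?thesis unfolding expectation_noise_products[OF s A B] by (intro prod_zero) auto
qed

lemma noise_product_variance:
  assumes s: "s \<ge> 1" and A: "A \<subseteq> {1..n}"
  shows "expectation (\<lambda>\<omega>. (\<Prod>j\<in>A. noise a j \<omega>)\<^sup>2) = (\<Prod>j\<in>A. expectation (\<lambda>\<omega>. (noise a j \<omega>)\<^sup>2))"
proof -
  have "expectation (\<lambda>\<omega>. (\<Prod>j\<in>A. noise a j \<omega>)\<^sup>2)
      = (\<Prod>j\<in>{1..n}. expectation (\<lambda>\<omega>. (if j \<in> A then noise a j \<omega> else 1) * (if j \<in> A then noise a j \<omega> else 1)))"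
    unfolding power2_eq_square by (rule expectation_noise_products[OF s A A])
  also have "\<dots> = (\<Prod>j\<in>{1..n}. if j \<in> A then expectation (\<lambda>\<omega>. (noise a j \<omega>)\<^sup>2) else 1)"
    by (intro prod.cong refl) (auto simp: prob_space power2_eq_square)
  also have "\<dots> = (\<Prod>j\<in>A. expectation (\<lambda>\<omega>. (noise a j \<omega>)\<^sup>2))"
    using A by (simp add: prod.inter_restrict[symmetric] Int_absorb1)
  finally show ?thesis .
qed

text \<open>Signs square to 1, so the variance of a signed sum is the same for every pattern. The
  one favourable pattern suffices, without the loss incurred in
  \<open>signed_mean_moment_le\<close>.\<close>

lemma sum_noise_variance_le:
  assumes s: "s \<ge> 1" and n: "n \<ge> 1"
  shows "(\<Sum>j\<in>{1..n}. expectation (\<lambda>\<omega>. (noise a j \<omega>)\<^sup>2)) \<le> (real n * \<sigma>)\<^sup>2"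
proof -
  obtain e where e: "e \<in> sign_patterns" "expectation (\<lambda>\<omega>. signed_mean a e \<omega> ^ (2 * 1)) \<le> \<sigma> ^ (2 * 1) * 2 ^ (1 - 1) * fact 1"
    using ex_signed_mean_moment[of 1 a] s by auto
  have e2: "(norm (e j))\<^sup>2 = 1" if "j \<in> {1..n}" for j
    using e(1) that PiE_mem[of e "{1..n}" "\<lambda>_. {-1, 1}" j] by (auto simp: sign_patterns_def)
  have single: "noise a i \<omega> * noise a j \<omega> = (\<Prod>j\<in>{i}. noise a j \<omega>) * (\<Prod>j\<in>{j}. noise a j \<omega>)" for i j \<omega>
    by simp
  have "expectation (\<lambda>\<omega>. (norm (\<Sum>j\<in>{1..n}. noise a j \<omega> *\<^sub>R e j))\<^sup>2) = (\<Sum>j\<in>{1..n}. (norm (e j))\<^sup>2 * expectation (\<lambda>\<omega>. (noise a j \<omega>)\<^sup>2))"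
  proof (rule expectation_norm_square_orthogonal_sum(2))
    show "integrable M (\<lambda>\<omega>. noise a i \<omega> * noise a j \<omega>)" if "i \<in> {1..n}" "j \<in> {1..n}" for i j
      unfolding single by (rule integrable_noise_products[OF s]) (use that in auto)
    show "expectation (\<lambda>\<omega>. noise a i \<omega> * noise a j \<omega>) = 0" if "i \<in> {1..n}" "j \<in> {1..n}" "i \<noteq> j" for i j
      unfolding single by (rule noise_products_orthogonal[OF s]) (use that in auto)
  qed simp
  also have "\<dots> = (\<Sum>j\<in>{1..n}. expectation (\<lambda>\<omega>. (noise a j \<omega>)\<^sup>2))"
    by (intro sum.cong refl) (simp only: e2 mult_1_left)
  finally have eq: "(\<Sum>j\<in>{1..n}. expectation (\<lambda>\<omega>. (noise a j \<omega>)\<^sup>2)) = expectation (\<lambda>\<omega>. (norm (\<Sum>j\<in>{1..n}. noise a j \<omega> *\<^sub>R e j))\<^sup>2)" ..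
  also have "\<dots> = expectation (\<lambda>\<omega>. (real n)\<^sup>2 * (signed_mean a e \<omega>)\<^sup>2)"
    using n by (intro Bochner_Integration.integral_cong refl) (simp add: signed_mean_def power_divide mult.commute)
  also have "\<dots> = (real n)\<^sup>2 * expectation (\<lambda>\<omega>. (signed_mean a e \<omega>)\<^sup>2)" by simp
  also have "\<dots> \<le> (real n)\<^sup>2 * \<sigma>\<^sup>2" using e(2) by (intro mult_left_mono) auto
  finally show ?thesis by (simp add: power_mult_distrib)
qed

text \<open>Expand \<open>Z\<close> into monomials indexed by a coordinate and a nonempty set of
  observations; they are orthogonal, so squares add up. The variance of one U-statistic is the
  symmetric polynomial of the noise variances over a squared binomial coefficient, and
  \<open>esym_le_power_sum\<close> reduces it to the total variance.\<close>

lemma ustat_noise_second_moment: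
  fixes g :: "'d \<Rightarrow> nat \<Rightarrow> complex"
  assumes s: "s \<ge> 1" and n: "n \<ge> 1" and m: "m \<le> n"
    and nk: "\<And>k. k \<le> m \<Longrightarrow> (real n ^ k)\<^sup>2 \<le> 2 * (fact k * real (n choose k))\<^sup>2"
  defines "Z \<equiv> \<lambda>\<omega>. \<Sum>a\<in>UNIV. \<Sum>k\<in>{1..m}. g a k * complex_of_real (ustat n k (\<lambda>j. noise a j \<omega>))"
  shows "integrable M (\<lambda>\<omega>. (norm (Z \<omega>))\<^sup>2)"
    and "expectation (\<lambda>\<omega>. (norm (Z \<omega>))\<^sup>2) \<le> (\<Sum>a\<in>UNIV. \<Sum>k\<in>{1..m}. (norm (g a k))\<^sup>2 * (2 * fact k * \<sigma> ^ (2 * k)))"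
proof -
  define S where "S = {A. A \<subseteq> {1..n} \<and> card A \<in> {1..m}}"
  define I where "I = (UNIV :: 'd set) \<times> S"
  define X where "X = (\<lambda>p \<omega>. \<Prod>j\<in>snd p. noise (fst p) j \<omega>)"
  define G where "G = (\<lambda>p :: 'd \<times> nat set. g (fst p) (card (snd p)) / complex_of_real (real (n choose card (snd p))))"
  let ?v = "\<lambda>a j. expectation (\<lambda>\<omega>. (noise a j \<omega>)\<^sup>2)"
  have fS: "finite S" by (rule finite_subset[of _ "Pow {1..n}"]) (auto simp: S_def)
  then have fI: "finite I" by (simp add: I_def)
  have group: "(\<Sum>p\<in>I. f p) = (\<Sum>a\<in>UNIV. \<Sum>k\<in>{1..m}. \<Sum>A | A \<subseteq> {1..n} \<and> card A = k. f (a, A))" for f :: "'d \<times> nat set \<Rightarrow> 'b::comm_monoid_add"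
  proof -
    have "(\<Sum>p\<in>I. f p) = (\<Sum>a\<in>UNIV. \<Sum>A\<in>S. f (a, A))" by (simp add: I_def sum.cartesian_product)
    also have "\<dots> = (\<Sum>a\<in>UNIV. \<Sum>k\<in>{1..m}. \<Sum>A | A \<in> S \<and> card A = k. f (a, A))"
      by (intro sum.cong refl sum.group[symmetric] fS) (auto simp: S_def)
    also have "\<dots> = (\<Sum>a\<in>UNIV. \<Sum>k\<in>{1..m}. \<Sum>A | A \<subseteq> {1..n} \<and> card A = k. f (a, A))"
      by (intro sum.cong refl) (auto simp: S_def)
    finally show ?thesis .
  qed
  have Z: "Z \<omega> = (\<Sum>p\<in>I. X p \<omega> *\<^sub>R G p)" for \<omega>
    unfolding group Z_def
    by (intro sum.cong refl) (simp add: ustat_def esym_def X_def G_def scaleR_conv_of_real sum_distrib_left sum_divide_distrib mult.commute)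
  have int: "integrable M (\<lambda>\<omega>. X p \<omega> * X q \<omega>)" if "p \<in> I" "q \<in> I" for p q
    unfolding X_def by (rule integrable_noise_products[OF s]) (use that in \<open>auto simp: I_def S_def\<close>)
  have orth: "expectation (\<lambda>\<omega>. X p \<omega> * X q \<omega>) = 0" if pq: "p \<in> I" "q \<in> I" "p \<noteq> q" for p q
    unfolding X_def
  proof (rule noise_products_orthogonal[OF s])
    show "snd p \<noteq> {}" using pq by (auto simp: I_def S_def)
    show "(fst p, snd p) \<noteq> (fst q, snd q)" using pq by (simp add: prod_eq_iff)
  qed (use pq in \<open>auto simp: I_def S_def\<close>)
  note os = expectation_norm_square_orthogonal_sum[OF fI int orth, where G = G]
  show "integrable M (\<lambda>\<omega>. (norm (Z \<omega>))\<^sup>2)" unfolding Z by (rule os(1))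
  have "expectation (\<lambda>\<omega>. (norm (Z \<omega>))\<^sup>2) = (\<Sum>p\<in>I. (norm (G p))\<^sup>2 * expectation (\<lambda>\<omega>. (X p \<omega>)\<^sup>2))"
    unfolding Z by (rule os(2))
  also have "\<dots> = (\<Sum>a\<in>UNIV. \<Sum>k\<in>{1..m}. (norm (g a k))\<^sup>2 * (esym {1..n} k (?v a) / (real (n choose k))\<^sup>2))"
    unfolding group
  proof (intro sum.cong refl)
    fix a k
    have "(\<Sum>A | A \<subseteq> {1..n} \<and> card A = k. (norm (G (a, A)))\<^sup>2 * expectation (\<lambda>\<omega>. (X (a, A) \<omega>)\<^sup>2))
        = (\<Sum>A | A \<subseteq> {1..n} \<and> card A = k. (norm (g a k))\<^sup>2 / (real (n choose k))\<^sup>2 * (\<Prod>j\<in>A. ?v a j))"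
      by (intro sum.cong refl) (auto simp: G_def X_def noise_product_variance[OF s] norm_divide power_divide)
    then show "(\<Sum>A | A \<subseteq> {1..n} \<and> card A = k. (norm (G (a, A)))\<^sup>2 * expectation (\<lambda>\<omega>. (X (a, A) \<omega>)\<^sup>2))
        = (norm (g a k))\<^sup>2 * (esym {1..n} k (?v a) / (real (n choose k))\<^sup>2)"
      by (simp add: esym_def sum_distrib_left sum_divide_distrib)
  qed
  also have "\<dots> \<le> (\<Sum>a\<in>UNIV. \<Sum>k\<in>{1..m}. (norm (g a k))\<^sup>2 * (2 * fact k * \<sigma> ^ (2 * k)))"
  proof (intro sum_mono mult_left_mono)
    fix a k assume k: "k \<in> {1..m}"
    let ?c = "real (n choose k)"
    have c: "?c > 0" using k m by simp
    have v0: "?v a j \<ge> 0" for j by (intro Bochner_Integration.integral_nonneg) auto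
    have "fact k * esym {1..n} k (?v a) \<le> (\<Sum>j\<in>{1..n}. ?v a j) ^ k"
      by (rule esym_le_power_sum) (auto simp: v0)
    also have "\<dots> \<le> ((real n * \<sigma>)\<^sup>2) ^ k"
      by (intro power_mono sum_noise_variance_le s n sum_nonneg v0)
    also have "\<dots> = (real n ^ k)\<^sup>2 * \<sigma> ^ (2 * k)"
      by (simp add: power_mult_distrib power_mult[symmetric] mult.commute)
    also have "\<dots> \<le> 2 * (fact k * ?c)\<^sup>2 * \<sigma> ^ (2 * k)"
      using nk[of k] k noise_level by (intro mult_right_mono) auto
    also have "\<dots> = fact k * (2 * fact k * \<sigma> ^ (2 * k) * ?c\<^sup>2)" by (simp add: power2_eq_square mult_ac)
    finally have "esym {1..n} k (?v a) \<le> 2 * fact k * \<sigma> ^ (2 * k) * ?c\<^sup>2"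
      by (rule mult_left_le_imp_le) simp
    then show "esym {1..n} k (?v a) / ?c\<^sup>2 \<le> 2 * fact k * \<sigma> ^ (2 * k)"
      using c by (simp add: pos_divide_le_eq)
  qed auto
  finally show "expectation (\<lambda>\<omega>. (norm (Z \<omega>))\<^sup>2) \<le> \<dots>" .
qed

lemma ustat_noise_measurable: "(\<lambda>\<omega>. ustat n k (\<lambda>j. noise a j \<omega>)) \<in> borel_measurable M"
  unfolding ustat_def esym_def
  by (intro borel_measurable_divide borel_measurable_sum borel_measurable_prod noise_measurable) auto

text \<open>\<open>D a\<close> is the bound of \<open>plugin_ustat_remainder\<close> for a
  displacement from the true coordinate to the sample mean. All its terms have degree
  \<open>s\<close> in the noise, so moments of order \<open>2 * s\<close> are enough. The weights
  \<open>(m choose k) * e^k\<close> are chosen to absorb the growth \<open>e^(2k)\<close> of the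
  squared U-statistics; their sum \<open>(1 + e)^m\<close> then occurs twice. The factor 4 is the 2
  of \<open>ustat_square_le\<close> times the two moments from
  \<open>power_mult_power_le\<close>.\<close>

lemma remainder_second_moment:
  assumes n: "n \<ge> 1" and s: "s \<ge> 1" "s \<le> n" and m: "m = s - 1"
    and nk: "\<And>k. k \<le> m \<Longrightarrow> (real n ^ k)\<^sup>2 \<le> 2 * (fact k * real (n choose k))\<^sup>2"
  defines "A \<equiv> \<lambda>a \<omega>. \<bar>signed_mean a (\<lambda>_. 1) \<omega>\<bar>"
  defines "D \<equiv> \<lambda>a \<omega>. A a \<omega> * (\<Sum>k\<le>m. real (m choose k) * A a \<omega> ^ (m - k) * \<bar>ustat n k (\<lambda>j. noise a j \<omega>)\<bar>)"
  shows "integrable M (\<lambda>\<omega>. (D a \<omega>)\<^sup>2)"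
    and "expectation (\<lambda>\<omega>. (D a \<omega>)\<^sup>2) \<le> (1 + exp 1) ^ (2 * m) * (4 * (\<sigma> ^ (2 * s) * 8 ^ s * fact s))"
proof -
  define H where "H = \<sigma> ^ (2 * s) * 8 ^ s * (fact s :: real)"
  have H0: "H \<ge> 0" using noise_level by (simp add: H_def)
  have sm: "integrable M (\<lambda>\<omega>. signed_mean a w \<omega> ^ (2 * s)) \<and> expectation (\<lambda>\<omega>. signed_mean a w \<omega> ^ (2 * s)) \<le> H"
    if "\<And>j. j \<in> {1..n} \<Longrightarrow> w j \<in> {-1, 1}" for w
  proof -
    have "2 * s + 1 + (s - 1) = 3 * s" using s by simp
    then have "(2::real) ^ (2 * s + 1) * 2 ^ (s - 1) = 2 ^ (3 * s)" by (simp only: power_add[symmetric])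
    also have "\<dots> = 8 ^ s" by (simp add: power_mult)
    finally have "2 ^ (2 * s + 1) * (\<sigma> ^ (2 * s) * 2 ^ (s - 1) * fact s) = H"
      by (simp add: H_def mult_ac)
    then show ?thesis using signed_mean_moment_le[of s w a] that s by simp
  qed
  let ?u = "\<lambda>k \<omega>. ustat n k (\<lambda>j. noise a j \<omega>)" and ?A = "signed_mean a (\<lambda>_. 1)"
  note [measurable] = ustat_noise_measurable[of _ a] signed_mean_measurable[of a]
  have one: "integrable M (\<lambda>\<omega>. ?A \<omega> ^ (2 * (s - k)) * (?u k \<omega>)\<^sup>2)
      \<and> expectation (\<lambda>\<omega>. ?A \<omega> ^ (2 * (s - k)) * (?u k \<omega>)\<^sup>2) \<le> exp (2 * real k) * (4 * H)" if k: "k \<le> m" for k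
  proof (cases "k = 0")
    case True
    then show ?thesis using sm[of "\<lambda>_. 1"] H0 by auto
  next
    case False
    define P where "P = ({1..n} \<rightarrow>\<^sub>E {1..k}) \<times> ({1..k} \<rightarrow>\<^sub>E {-1, 1::real})"
    let ?w = "\<lambda>p j. snd p (fst p j)"
    have w: "?w p j \<in> {-1, 1}" if p: "p \<in> P" "j \<in> {1..n}" for p and j :: nat
    proof -
      have "fst p j \<in> {1..k}" using p PiE_mem[of "fst p" "{1..n}" "\<lambda>_. {1..k}" j] by (auto simp: P_def)
      then show ?thesis using p PiE_mem[of "snd p" "{1..k}" "\<lambda>_. {-1, 1}" "fst p j"] by (auto simp: P_def)
    qed
    have fP: "finite P" by (simp add: P_def finite_PiE)
    have cP: "real (card P) > 0"
      using False by (simp add: P_def card_cartesian_product card_PiE)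
    let ?b = "\<lambda>\<omega>. 2 * exp (2 * real k) * ((\<Sum>p\<in>P. ?A \<omega> ^ (2 * s) + signed_mean a (?w p) \<omega> ^ (2 * s)) / real (card P))"
    have "integrable M (\<lambda>\<omega>. (\<Sum>p\<in>P. ?A \<omega> ^ (2 * s) + signed_mean a (?w p) \<omega> ^ (2 * s)))"
      using sm w by (intro Bochner_Integration.integrable_sum Bochner_Integration.integrable_add) auto
    then have bint: "integrable M ?b" by simp
    have bexp: "expectation ?b \<le> exp (2 * real k) * (4 * H)"
    proof -
      have "expectation (\<lambda>\<omega>. (\<Sum>p\<in>P. ?A \<omega> ^ (2 * s) + signed_mean a (?w p) \<omega> ^ (2 * s)))
         = (\<Sum>p\<in>P. expectation (\<lambda>\<omega>. ?A \<omega> ^ (2 * s)) + expectation (\<lambda>\<omega>. signed_mean a (?w p) \<omega> ^ (2 * s)))"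
        using sm[of "\<lambda>_. 1"] sm w by (subst Bochner_Integration.integral_sum) auto
      also have "\<dots> \<le> (\<Sum>p\<in>P. H + H)" using sm[of "\<lambda>_. 1"] sm w by (intro sum_mono add_mono) auto
      also have "\<dots> = real (card P) * (2 * H)" by simp
      finally have "expectation (\<lambda>\<omega>. (\<Sum>p\<in>P. ?A \<omega> ^ (2 * s) + signed_mean a (?w p) \<omega> ^ (2 * s))) / real (card P) \<le> 2 * H"
        using cP by (simp add: pos_divide_le_eq mult.commute)
      then have "2 * exp (2 * real k) * (expectation (\<lambda>\<omega>. (\<Sum>p\<in>P. ?A \<omega> ^ (2 * s) + signed_mean a (?w p) \<omega> ^ (2 * s))) / real (card P)) \<le> 2 * exp (2 * real k) * (2 * H)"
        by (intro mult_left_mono) auto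
      then show ?thesis by simp
    qed
    have pw: "?A \<omega> ^ (2 * (s - k)) * (?u k \<omega>)\<^sup>2 \<le> ?b \<omega>" for \<omega>
    proof -
      have "(?u k \<omega>)\<^sup>2 \<le> 2 * exp (2 * real k) * ((\<Sum>p\<in>P. signed_mean a (?w p) \<omega> ^ (2 * k)) / real (card P))"
        using ustat_square_le[of k n "\<lambda>j. noise a j \<omega>"] nk[OF k] False k s m unfolding P_def signed_mean_def by simp
      then have "?A \<omega> ^ (2 * (s - k)) * (?u k \<omega>)\<^sup>2 \<le> ?A \<omega> ^ (2 * (s - k)) * (2 * exp (2 * real k) * ((\<Sum>p\<in>P. signed_mean a (?w p) \<omega> ^ (2 * k)) / real (card P)))"
        by (intro mult_left_mono) (auto simp: zero_le_even_power)
      also have "\<dots> = 2 * exp (2 * real k) * ((\<Sum>p\<in>P. ?A \<omega> ^ (2 * (s - k)) * signed_mean a (?w p) \<omega> ^ (2 * k)) / real (card P))"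
        by (simp add: sum_distrib_left[symmetric])
      also have "\<dots> \<le> ?b \<omega>"
        using k s m by (intro mult_left_mono divide_right_mono sum_mono power_mult_power_le) auto
      finally show ?thesis .
    qed
    have nn: "0 \<le> ?A \<omega> ^ (2 * (s - k)) * (?u k \<omega>)\<^sup>2" for \<omega> by (simp add: zero_le_even_power)
    have "integrable M (\<lambda>\<omega>. ?A \<omega> ^ (2 * (s - k)) * (?u k \<omega>)\<^sup>2)"
    proof (rule Bochner_Integration.integrable_bound[OF bint])
      show "AE \<omega> in M. norm (?A \<omega> ^ (2 * (s - k)) * (?u k \<omega>)\<^sup>2) \<le> norm (?b \<omega>)"
      proof (rule AE_I2)
        fix \<omega>
        have "norm (?A \<omega> ^ (2 * (s - k)) * (?u k \<omega>)\<^sup>2) = ?A \<omega> ^ (2 * (s - k)) * (?u k \<omega>)\<^sup>2"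
          using nn[of \<omega>] by (simp only: real_norm_def abs_of_nonneg)
        also have "\<dots> \<le> ?b \<omega>" by (rule pw)
        also have "\<dots> \<le> norm (?b \<omega>)" unfolding real_norm_def by (rule abs_ge_self)
        finally show "norm (?A \<omega> ^ (2 * (s - k)) * (?u k \<omega>)\<^sup>2) \<le> norm (?b \<omega>)" .
      qed
    qed measurable
    moreover from this have "expectation (\<lambda>\<omega>. ?A \<omega> ^ (2 * (s - k)) * (?u k \<omega>)\<^sup>2) \<le> expectation ?b"
      by (intro integral_mono bint pw)
    ultimately show ?thesis using bexp by (auto intro: order_trans)
  qed
  let ?p = "\<lambda>k. real (m choose k) * exp 1 ^ k"
  have sump: "(\<Sum>k\<le>m. ?p k) = (1 + exp 1) ^ m"
    using binomial_ring[of "exp 1 :: real" 1 m] by (simp add: add.commute)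
  let ?q = "\<lambda>k \<omega>. exp (- 2 * real k) * (?A \<omega> ^ (2 * (s - k)) * (?u k \<omega>)\<^sup>2)"
  have D2: "(D a \<omega>)\<^sup>2 \<le> (1 + exp 1) ^ m * (\<Sum>k\<le>m. ?p k * ?q k \<omega>)" for \<omega>
  proof -
    have "D a \<omega> = (\<Sum>k\<le>m. ?p k * (exp (- real k) * (\<bar>?A \<omega>\<bar> ^ (s - k) * \<bar>?u k \<omega>\<bar>)))"
      unfolding D_def A_def sum_distrib_left
    proof (intro sum.cong refl)
      fix k assume "k \<in> {..m}"
      then have sk: "s - k = Suc (m - k)" using m s by auto
      have e1: "exp 1 ^ k * exp (- real k) = (1 :: real)"
        using exp_of_nat_mult[where n = k and x = "1 :: real"] by (simp add: exp_minus)
      have pz: "?p k * (exp (- real k) * z) = real (m choose k) * z" for z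
      proof -
        have "?p k * (exp (- real k) * z) = real (m choose k) * ((exp 1 ^ k * exp (- real k)) * z)"
          by (simp only: mult.assoc)
        then show ?thesis by (simp only: e1 mult_1_left)
      qed
      show "\<bar>?A \<omega>\<bar> * (real (m choose k) * \<bar>?A \<omega>\<bar> ^ (m - k) * \<bar>?u k \<omega>\<bar>) = ?p k * (exp (- real k) * (\<bar>?A \<omega>\<bar> ^ (s - k) * \<bar>?u k \<omega>\<bar>))"
        unfolding pz sk by (simp only: power_Suc mult_ac)
    qed
    then have "(D a \<omega>)\<^sup>2 \<le> (\<Sum>k\<le>m. ?p k) * (\<Sum>k\<le>m. ?p k * (exp (- real k) * (\<bar>?A \<omega>\<bar> ^ (s - k) * \<bar>?u k \<omega>\<bar>))\<^sup>2)"
      by (simp only:) (rule weighted_sum_square_le, simp)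
    also have "(\<Sum>k\<le>m. ?p k * (exp (- real k) * (\<bar>?A \<omega>\<bar> ^ (s - k) * \<bar>?u k \<omega>\<bar>))\<^sup>2) = (\<Sum>k\<le>m. ?p k * ?q k \<omega>)"
    proof (intro sum.cong refl arg_cong2[where f = "(*)"])
      fix k
      have "(exp (- real k))\<^sup>2 = exp (- 2 * real k)" by (simp add: exp_double[symmetric])
      moreover have "(\<bar>?A \<omega>\<bar> ^ (s - k))\<^sup>2 = ?A \<omega> ^ (2 * (s - k))"
        by (simp only: power_mult[symmetric] mult.commute[of "s - k"] power_even_abs even_mult_iff even_numeral simp_thms)
      ultimately show "(exp (- real k) * (\<bar>?A \<omega>\<bar> ^ (s - k) * \<bar>?u k \<omega>\<bar>))\<^sup>2 = ?q k \<omega>"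
        by (simp only: power_mult_distrib power2_abs)
    qed
    finally show ?thesis unfolding sump .
  qed
  have qint: "integrable M (\<lambda>\<omega>. (1 + exp 1) ^ m * (\<Sum>k\<le>m. ?p k * ?q k \<omega>))"
    using one by (intro integrable_mult_right Bochner_Integration.integrable_sum) auto
  show int: "integrable M (\<lambda>\<omega>. (D a \<omega>)\<^sup>2)"
  proof (rule Bochner_Integration.integrable_bound[OF qint])
    show "(\<lambda>\<omega>. (D a \<omega>)\<^sup>2) \<in> borel_measurable M" unfolding D_def A_def by measurable
    show "AE \<omega> in M. norm ((D a \<omega>)\<^sup>2) \<le> norm ((1 + exp 1) ^ m * (\<Sum>k\<le>m. ?p k * ?q k \<omega>))"
      using D2 by (intro AE_I2) (auto intro: order_trans[OF _ abs_ge_self])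
  qed
  have "expectation (\<lambda>\<omega>. (D a \<omega>)\<^sup>2) \<le> expectation (\<lambda>\<omega>. (1 + exp 1) ^ m * (\<Sum>k\<le>m. ?p k * ?q k \<omega>))"
    by (intro integral_mono int qint D2)
  also have "\<dots> = (1 + exp 1) ^ m * (\<Sum>k\<le>m. ?p k * (exp (- 2 * real k) * expectation (\<lambda>\<omega>. ?A \<omega> ^ (2 * (s - k)) * (?u k \<omega>)\<^sup>2)))"
    using one by (simp add: Bochner_Integration.integral_sum)
  also have "\<dots> \<le> (1 + exp 1) ^ m * (\<Sum>k\<le>m. ?p k * (exp (- 2 * real k) * (exp (2 * real k) * (4 * H))))"
    using one by (intro mult_left_mono sum_mono) auto
  also have "\<dots> = (1 + exp 1) ^ m * (\<Sum>k\<le>m. ?p k * (4 * H))"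
    by (simp add: mult.assoc[symmetric] exp_add[symmetric])
  also have "\<dots> = (1 + exp 1) ^ (2 * m) * (4 * H)"
    unfolding sum_distrib_right[symmetric] sump by (simp add: mult_2 power_add)
  finally show "expectation (\<lambda>\<omega>. (D a \<omega>)\<^sup>2) \<le> (1 + exp 1) ^ (2 * m) * (4 * (\<sigma> ^ (2 * s) * 8 ^ s * fact s))"
    by (simp add: H_def)
qed

end

section \<open>Expansion of the estimator\<close>

lemma centered_ustat_eq:
  assumes "k \<le> n"
  shows "centered_ustat n k y a = ustat n k (\<lambda>j. y j $ a - sample_mean n y a)"
  unfolding centered_ustat_def ustat_def
  by (subst sum_inj_eq_fact_esym) (use assms in \<open>auto simp: binomial_fact\<close>)

text \<open>After normalization the coefficients of \<open>esym_shift\<close> become those of the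
  binomial theorem: under a change of centre, U-statistics behave like the powers
  \<open>(y - t)^k\<close>.\<close>

lemma ustat_shift:
  assumes "k \<le> n"
  shows "ustat n k (\<lambda>j. y j - t) = (\<Sum>i\<le>k. real (k choose i) * (- t) ^ (k - i) * ustat n i y)"
proof -
  have "esym {1..n} k (\<lambda>j. y j + - t) / real (n choose k)
      = (\<Sum>i\<le>k. real ((n - i) choose (k - i)) * (- t) ^ (k - i) * esym {1..n} i y / real (n choose k))"
    by (subst esym_shift) (simp_all add: sum_divide_distrib)
  also have "\<dots> = (\<Sum>i\<le>k. real (k choose i) * (- t) ^ (k - i) * ustat n i y)"
  proof (intro sum.cong refl)
    fix i assume i: "i \<in> {..k}"
    have "real (n choose k) * real (k choose i) = real (n choose i) * real ((n - i) choose (k - i))"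
      using choose_mult[of i k n] i assms by (simp flip: of_nat_mult)
    moreover have "real (n choose k) > 0" "real (n choose i) > 0" using i assms by auto
    ultimately have "real ((n - i) choose (k - i)) / real (n choose k) = real (k choose i) / real (n choose i)"
      by (simp add: field_simps)
    then have "real ((n - i) choose (k - i)) / real (n choose k) * ((- t) ^ (k - i) * esym {1..n} i y)
        = real (k choose i) / real (n choose i) * ((- t) ^ (k - i) * esym {1..n} i y)" by simp
    then show "real ((n - i) choose (k - i)) * (- t) ^ (k - i) * esym {1..n} i y / real (n choose k)
        = real (k choose i) * (- t) ^ (k - i) * ustat n i y"
      by (simp add: ustat_def mult_ac)
  qed
  finally show ?thesis by (simp add: ustat_def)
qed

lemma ustat_has_derivative:
  assumes "Suc k \<le> n"
  shows "((\<lambda>t. ustat n (Suc k) (\<lambda>j. y j - t)) has_real_derivative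
    - (real (Suc k) * ustat n k (\<lambda>j. y j - t))) (at t)"
proof -
  let ?g = "\<lambda>i t. real (Suc k choose i) * (- t) ^ (Suc k - i) * ustat n i y"
  have "((\<lambda>t. \<Sum>i\<le>Suc k. ?g i t) has_real_derivative
      (\<Sum>i\<le>Suc k. - (real (Suc k choose i) * (real (Suc k - i) * (- t) ^ (k - i)) * ustat n i y))) (at t)"
    by (intro DERIV_sum) (auto intro!: derivative_eq_intros simp: Suc_diff_le)
  also have "(\<Sum>i\<le>Suc k. - (real (Suc k choose i) * (real (Suc k - i) * (- t) ^ (k - i)) * ustat n i y))
      = (\<Sum>i\<le>k. - (real (Suc k) * (real (k choose i) * (- t) ^ (k - i) * ustat n i y)))"
  proof -
    have "real (Suc k choose i) * (real (Suc k - i) * z) = real (Suc k) * (real (k choose i) * z)" for i z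
    proof -
      have "real (Suc k - i) * real (Suc k choose i) = real (Suc k) * real (k choose i)"
        using binomial_absorb_comp[of "Suc k" i] by (simp only: of_nat_mult[symmetric] diff_Suc_1)
      then show ?thesis by (metis (no_types, opaque_lifting) mult.assoc mult.commute)
    qed
    note key = this
    have "(\<Sum>i\<le>Suc k. - (real (Suc k choose i) * (real (Suc k - i) * (- t) ^ (k - i)) * ustat n i y))
        = (\<Sum>i\<le>k. - (real (Suc k choose i) * (real (Suc k - i) * (- t) ^ (k - i)) * ustat n i y))"
      by (subst sum.atMost_Suc) simp
    also have "\<dots> = (\<Sum>i\<le>k. - (real (Suc k) * (real (k choose i) * (- t) ^ (k - i) * ustat n i y)))"
      by (intro sum.cong refl) (simp only: key mult.assoc)
    finally show ?thesis .
  qed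
  also have "\<dots> = - (real (Suc k) * ustat n k (\<lambda>j. y j - t))"
    using assms by (subst ustat_shift) (simp_all add: sum_negf sum_distrib_left)
  finally show ?thesis using assms by (subst ustat_shift) auto
qed

text \<open>The Taylor polynomial of \<open>f\<close> about \<open>t\<close>, with the
  \<open>k\<close>-th power of the displacement replaced by its unbiased estimator, the U-statistic
  of order \<open>k\<close> of the data centred at \<open>t\<close>.\<close>

definition plugin_ustat :: "nat \<Rightarrow> nat \<Rightarrow> (real \<Rightarrow> complex) \<Rightarrow> (nat \<Rightarrow> real) \<Rightarrow> real \<Rightarrow> complex" where
  "plugin_ustat n m f y t = (\<Sum>k\<le>m. nth_deriv k f t * complex_of_real (ustat n k (\<lambda>j. y j - t)) / fact k)"

text \<open>For a polynomial \<open>f\<close> of degree at most \<open>m\<close> this derivative vanishes: the estimator does not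
  depend on the expansion point.\<close>

lemma plugin_ustat_has_vector_derivative:
  assumes "m \<le> n" and D: "\<And>i. i \<le> m \<Longrightarrow> (nth_deriv i f has_vector_derivative nth_deriv (Suc i) f t) (at t)"
  shows "(plugin_ustat n m f y has_vector_derivative
    nth_deriv (Suc m) f t * complex_of_real (ustat n m (\<lambda>j. y j - t)) / fact m) (at t)"
  using assms
proof (induction m)
  case 0
  then show ?case using 0(2)[of 0] by (simp add: plugin_ustat_def[abs_def])
next
  case (Suc m)
  let ?u = "\<lambda>k t. complex_of_real (ustat n k (\<lambda>j. y j - t))"
  have IH: "(plugin_ustat n m f y has_vector_derivative nth_deriv (Suc m) f t * ?u m t / fact m) (at t)"
    using Suc by auto
  have "(?u (Suc m) has_vector_derivative complex_of_real (- (real (Suc m) * ustat n m (\<lambda>j. y j - t)))) (at t)"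
    using ustat_has_derivative[OF Suc.prems(1), of y t]
    by (intro has_vector_derivative_of_real) (simp add: has_real_derivative_iff_has_vector_derivative)
  from has_vector_derivative_divide[OF has_vector_derivative_mult[OF Suc.prems(2)[of "Suc m"] this], of "fact (Suc m)"]
  have "((\<lambda>t. nth_deriv (Suc m) f t * ?u (Suc m) t / fact (Suc m)) has_vector_derivative
    (nth_deriv (Suc m) f t * complex_of_real (- (real (Suc m) * ustat n m (\<lambda>j. y j - t)))
      + nth_deriv (Suc (Suc m)) f t * ?u (Suc m) t) / fact (Suc m)) (at t)"
    by simp
  from has_vector_derivative_add[OF IH this]
  have "((\<lambda>t. plugin_ustat n m f y t + nth_deriv (Suc m) f t * ?u (Suc m) t / fact (Suc m)) has_vector_derivative
    nth_deriv (Suc m) f t * ?u m t / fact m + (nth_deriv (Suc m) f t * complex_of_real (- (real (Suc m) * ustat n m (\<lambda>j. y j - t)))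
      + nth_deriv (Suc (Suc m)) f t * ?u (Suc m) t) / fact (Suc m)) (at t)" .
  \<comment> \<open>Differentiating the U-statistic in the new term cancels the derivative of the
    lower sum; the part with the raised derivative of \<open>f\<close> survives.\<close>
  moreover have "nth_deriv (Suc m) f t * ?u m t / fact m + (nth_deriv (Suc m) f t * complex_of_real (- (real (Suc m) * ustat n m (\<lambda>j. y j - t)))
      + nth_deriv (Suc (Suc m)) f t * ?u (Suc m) t) / fact (Suc m) = nth_deriv (Suc (Suc m)) f t * ?u (Suc m) t / fact (Suc m)"
  proof -
    have "nth_deriv (Suc m) f t * complex_of_real (- (real (Suc m) * ustat n m (\<lambda>j. y j - t))) / fact (Suc m)
        = - (of_nat (Suc m) * (nth_deriv (Suc m) f t * ?u m t)) / (of_nat (Suc m) * fact m)"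
      by (simp only: fact_Suc of_real_minus of_real_mult of_real_of_nat_eq mult_minus_right mult.left_commute)
    also have "\<dots> = - (nth_deriv (Suc m) f t * ?u m t) / fact m"
      by (simp only: mult_minus_right[symmetric]) (simp del: of_nat_Suc)
    finally have eq: "nth_deriv (Suc m) f t * complex_of_real (- (real (Suc m) * ustat n m (\<lambda>j. y j - t))) / fact (Suc m)
        = - (nth_deriv (Suc m) f t * ?u m t) / fact m" .
    show ?thesis unfolding add_divide_distrib eq by simp
  qed
  ultimately show ?case unfolding plugin_ustat_def[abs_def] by simp
qed

text \<open>Mean value inequality on the ball of radius \<open>\<bar>b\<bar>\<close> about
  \<open>t0\<close>: the derivative contains a single U-statistic of order \<open>m\<close>, which
  \<open>ustat_shift\<close> re-expands about \<open>t0\<close>. In the application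
  \<open>t0\<close> is the true coordinate and \<open>y\<close> the noise.\<close>

lemma plugin_ustat_remainder:
  assumes m: "m \<le> n" and D: "\<And>i t. i \<le> m \<Longrightarrow> (nth_deriv i f has_vector_derivative nth_deriv (Suc i) f t) (at t)"
    and c: "\<And>t. norm (nth_deriv (Suc m) f t) \<le> c"
  shows "norm (plugin_ustat n m f (\<lambda>j. t0 + y j) (t0 + b) - plugin_ustat n m f (\<lambda>j. t0 + y j) t0)
    \<le> c / fact m * (\<bar>b\<bar> * (\<Sum>k\<le>m. real (m choose k) * \<bar>b\<bar> ^ (m - k) * \<bar>ustat n k y\<bar>))"
proof -
  let ?F = "plugin_ustat n m f (\<lambda>j. t0 + y j)"
  let ?B = "\<Sum>k\<le>m. real (m choose k) * \<bar>b\<bar> ^ (m - k) * \<bar>ustat n k y\<bar>"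
  let ?F' = "\<lambda>t. nth_deriv (Suc m) f t * complex_of_real (ustat n m (\<lambda>j. t0 + y j - t)) / fact m"
  have c0: "c \<ge> 0" using c[of 0] norm_ge_zero order_trans by blast
  have bound: "norm (?F' t) \<le> c / fact m * ?B" if t: "t \<in> cball t0 \<bar>b\<bar>" for t
  proof -
    have "\<bar>ustat n m (\<lambda>j. y j - (t - t0))\<bar> \<le> (\<Sum>k\<le>m. \<bar>real (m choose k) * (- (t - t0)) ^ (m - k) * ustat n k y\<bar>)"
      unfolding ustat_shift[OF m] by (rule sum_abs)
    also have "\<dots> \<le> ?B"
      using t by (intro sum_mono) (auto simp: abs_mult power_abs dist_real_def intro!: mult_right_mono mult_left_mono power_mono)
    finally have u: "\<bar>ustat n m (\<lambda>j. t0 + y j - t)\<bar> \<le> ?B" by (simp add: algebra_simps)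
    have "norm (?F' t) = norm (nth_deriv (Suc m) f t) / fact m * \<bar>ustat n m (\<lambda>j. t0 + y j - t)\<bar>"
      by (simp add: norm_mult norm_divide)
    also have "\<dots> \<le> c / fact m * ?B"
      using u c[of t] c0 by (intro mult_mono divide_right_mono) auto
    finally show ?thesis .
  qed
  have "norm (?F (t0 + b) - ?F t0) \<le> (c / fact m * ?B) * norm (t0 + b - t0)"
  proof (rule differentiable_bound[of "cball t0 \<bar>b\<bar>" ?F "\<lambda>t h. h *\<^sub>R ?F' t"])
    fix t assume t: "t \<in> cball t0 \<bar>b\<bar>"
    show "(?F has_derivative (\<lambda>h. h *\<^sub>R ?F' t)) (at t within cball t0 \<bar>b\<bar>)"
      using plugin_ustat_has_vector_derivative[OF m D] by (auto simp: has_vector_derivative_def intro: has_derivative_at_withinI)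
    show "onorm (\<lambda>h. h *\<^sub>R ?F' t) \<le> c / fact m * ?B"
    proof (rule onorm_le)
      fix h :: real
      have "norm (h *\<^sub>R ?F' t) = \<bar>h\<bar> * norm (?F' t)" by (rule norm_scaleR)
      also have "\<dots> \<le> \<bar>h\<bar> * (c / fact m * ?B)" by (intro mult_left_mono bound[OF t]) auto
      finally show "norm (h *\<^sub>R ?F' t) \<le> c / fact m * ?B * norm h"
        by (simp only: mult.commute[of _ "\<bar>h\<bar>"] real_norm_def)
    qed
  qed (auto simp: dist_real_def)
  then show ?thesis by (simp add: mult_ac)
qed

lemma ustat_1_centered:
  assumes "n \<ge> 1"
  shows "ustat n 1 (\<lambda>j. y j - (\<Sum>j\<in>{1..n}. y j) / real n) = 0"
proof -
  have "esym {1..n} 1 z = (\<Sum>j\<in>{1..n}. z j)" for z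
    using sum_inj_eq_fact_esym[where I = "{1..n}" and k = 1 and y = z] power_sum_PiE[where I = "{1..n}" and f = z and k = 1] by simp
  then show ?thesis using assms by (simp add: ustat_def sum_subtractf)
qed

text \<open>Data centred at the sample mean sum to 0, so the term of order 1 vanishes; this is why
  the sum in the estimator can start at 2.\<close>

lemma estimator_eq:
  assumes "n \<ge> 1" "1 \<le> m" "m \<le> n"
  shows "estimator n m f y = complex_of_real (1 / real CARD('d::finite)) *
    (\<Sum>a\<in>UNIV. plugin_ustat n m f (\<lambda>j. y j $ (a::'d)) (sample_mean n y a))"
proof -
  have "f (sample_mean n y a) + (\<Sum>k\<in>{2..m}. nth_deriv k f (sample_mean n y a) * complex_of_real (centered_ustat n k y a) / fact k)
      = plugin_ustat n m f (\<lambda>j. y j $ a) (sample_mean n y a)" for a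
  proof -
    let ?t = "\<lambda>k. nth_deriv k f (sample_mean n y a) * complex_of_real (ustat n k (\<lambda>j. y j $ a - sample_mean n y a)) / fact k"
    have "{..m} = insert 0 (insert 1 {2..m})" using assms by auto
    then have "(\<Sum>k\<le>m. ?t k) = ?t 0 + (?t 1 + (\<Sum>k\<in>{2..m}. ?t k))" by simp
    moreover have "?t 1 = 0" using ustat_1_centered[OF assms(1), of "\<lambda>j. y j $ a"] by (simp add: sample_mean_def)
    moreover have "(\<Sum>k\<in>{2..m}. ?t k) = (\<Sum>k\<in>{2..m}. nth_deriv k f (sample_mean n y a) * complex_of_real (centered_ustat n k y a) / fact k)"
      using assms by (intro sum.cong refl) (simp add: centered_ustat_eq)
    ultimately show ?thesis by (simp add: plugin_ustat_def)
  qed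
  then show ?thesis by (simp add: estimator_def)
qed

section \<open>Numerical constants\<close>

text \<open>From \<open>e < 2.72\<close> the base is below \<open>1 - 27/200\<close>, so the power
  decays at rate \<open>27/200\<close>. On the other side \<open>s \<le> exp (9 s / 200)\<close>,
  and cubing gives the same rate.\<close>

lemma exponential_beats_cubic:
  assumes "s \<ge> 320"
  shows "real s ^ 3 * ((1 + exp 1)\<^sup>2 / 16) ^ s \<le> 1"
proof -
  have "(1 + exp 1)\<^sup>2 / 16 \<le> (372 / 100)\<^sup>2 / (16 :: real)"
    using e_less_272 by (intro divide_right_mono power_mono) auto
  also have "\<dots> \<le> 1 + - (27 / 200 :: real)" by (simp add: power2_eq_square)
  also have "\<dots> \<le> exp (- (27 / 200))" by (rule exp_ge_add_one_self)
  finally have "((1 + exp 1)\<^sup>2 / 16) ^ s \<le> exp (- (27 / 200) :: real) ^ s" by (intro power_mono) auto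
  also have "\<dots> = exp (- (27 / 200) * real s)" by (simp add: exp_of_nat_mult[symmetric] mult.commute)
  finally have q: "((1 + exp 1)\<^sup>2 / 16) ^ s \<le> exp (- (27 / 200) * real s)" .
  \<comment> \<open>Numerically \<open>1 + 9/800 * 320 = 4.6\<close>, and \<open>4.6^3\<close>
    exceeds \<open>800/9\<close>; this fixes the threshold 320.\<close>
  have "real s \<le> (9 / 800 * real s) * (1 + 9 / 800 * 320) ^ 3" by (simp add: power3_eq_cube)
  also have "\<dots> \<le> (1 + 9 / 800 * real s) * (1 + 9 / 800 * real s) ^ 3"
    using assms by (intro mult_mono power_mono) auto
  also have "\<dots> = (1 + (9 / 200 * real s) / real 4) ^ 4" by (simp add: power_numeral_reduce)
  also have "\<dots> \<le> exp (9 / 200 * real s)"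
    by (rule exp_ge_one_plus_x_over_n_power_n) auto
  finally have "real s ^ 3 \<le> exp (9 / 200 * real s) ^ 3" by (intro power_mono) auto
  also have "\<dots> = exp (27 / 200 * real s)" by (simp add: exp_of_nat_mult[symmetric])
  finally have "real s ^ 3 * ((1 + exp 1)\<^sup>2 / 16) ^ s \<le> exp (27 / 200 * real s) * exp (- (27 / 200) * real s)"
    using q by (intro mult_mono) auto
  also have "\<dots> = 1" by (simp add: exp_add[symmetric])
  finally show ?thesis .
qed

text \<open>With \<open>L^s \<le> s! / 128^s\<close> the left side is at most
  \<open>s^2 ((1 + e)^2 / 16)^s\<close>: 16 is \<open>128 / 8\<close>, and \<open>s^2\<close> is the
  squared ratio of \<open>fact s\<close> to \<open>fact (s - 1)\<close>. The cubic bound leaves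
  \<open>1 / s\<close>, which is weakened to the square of \<open>s^(-1/4)\<close>.\<close>

lemma remainder_constant_le:
  assumes s: "s \<ge> 320" and L: "0 < L" "L \<le> real s / (128 * exp 1)"
  shows "L ^ s / (fact (s - 1))\<^sup>2 * ((1 + exp 1) ^ (2 * (s - 1)) * (4 * (8 ^ s * fact s))) \<le> real s powr (- 1 / 2)"
proof -
  let ?E = "1 + exp 1 :: real"
  have s0: "real s > 0" using s by simp
  have "L ^ s \<le> (real s / (128 * exp 1)) ^ s" using L by (intro power_mono) auto
  also have "\<dots> = real s ^ s / (128 ^ s * exp (real s))"
    by (simp add: power_divide power_mult_distrib exp_of_nat_mult[symmetric])
  also have "\<dots> \<le> fact s * exp (real s) / (128 ^ s * exp (real s))"
    by (intro divide_right_mono power_le_fact_mult_exp) auto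
  finally have Ls: "L ^ s \<le> fact s / 128 ^ s" by simp
  have f: "fact s = real s * fact (s - 1)" using s by (subst fact_reduce) auto
  have E2: "?E ^ (2 * (s - 1)) = (?E\<^sup>2) ^ s / ?E\<^sup>2"
  proof -
    have "(?E\<^sup>2) ^ s = (?E\<^sup>2) ^ (s - 1) * ?E\<^sup>2" using s by (simp flip: power_Suc2)
    moreover have "?E\<^sup>2 > 0" by (intro zero_less_power add_pos_pos) auto
    ultimately show ?thesis by (simp add: power_mult)
  qed
  have E4: "4 / ?E\<^sup>2 \<le> 1"
  proof -
    have "2\<^sup>2 \<le> ?E\<^sup>2" using exp_ge_add_one_self[of 1] by (intro power_mono) auto
    moreover have "?E\<^sup>2 > 0" by (intro zero_less_power add_pos_pos) auto
    ultimately show ?thesis by simp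
  qed
  have "L ^ s / (fact (s - 1))\<^sup>2 * (?E ^ (2 * (s - 1)) * (4 * (8 ^ s * fact s)))
      \<le> fact s / 128 ^ s / (fact (s - 1))\<^sup>2 * (?E ^ (2 * (s - 1)) * (4 * (8 ^ s * fact s)))"
    by (intro mult_right_mono divide_right_mono Ls) (auto intro!: mult_nonneg_nonneg zero_le_power add_nonneg_nonneg)
  also have "\<dots> = (real s)\<^sup>2 * (8 / 128) ^ s * ((?E\<^sup>2) ^ s) * (4 / ?E\<^sup>2)"
  proof -
    have "S * g / p / g\<^sup>2 * (w / v * (4 * (q * (S * g)))) = S\<^sup>2 * (q / p) * w * (4 / v)"
      if "g \<noteq> 0" for S g p q w v :: real
      using that by (simp add: power2_eq_square)
    then show ?thesis unfolding f E2 power_divide by simp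
  qed
  also have "\<dots> = (4 / ?E\<^sup>2) * ((real s)\<^sup>2 * (?E\<^sup>2 / 16) ^ s)"
  proof -
    have "(8 / 128) ^ s * (?E\<^sup>2) ^ s = (?E\<^sup>2 / 16) ^ s"
      unfolding power_mult_distrib[symmetric] by simp
    then show ?thesis by (simp only: mult_ac)
  qed
  also have "\<dots> \<le> 1 * ((real s)\<^sup>2 * (?E\<^sup>2 / 16) ^ s)" by (intro mult_right_mono E4) auto
  also have "\<dots> \<le> 1 / real s"
    using exponential_beats_cubic[OF s] s0 by (simp add: pos_le_divide_eq power3_eq_cube power2_eq_square mult_ac)
  also have "\<dots> = real s powr (- 1)" using s0 by (simp add: powr_minus_divide)
  also have "\<dots> \<le> real s powr (- 1 / 2)" using s by (intro powr_mono) auto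
  finally show ?thesis .
qed

text \<open>A pointwise form of Minkowski's inequality: once the second moments of \<open>z\<close>
  and \<open>r\<close> are at most \<open>Z^2\<close> and \<open>R^2\<close>, the expectation of the
  right side is at most \<open>(B + Z + R)^2\<close>.\<close>

lemma square_sum3_le:
  fixes b z r B Z R :: real
  assumes "B \<ge> 0" "Z > 0" "R > 0"
  shows "(B + z + r)\<^sup>2 \<le> (B + Z + R) * (B + z\<^sup>2 / Z + r\<^sup>2 / R)"
proof -
  have "(\<Sum>i\<in>{0,1,2::nat}. (if i = 0 then B else if i = 1 then Z else R) * (if i = 0 then 1 else if i = 1 then z / Z else r / R))\<^sup>2
    \<le> (\<Sum>i\<in>{0,1,2::nat}. if i = 0 then B else if i = 1 then Z else R) *
      (\<Sum>i\<in>{0,1,2::nat}. (if i = 0 then B else if i = 1 then Z else R) * (if i = 0 then 1 else if i = 1 then z / Z else r / R)\<^sup>2)"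
    by (rule weighted_sum_square_le) (use assms in auto)
  then show ?thesis using assms by (simp add: power_divide power2_eq_square add.assoc)
qed

lemma (in prob_space) second_moment_sum3_le:
  fixes X z r :: "'a \<Rightarrow> real"
  assumes B: "B \<ge> 0" "Z > 0" "R > 0"
    and meas: "X \<in> borel_measurable M" and X: "\<And>\<omega>. \<omega> \<in> space M \<Longrightarrow> \<bar>X \<omega>\<bar> \<le> B + z \<omega> + r \<omega>"
    and z: "integrable M (\<lambda>\<omega>. (z \<omega>)\<^sup>2)" "expectation (\<lambda>\<omega>. (z \<omega>)\<^sup>2) \<le> Z\<^sup>2"
    and r: "integrable M (\<lambda>\<omega>. (r \<omega>)\<^sup>2)" "expectation (\<lambda>\<omega>. (r \<omega>)\<^sup>2) \<le> R\<^sup>2"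
  shows "integrable M (\<lambda>\<omega>. (X \<omega>)\<^sup>2)" "expectation (\<lambda>\<omega>. (X \<omega>)\<^sup>2) \<le> (B + Z + R)\<^sup>2"
proof -
  let ?b = "\<lambda>\<omega>. (B + Z + R) * (B + (z \<omega>)\<^sup>2 / Z + (r \<omega>)\<^sup>2 / R)"
  have b: "integrable M ?b" using z r by simp
  have le: "(X \<omega>)\<^sup>2 \<le> ?b \<omega>" if "\<omega> \<in> space M" for \<omega>
  proof -
    have "\<bar>X \<omega>\<bar>\<^sup>2 \<le> (B + z \<omega> + r \<omega>)\<^sup>2" by (intro power_mono X that) auto
    then show ?thesis using square_sum3_le[OF B, of "z \<omega>" "r \<omega>"] by simp
  qed
  show int: "integrable M (\<lambda>\<omega>. (X \<omega>)\<^sup>2)"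
    by (rule Bochner_Integration.integrable_bound[OF b])
       (use meas le in \<open>auto intro!: AE_I2 order_trans[OF _ abs_ge_self]\<close>)
  have "expectation (\<lambda>\<omega>. (X \<omega>)\<^sup>2) \<le> expectation ?b" by (intro integral_mono int b le)
  also have "\<dots> = (B + Z + R) * (B + expectation (\<lambda>\<omega>. (z \<omega>)\<^sup>2) / Z + expectation (\<lambda>\<omega>. (r \<omega>)\<^sup>2) / R)"
    using z r by (simp add: prob_space)
  also have "\<dots> \<le> (B + Z + R) * (B + Z\<^sup>2 / Z + R\<^sup>2 / R)"
    using B z r by (intro mult_left_mono add_mono divide_right_mono) auto
  also have "\<dots> = (B + Z + R)\<^sup>2" using B by (simp add: power2_eq_square)
  finally show "expectation (\<lambda>\<omega>. (X \<omega>)\<^sup>2) \<le> (B + Z + R)\<^sup>2" .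
qed

section \<open>The risk bound\<close>

lemma (in noisy_observations) estimator_measurable:
  assumes n: "n \<ge> 1" and m: "1 \<le> m" "m \<le> n"
    and cont: "\<And>k. k \<le> m \<Longrightarrow> continuous_on UNIV (nth_deriv k f)"
  shows "(\<lambda>\<omega>. estimator n m f (\<lambda>j. x j \<omega>)) \<in> borel_measurable M"
proof -
  have mean: "(\<lambda>\<omega>. sample_mean n (\<lambda>j. x j \<omega>) a) \<in> borel_measurable M" for a
  proof -
    have "(\<lambda>\<omega>. \<theta> $ a + signed_mean a (\<lambda>_. 1) \<omega>) \<in> borel_measurable M"
      using signed_mean_measurable by measurable
    moreover have "sample_mean n (\<lambda>j. x j \<omega>) a = \<theta> $ a + signed_mean a (\<lambda>_. 1) \<omega>" for \<omega>
      using n by (simp add: sample_mean_def signed_mean_def noise_def sum_subtractf diff_divide_distrib)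
    ultimately show ?thesis by simp
  qed
  have u: "(\<lambda>\<omega>. ustat n k (\<lambda>j. x j \<omega> $ a - sample_mean n (\<lambda>j. x j \<omega>) a)) \<in> borel_measurable M" for k a
  proof -
    have "(\<lambda>\<omega>. x j \<omega> $ a) \<in> borel_measurable M" if "j \<in> {1..n}" for j
      using borel_measurable_add[OF noise_measurable[OF that, of a] borel_measurable_const[of "\<theta> $ a"]]
      by (simp add: noise_def)
    then show ?thesis
      unfolding ustat_def esym_def using mean
      by (intro borel_measurable_divide borel_measurable_sum borel_measurable_prod borel_measurable_diff) auto
  qed
  then have u: "(\<lambda>\<omega>. complex_of_real (ustat n k (\<lambda>j. x j \<omega> $ a - sample_mean n (\<lambda>j. x j \<omega>) a))) \<in> borel_measurable M" for k a
    by measurable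
  have D: "(\<lambda>\<omega>. nth_deriv k f (sample_mean n (\<lambda>j. x j \<omega>) a)) \<in> borel_measurable M" if "k \<le> m" for k a
    using mean borel_measurable_continuous_onI[OF cont[OF that]] by (rule measurable_compose)
  show ?thesis
    unfolding estimator_eq[OF n m] plugin_ustat_def
    by (intro borel_measurable_times borel_measurable_const borel_measurable_sum borel_measurable_divide
      D u) auto
qed

text \<open>In units of \<open>C * h\<close>, the three summands of the constant are the bias and
  the root mean squares of the fluctuation and the remainder; the last factor of the bound is
  \<open>(C * h)^2\<close>.\<close>

lemma (in noisy_observations) estimator_risk_bound:
  assumes d: "d = CARD('d)" "d \<ge> 2"
    and s: "s = nat \<lceil>2 ^ 7 * exp 1 * ln (real d / ln (real d))\<rceil>"
    and n: "n \<ge> 1" and m: "m = s - 1" and sn: "real s \<le> sqrt (real n / 2 * ln 2)"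
    and h: "h = \<sigma> / sqrt (ln (real d / ln (real d)))" and kc: "kernel_condition C s K"
  defines "f \<equiv> smoothing K h (\<lambda>t. \<bar>t\<bar>)"
  defines "err \<equiv> \<lambda>\<omega>. norm (estimator n m f (\<lambda>j. x j \<omega>) - complex_of_real ((\<Sum>a\<in>UNIV. \<bar>\<theta> $ a\<bar>) / real d))"
  shows "integrable M (\<lambda>\<omega>. (err \<omega>)\<^sup>2)"
    and "expectation (\<lambda>\<omega>. (err \<omega>)\<^sup>2) \<le> (1 + sqrt (2 / ln (real d)) + real s powr (-1/4))\<^sup>2 * (C\<^sup>2 * \<sigma>\<^sup>2 / ln (real d / ln (real d)))"
proof -
  define L where "L = ln (real d / ln (real d))"
  have lnd: "ln (real d) > 0" using d by simp
  \<comment> \<open>This amounts to \<open>ln d \<le> d / e\<close>, the tangent of the logarithm at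
    \<open>e\<close>; it yields \<open>L \<ge> 1\<close>.\<close>
  have dln: "exp 1 \<le> real d / ln (real d)"
  proof -
    have "ln (real d / exp 1) \<le> real d / exp 1 - 1" by (rule ln_le_minus_one) (use d in auto)
    moreover have "ln (real d / exp 1) = ln (real d) - 1" using d by (subst ln_div) auto
    ultimately show ?thesis using lnd by (simp add: field_simps)
  qed
  have dln0: "real d / ln (real d) > 0" using lnd d by simp
  have expL: "exp L = real d / ln (real d)" using dln0 by (simp add: L_def)
  have L1: "L \<ge> 1" unfolding L_def using dln dln0 by (subst ln_ge_iff) auto
  have s_ge: "2 ^ 7 * exp 1 * L \<le> real s" unfolding s L_def by linarith
  have s320: "s \<ge> 320"
  proof -
    have "(5 / 2 :: real) \<le> exp 1" using exp_lower_Taylor_quadratic[of 1] by simp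
    then have "(320 :: real) \<le> 2 ^ 7 * exp 1 * 1" by simp
    also have "\<dots> \<le> 2 ^ 7 * exp 1 * L" using L1 by (intro mult_left_mono) auto
    finally show ?thesis using s_ge by linarith
  qed
  have Ls: "L \<le> real s / (128 * exp 1)" using s_ge by (simp add: field_simps)
  have s2: "(real s)\<^sup>2 \<le> real n / 2"
  proof -
    have "(real s)\<^sup>2 \<le> (sqrt (real n / 2 * ln 2))\<^sup>2" using sn by (intro power_mono) auto
    also have "\<dots> = real n / 2 * ln 2" by simp
    also have "\<dots> \<le> real n / 2 * 1" using ln_2_less_1 by (intro mult_left_mono) auto
    finally show ?thesis by simp
  qed
  have s_le: "s \<le> n"
  proof -
    have "real s \<le> (real s)\<^sup>2" using s320 by (simp add: power2_eq_square)
    then have "real s \<le> real n" using s2 by linarith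
    then show ?thesis by simp
  qed
  have mn: "m \<le> n" "1 \<le> m" "Suc m = s" using s_le s320 m by auto
  \<comment> \<open>Here \<open>k^2 \<le> n / 2\<close> gives the factor \<open>3/4\<close> for the
    falling factorial, and \<open>(4/3)^2 = 16/9\<close> is below 2.\<close>
  have nk: "(real n ^ k)\<^sup>2 \<le> 2 * (fact k * real (n choose k))\<^sup>2" if "k \<le> m" for k
  proof -
    have "(real k)\<^sup>2 \<le> (real s)\<^sup>2" using that m by (intro power_mono) auto
    also note s2
    finally have "3 / 4 \<le> 1 - (real k)\<^sup>2 / (2 * real n)" using n by (simp add: field_simps)
    then have "real n ^ k * (3 / 4) \<le> real n ^ k * (1 - (real k)\<^sup>2 / (2 * real n))" by (intro mult_left_mono) auto
    also have "\<dots> \<le> fact k * real (n choose k)" by (rule falling_factorial_lower_bound) (use that mn in simp)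
    finally have "(real n ^ k * (3 / 4))\<^sup>2 \<le> (fact k * real (n choose k))\<^sup>2" by (intro power_mono) auto
    moreover have "(real n ^ k * (3 / 4))\<^sup>2 = (real n ^ k)\<^sup>2 * (9 / 16)"
      unfolding power_mult_distrib by (simp add: power_divide)
    moreover have "0 \<le> (real n ^ k)\<^sup>2" by simp
    ultimately show ?thesis by linarith
  qed
  have h0: "h > 0" using noise_level L1 unfolding h L_def[symmetric] by simp
  have h2: "h\<^sup>2 = \<sigma>\<^sup>2 / L" using L1 unfolding h L_def[symmetric] by (simp add: power_divide)
  have s3: "3 \<le> s" using s320 by simp
  \<comment> \<open>What matters below is that \<open>C * h\<close> is positive: the sum of three
    errors is weighted by multiples of it, which must not be 0.\<close>
  have C1: "C \<ge> 1"
  proof -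
    have "1 = norm (LINT u|lborel. K u)" using kernel_integral[OF kc s3] by simp
    also have "\<dots> \<le> (LINT u|lborel. norm (K u))" by (rule integral_norm_bound)
    also have "\<dots> \<le> C" by (rule kernel_integrable(2)[OF kc s3])
    finally show ?thesis .
  qed
  have Ch: "C * h > 0" using C1 h0 by simp
  have D: "(nth_deriv i f has_vector_derivative nth_deriv (Suc i) f t) (at t)" if "i \<le> m" for i t
    unfolding f_def by (rule nth_deriv_smoothing_abs[OF kc s3 h0]) (use that mn in simp)
  have bnd: "norm (nth_deriv k f t) \<le> C / h ^ (k - 1)" if "1 \<le> k" "k \<le> s" for k t
    unfolding f_def by (rule nth_deriv_smoothing_abs_bound[OF kc s3 h0 that])
  have bias: "norm (f t - complex_of_real \<bar>t\<bar>) \<le> C * h" for t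
    unfolding f_def by (rule smoothing_abs_bias[OF kc s3 h0])
  let ?A = "\<lambda>a \<omega>. signed_mean a (\<lambda>_. 1) \<omega>"
  let ?D = "\<lambda>a \<omega>. \<bar>?A a \<omega>\<bar> * (\<Sum>k\<le>m. real (m choose k) * \<bar>?A a \<omega>\<bar> ^ (m - k) * \<bar>ustat n k (\<lambda>j. noise a j \<omega>)\<bar>)"
  define c where "c = C / h ^ m"
  define g where "g = (\<lambda>a k. complex_of_real (1 / real d) * (nth_deriv k f (\<theta> $ a) / fact k))"
  define Z where "Z = (\<lambda>\<omega>. \<Sum>a\<in>UNIV. \<Sum>k\<in>{1..m}. g a k * complex_of_real (ustat n k (\<lambda>j. noise a j \<omega>)))"
  define r where "r = (\<lambda>\<omega>. \<Sum>a\<in>(UNIV :: 'd set). 1 / real d * (c / fact m * ?D a \<omega>))"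
  have d0: "real d > 0" using d by simp
  have sum_const: "(\<Sum>a\<in>(UNIV :: 'd set). 1 / real d * v) = v" for v :: real
    using d0 d(1) by simp
  have err_le: "err \<omega> \<le> C * h + norm (Z \<omega>) + r \<omega>" for \<omega>
  proof -
    let ?F = "\<lambda>a. plugin_ustat n m f (\<lambda>j. \<theta> $ a + noise a j \<omega>)"
    have mean_eq: "sample_mean n (\<lambda>j. x j \<omega>) a = \<theta> $ a + ?A a \<omega>" for a
      using n by (simp add: sample_mean_def signed_mean_def noise_def sum_subtractf diff_divide_distrib)
    have x_eq: "(\<lambda>j. x j \<omega> $ a) = (\<lambda>j. \<theta> $ a + noise a j \<omega>)" for a by (simp add: noise_def)
    have F0: "?F a (\<theta> $ a) = f (\<theta> $ a) + (\<Sum>k\<in>{1..m}. nth_deriv k f (\<theta> $ a) / fact k * complex_of_real (ustat n k (\<lambda>j. noise a j \<omega>)))" for a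
    proof -
      have "{..m} = insert 0 {1..m}" by auto
      then show ?thesis by (simp add: plugin_ustat_def)
    qed
    let ?i = "complex_of_real (1 / real d)"
    \<comment> \<open>The summands are, in this order, the remainder, the fluctuation and the
      bias.\<close>
    have split: "estimator n m f (\<lambda>j. x j \<omega>) - complex_of_real ((\<Sum>a\<in>UNIV. \<bar>\<theta> $ a\<bar>) / real d)
      = (\<Sum>a\<in>UNIV. ?i * (?F a (\<theta> $ a + ?A a \<omega>) - ?F a (\<theta> $ a))) + Z \<omega> + (\<Sum>a\<in>UNIV. ?i * (f (\<theta> $ a) - complex_of_real \<bar>\<theta> $ a\<bar>))"
    proof -
      have est: "estimator n m f (\<lambda>j. x j \<omega>) = (\<Sum>a\<in>UNIV. ?i * ?F a (\<theta> $ a + ?A a \<omega>))"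
        unfolding estimator_eq[OF n mn(2,1)] x_eq mean_eq d(1) sum_distrib_left ..
      have th: "complex_of_real ((\<Sum>a\<in>UNIV. \<bar>\<theta> $ a\<bar>) / real d) = (\<Sum>a\<in>UNIV. ?i * complex_of_real \<bar>\<theta> $ a\<bar>)"
        by (simp add: sum_divide_distrib)
      have Zeq: "Z \<omega> = (\<Sum>a\<in>UNIV. ?i * (?F a (\<theta> $ a) - f (\<theta> $ a)))"
        unfolding Z_def g_def F0 by (simp add: sum_distrib_left sum_divide_distrib mult_ac)
      show ?thesis unfolding est th Zeq sum_subtractf[symmetric] sum.distrib[symmetric]
        by (intro sum.cong refl) (simp only: right_diff_distrib, simp)
    qed
    have "norm (\<Sum>a\<in>UNIV. ?i * (?F a (\<theta> $ a + ?A a \<omega>) - ?F a (\<theta> $ a))) \<le> r \<omega>"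
      unfolding r_def
    proof (intro order_trans[OF norm_sum] sum_mono)
      fix a :: 'd
      have "norm (?F a (\<theta> $ a + ?A a \<omega>) - ?F a (\<theta> $ a)) \<le> c / fact m * ?D a \<omega>"
        by (rule plugin_ustat_remainder[OF mn(1) D]) (use bnd[of s] mn m in \<open>auto simp: c_def\<close>)
      then show "norm (?i * (?F a (\<theta> $ a + ?A a \<omega>) - ?F a (\<theta> $ a))) \<le> 1 / real d * (c / fact m * ?D a \<omega>)"
        unfolding norm_mult norm_of_real using d0 by (intro mult_mono) auto
    qed
    moreover have "norm (\<Sum>a\<in>UNIV. ?i * (f (\<theta> $ a) - complex_of_real \<bar>\<theta> $ a\<bar>)) \<le> C * h"
    proof -
      have "norm (\<Sum>a\<in>UNIV. ?i * (f (\<theta> $ a) - complex_of_real \<bar>\<theta> $ a\<bar>)) \<le> (\<Sum>a\<in>(UNIV :: 'd set). 1 / real d * (C * h))"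
      proof (intro order_trans[OF norm_sum] sum_mono)
        fix a :: 'd
        show "norm (?i * (f (\<theta> $ a) - complex_of_real \<bar>\<theta> $ a\<bar>)) \<le> 1 / real d * (C * h)"
          unfolding norm_mult norm_of_real using d0 bias[of "\<theta> $ a"] by (intro mult_mono) auto
      qed
      then show ?thesis unfolding sum_const .
    qed
    ultimately show ?thesis unfolding err_def split
      by (intro order_trans[OF norm_triangle_ineq] order_trans[OF add_right_mono[OF norm_triangle_ineq]]) linarith
  qed
  have Zint: "integrable M (\<lambda>\<omega>. (norm (Z \<omega>))\<^sup>2)"
    unfolding Z_def by (rule ustat_noise_second_moment(1)[OF _ n mn(1) nk]) (use s320 in auto)
  have Zexp: "expectation (\<lambda>\<omega>. (norm (Z \<omega>))\<^sup>2) \<le> (C * h * sqrt (2 / ln (real d)))\<^sup>2"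
  proof -
    have "expectation (\<lambda>\<omega>. (norm (Z \<omega>))\<^sup>2) \<le> (\<Sum>a\<in>UNIV. \<Sum>k\<in>{1..m}. (norm (g a k))\<^sup>2 * (2 * fact k * \<sigma> ^ (2 * k)))"
      unfolding Z_def by (rule ustat_noise_second_moment(2)[OF _ n mn(1) nk]) (use s320 in auto)
    \<comment> \<open>Of the factor \<open>1 / d^2\<close>, one \<open>1 / d\<close> is consumed by
      the sum over the coordinates. The other meets the series in
      \<open>L = (\<sigma> / h)^2\<close>, bounded by \<open>exp L = d / ln d\<close>, and leaves
      \<open>1 / ln d\<close>.\<close>
    also have "\<dots> \<le> (\<Sum>a\<in>(UNIV :: 'd set). \<Sum>k\<in>{1..m}. 1 / real d * (2 * (C * h)\<^sup>2 / real d * (L ^ k / fact k)))"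
    proof (intro sum_mono)
      fix a :: 'd and k assume k: "k \<in> {1..m}"
      have hk: "h * h ^ (k - 1) = h ^ k" using k by (simp flip: power_Suc)
      have "norm (g a k) = 1 / real d * (norm (nth_deriv k f (\<theta> $ a)) / fact k)"
        using d0 by (simp add: g_def norm_mult norm_divide)
      also have "\<dots> \<le> 1 / real d * (C / h ^ (k - 1) / fact k)"
        using k d0 m by (intro mult_left_mono divide_right_mono bnd) auto
      also have "C / h ^ (k - 1) = C * h / h ^ k" using h0 unfolding hk[symmetric] by simp
      finally have "(norm (g a k))\<^sup>2 \<le> (1 / real d * (C * h / h ^ k / fact k))\<^sup>2" by (intro power_mono) auto
      then have "(norm (g a k))\<^sup>2 * (2 * fact k * \<sigma> ^ (2 * k)) \<le> (1 / real d * (C * h / h ^ k / fact k))\<^sup>2 * (2 * fact k * \<sigma> ^ (2 * k))"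
        using noise_level by (intro mult_right_mono) auto
      also have "\<dots> = 1 / real d * (2 * (C * h)\<^sup>2 / real d * ((\<sigma> ^ (2 * k) / (h ^ k)\<^sup>2) / fact k))"
        using d0 h0 by (simp add: power2_eq_square field_simps)
      also have "\<sigma> ^ (2 * k) / (h ^ k)\<^sup>2 = L ^ k"
      proof -
        have "\<sigma> ^ (2 * k) / (h ^ k)\<^sup>2 = (\<sigma>\<^sup>2 / h\<^sup>2) ^ k"
          by (simp add: power_divide power_mult[symmetric] mult.commute)
        also have "\<sigma>\<^sup>2 = L * h\<^sup>2" using h2 L1 by simp
        also have "L * h\<^sup>2 / h\<^sup>2 = L" using h0 by simp
        finally show ?thesis .
      qed
      finally show "(norm (g a k))\<^sup>2 * (2 * fact k * \<sigma> ^ (2 * k)) \<le> 1 / real d * (2 * (C * h)\<^sup>2 / real d * (L ^ k / fact k))" .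
    qed
    also have "\<dots> = 2 * (C * h)\<^sup>2 / real d * (\<Sum>k\<in>{1..m}. L ^ k / fact k)"
    proof -
      have "(\<Sum>k\<in>{1..m}. 1 / real d * (2 * (C * h)\<^sup>2 / real d * (L ^ k / fact k)))
          = 1 / real d * (2 * (C * h)\<^sup>2 / real d * (\<Sum>k\<in>{1..m}. L ^ k / fact k))"
        by (simp only: sum_distrib_left)
      then show ?thesis by (simp only: sum_const)
    qed
    also have "\<dots> \<le> 2 * (C * h)\<^sup>2 / real d * exp L"
      using L1 d0 by (intro mult_left_mono sum_power_div_fact_le_exp) auto
    also have "\<dots> = (C * h)\<^sup>2 * (2 / ln (real d))"
      unfolding expL using d0 by simp
    also have "\<dots> = (C * h * sqrt (2 / ln (real d)))\<^sup>2"
      using lnd by (simp only: power_mult_distrib) simp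
    finally show ?thesis .
  qed
  have Dint: "integrable M (\<lambda>\<omega>. (?D a \<omega>)\<^sup>2)"
    and Dexp: "expectation (\<lambda>\<omega>. (?D a \<omega>)\<^sup>2) \<le> (1 + exp 1) ^ (2 * m) * (4 * (\<sigma> ^ (2 * s) * 8 ^ s * fact s))" for a
    by (rule remainder_second_moment[OF n _ s_le m nk]; use s320 in simp)+
  let ?w = "\<lambda>\<omega>. \<Sum>a\<in>(UNIV :: 'd set). 1 / real d * ((c / fact m)\<^sup>2 * (?D a \<omega>)\<^sup>2)"
  \<comment> \<open>Jensen over the coordinates, with no gain in \<open>d\<close>: the absolute
    values in \<open>?D\<close> have destroyed orthogonality.\<close>
  have r2: "(r \<omega>)\<^sup>2 \<le> ?w \<omega>" for \<omega>
  proof -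
    have "(r \<omega>)\<^sup>2 \<le> (\<Sum>a\<in>(UNIV :: 'd set). 1 / real d) * (\<Sum>a\<in>(UNIV :: 'd set). 1 / real d * (c / fact m * ?D a \<omega>)\<^sup>2)"
      unfolding r_def by (rule weighted_sum_square_le) simp
    also have "(\<Sum>a\<in>(UNIV :: 'd set). 1 / real d) = 1" using sum_const[of 1] by simp
    finally show ?thesis by (simp only: power_mult_distrib mult_1_left)
  qed
  have wint: "integrable M ?w" using Dint by (intro Bochner_Integration.integrable_sum integrable_mult_right) auto
  have rint: "integrable M (\<lambda>\<omega>. (r \<omega>)\<^sup>2)"
  proof (rule Bochner_Integration.integrable_bound[OF wint])
    show "(\<lambda>\<omega>. (r \<omega>)\<^sup>2) \<in> borel_measurable M"
      unfolding r_def using signed_mean_measurable ustat_noise_measurable by measurable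
    show "AE \<omega> in M. norm ((r \<omega>)\<^sup>2) \<le> norm (?w \<omega>)"
      using r2 by (intro AE_I2) (auto intro: order_trans[OF _ abs_ge_self])
  qed
  have rexp: "expectation (\<lambda>\<omega>. (r \<omega>)\<^sup>2) \<le> (C * h * real s powr (- 1 / 4))\<^sup>2"
  proof -
    let ?H = "(1 + exp 1) ^ (2 * m) * (4 * (\<sigma> ^ (2 * s) * 8 ^ s * fact s)) :: real"
    have "expectation (\<lambda>\<omega>. (r \<omega>)\<^sup>2) \<le> expectation ?w" by (intro integral_mono rint wint r2)
    also have "\<dots> = (\<Sum>a\<in>(UNIV :: 'd set). 1 / real d * ((c / fact m)\<^sup>2 * expectation (\<lambda>\<omega>. (?D a \<omega>)\<^sup>2)))"
      using Dint by (subst Bochner_Integration.integral_sum) auto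
    also have "\<dots> \<le> (\<Sum>a\<in>(UNIV :: 'd set). 1 / real d * ((c / fact m)\<^sup>2 * ?H))"
      using d0 by (intro sum_mono mult_left_mono Dexp) auto
    also have "\<dots> = (c / fact m)\<^sup>2 * ?H" by (rule sum_const)
    also have "\<dots> = (C * h)\<^sup>2 * (L ^ s / (fact (s - 1))\<^sup>2 * ((1 + exp 1) ^ (2 * (s - 1)) * (4 * (8 ^ s * fact s))))"
    proof -
      have "\<sigma> ^ (2 * s) = L ^ s * h ^ (2 * s)"
      proof -
        have "\<sigma>\<^sup>2 = L * h\<^sup>2" using h2 L1 by simp
        then show ?thesis by (simp add: power_mult power_mult_distrib)
      qed
      moreover have "h ^ (2 * s) = h\<^sup>2 * (h ^ m)\<^sup>2"
        unfolding mn(3)[symmetric] by (simp add: power_mult[symmetric] mult.commute flip: power_add)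
      ultimately have "c\<^sup>2 * \<sigma> ^ (2 * s) = (C * h)\<^sup>2 * L ^ s"
        using h0 by (simp add: c_def power_divide power_mult_distrib)
      then have "(c / fact m)\<^sup>2 * ((1 + exp 1) ^ (2 * m) * (4 * (\<sigma> ^ (2 * s) * 8 ^ s * fact s)))
          = ((C * h)\<^sup>2 * L ^ s) / (fact m)\<^sup>2 * ((1 + exp 1) ^ (2 * m) * (4 * (8 ^ s * fact s)))"
        by (simp only: power_divide times_divide_eq_left times_divide_eq_right mult_ac) (simp add: mult_ac)
      then show ?thesis using m by simp
    qed
    also have "\<dots> \<le> (C * h)\<^sup>2 * real s powr (- 1 / 2)"
      using L1 Ls by (intro mult_left_mono remainder_constant_le s320) auto
    also have "real s powr (- 1 / 2) = (real s powr (- 1 / 4))\<^sup>2"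
      using s320 by (simp add: powr_numeral[symmetric] powr_powr)
    finally show ?thesis by (simp only: power_mult_distrib)
  qed
  have meas: "err \<in> borel_measurable M"
  proof -
    have "(\<lambda>\<omega>. estimator n m f (\<lambda>j. x j \<omega>)) \<in> borel_measurable M"
      using has_vector_derivative_imp_continuous_on[OF D] by (intro estimator_measurable n mn) auto
    then show ?thesis unfolding err_def by measurable
  qed
  have pos: "C * h * sqrt (2 / ln (real d)) > 0" "C * h * real s powr (- 1 / 4) > 0"
    using Ch lnd s320 by auto
  have abs_err: "\<bar>err \<omega>\<bar> \<le> C * h + norm (Z \<omega>) + r \<omega>" for \<omega>
    using err_le[of \<omega>] by (simp add: err_def)
  note fin = second_moment_sum3_le[OF less_imp_le[OF Ch] pos meas abs_err Zint Zexp rint rexp]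
  show "integrable M (\<lambda>\<omega>. (err \<omega>)\<^sup>2)" by (rule fin(1))
  have "expectation (\<lambda>\<omega>. (err \<omega>)\<^sup>2) \<le> (C * h + C * h * sqrt (2 / ln (real d)) + C * h * real s powr (- 1 / 4))\<^sup>2"
    by (rule fin(2))
  also have "\<dots> = ((1 + sqrt (2 / ln (real d)) + real s powr (- 1 / 4)) * (C * h))\<^sup>2"
    by (simp add: algebra_simps)
  also have "\<dots> = (1 + sqrt (2 / ln (real d)) + real s powr (-1/4))\<^sup>2 * (C\<^sup>2 * \<sigma>\<^sup>2 / ln (real d / ln (real d)))"
    unfolding power_mult_distrib h2 L_def by simp
  finally show "expectation (\<lambda>\<omega>. (err \<omega>)\<^sup>2) \<le> \<dots>" .
qed

theorem theorem5p3:
  fixes n d s m :: nat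
    and \<sigma> C\<^sub>1 h :: real
    and M :: "'w measure"
    and \<theta> :: "real ^ 'd::finite"
    and x :: "nat \<Rightarrow> 'w \<Rightarrow> real ^ 'd"
    and \<epsilon>' :: "nat \<Rightarrow> 'w \<Rightarrow> real"
    and K :: "real \<Rightarrow> complex"
  assumes "d = CARD('d)" and "d \<ge> 2"
    and "s = nat \<lceil>2 ^ 7 * exp 1 * ln (real d / ln (real d))\<rceil>"
  shows
    "(n \<ge> 1 \<and> m = s - 1 \<and> real s \<le> sqrt (real n / 2 * ln 2) \<and>
      noisy_observations M n s \<theta> \<sigma> x \<epsilon>' \<and>
      h = \<sigma> / sqrt (ln (real d / ln (real d))) \<and>
      kernel_condition C\<^sub>1 s K
      \<longrightarrow>
      (let f_hat = \<lambda>\<omega>. estimator n m (smoothing K h (\<lambda>t. \<bar>t\<bar>)) (\<lambda>j. x j \<omega>);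
           f_theta = (\<Sum>a\<in>UNIV. \<bar>\<theta> $ a\<bar>) / real d
       in integrable M (\<lambda>\<omega>. (norm (f_hat \<omega> - complex_of_real f_theta))\<^sup>2) \<and>
          (LINT \<omega>|M. (norm (f_hat \<omega> - complex_of_real f_theta))\<^sup>2)
            \<le> (1 + sqrt (2 / ln (real d)) + real s powr (-1/4))\<^sup>2 *
               (C\<^sub>1\<^sup>2 * \<sigma>\<^sup>2 / ln (real d / ln (real d)))))
     \<and>
     (\<forall>Q. fourier_window C\<^sub>1 Q \<and> K = fourier_inversion Q \<longrightarrow> kernel_condition C\<^sub>1 s K)"
  using noisy_observations.estimator_risk_bound[OF _ assms, of M n \<theta> \<sigma> x \<epsilon>' m h C\<^sub>1 K]
    fourier_window_kernel_condition[of C\<^sub>1 _ K s]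
  unfolding Let_def by blast

end
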